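(* Let $(\mathbb{U}_t : 0\le t\le 1)$ be a standard Brownian bridge and let $M^+=\max_{0\le t\le 1}\mathbb{U}_t$ and $M^-=-\min_{0\le t\le 1}\mathbb{U}_t$. Let $K=M^++M^-$, $L=M^+-M^-$ and $Q=M^+/M^-$, with distribution functions $F_K,F_L,F_Q$ respectively. Then: (i) For every $\theta>0$, if $\gamma\sim\Gamma(1/2,\theta)$ is independent of $\mathbb{U}$, then for all $x,y>0$ $$P(\sqrt{\gamma}\,M^+\le x,\ \sqrt{\gamma}\,M^-\le y)=\frac{\sqrt{2\theta}}{\sqrt{2\theta}+m(x)+m(y)}=\coth\big((x+y)\sqrt{2\theta}\big)-\frac{\cosh\big((x-y)\sqrt{2\theta}\big)}{\sinh\big((x+y)\sqrt{2\theta}\big)},$$ where $m(x)=\dfrac{\sqrt{2\theta}\,e^{-2x\sqrt{2\theta}}}{1-e^{-2x\sqrt{2\theta}}}$ for $x>0$. (ii) For all $x>0$, $$F_K(x)=P(M^++M^-\le x)=\sum_{k=-\infty}^{\infty}(1-4k^2x^2)\,e^{-2k^2x^2}.$$ (iii) For all $x>0$, $$1-F_L(x)=P(M^+-M^-\ge x)=\sum_{k=1}^{\infty}\frac{1}{4k^2-1}\,e^{-2k^2x^2}.$$ (iv) For all $x>0$, $$F_Q(x)=P(Q\le x)=\frac{1}{x+1}\left(1-\frac{\pi x\cot\left(\frac{\pi x}{x+1}\right)}{x+1}\right).$$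
   Context: A standard Brownian bridge on $[0,1]$ is standard Brownian motion on $[0,1]$ conditioned to be $0$ at time $1$ (the centered continuous Gaussian process with covariance $\min(s,t)-st$). $\Gamma(a,b)$ denotes the Gamma distribution with density $\frac{b(bx)^{a-1}}{\Gamma(a)}e^{-bx}$ on $(0,\infty)$ (so $b$ is the rate). $M^-$ is almost surely strictly positive, so $Q$ is almost surely well defined. *)

theory Defs
  imports "HOL-Probability.Probability"
begin

definition covar :: "'a measure \<Rightarrow> ('a \<Rightarrow> real) \<Rightarrow> ('a \<Rightarrow> real) \<Rightarrow> real" where
  "covar M X Y = (LINT \<omega>|M. (X \<omega> - (LINT \<omega>'|M. X \<omega>')) * (Y \<omega> - (LINT \<omega>'|M. Y \<omega>')))"

(* The second disjunct is the degenerate normal law (variance 0): normal_density has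
   no density interpretation at standard deviation 0. *)
definition gaussian_rv :: "'a measure \<Rightarrow> ('a \<Rightarrow> real) \<Rightarrow> bool" where
  "gaussian_rv M X \<longleftrightarrow> X \<in> borel_measurable M \<and>
     ((\<exists>\<mu> \<sigma>. 0 < \<sigma> \<and> distributed M lborel X (\<lambda>x. ennreal (normal_density \<mu> \<sigma> x))) \<or>
      (\<exists>\<mu>. AE \<omega> in M. X \<omega> = \<mu>))"

definition gaussian_process :: "'a measure \<Rightarrow> 'i set \<Rightarrow> ('i \<Rightarrow> 'a \<Rightarrow> real) \<Rightarrow> bool" where
  "gaussian_process M T X \<longleftrightarrow>
     (\<forall>J c. finite J \<and> J \<subseteq> T \<longrightarrow> gaussian_rv M (\<lambda>\<omega>. \<Sum>t\<in>J. c t * X t \<omega>))"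

definition standard_brownian_bridge :: "'a measure \<Rightarrow> (real \<Rightarrow> 'a \<Rightarrow> real) \<Rightarrow> bool" where
  "standard_brownian_bridge M U \<longleftrightarrow>
     gaussian_process M {0..1} U \<and>
     (\<forall>t\<in>{0..1}. (LINT \<omega>|M. U t \<omega>) = 0) \<and>
     (\<forall>s\<in>{0..1}. \<forall>t\<in>{0..1}. covar M (U s) (U t) = min s t - s * t) \<and>
     (\<forall>\<omega>\<in>space M. continuous_on {0..1} (\<lambda>t. U t \<omega>))"

(* Paths of a bridge are continuous on the compact interval, so the supremum and
   infimum below are an attained maximum and minimum. *)
definition Mplus :: "(real \<Rightarrow> 'a \<Rightarrow> real) \<Rightarrow> 'a \<Rightarrow> real" where
  "Mplus U \<omega> = (SUP t\<in>{0..1}. U t \<omega>)"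

definition Mminus :: "(real \<Rightarrow> 'a \<Rightarrow> real) \<Rightarrow> 'a \<Rightarrow> real" where
  "Mminus U \<omega> = - (INF t\<in>{0..1}. U t \<omega>)"

definition bridge_K :: "(real \<Rightarrow> 'a \<Rightarrow> real) \<Rightarrow> 'a \<Rightarrow> real" where
  "bridge_K U \<omega> = Mplus U \<omega> + Mminus U \<omega>"

definition bridge_L :: "(real \<Rightarrow> 'a \<Rightarrow> real) \<Rightarrow> 'a \<Rightarrow> real" where
  "bridge_L U \<omega> = Mplus U \<omega> - Mminus U \<omega>"

(* On the null event where Mminus vanishes, HOL division gives the value 0. *)
definition bridge_Q :: "(real \<Rightarrow> 'a \<Rightarrow> real) \<Rightarrow> 'a \<Rightarrow> real" where
  "bridge_Q U \<omega> = Mplus U \<omega> / Mminus U \<omega>"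

(* Shape a, rate b. *)
definition gamma_density :: "real \<Rightarrow> real \<Rightarrow> real \<Rightarrow> real" where
  "gamma_density a b x =
     (if 0 < x then b * (b * x) powr (a - 1) / Gamma a * exp (- b * x) else 0)"

(* Independence of Y and the whole process (X t), t in T, i.e. of the sigma-algebras they
   generate, the process being a random element of the product space over T.
   prob_space.indep_var is not applicable since it needs Y and the process to take values
   in one type. *)
definition indep_of_process ::
    "'a measure \<Rightarrow> ('a \<Rightarrow> real) \<Rightarrow> 'i set \<Rightarrow> ('i \<Rightarrow> 'a \<Rightarrow> real) \<Rightarrow> bool" where
  "indep_of_process M Y T X \<longleftrightarrow>
     prob_space.indep_set M
       (sets (vimage_algebra (space M) Y borel))
       (sets (vimage_algebra (space M) (\<lambda>\<omega>. \<lambda>t\<in>T. X t \<omega>) (PiM T (\<lambda>_. borel))))"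

definition m_fun :: "real \<Rightarrow> real \<Rightarrow> real" where
  "m_fun \<theta> x = sqrt (2 * \<theta>) * exp (- 2 * x * sqrt (2 * \<theta>)) / (1 - exp (- 2 * x * sqrt (2 * \<theta>)))"

definition coth :: "real \<Rightarrow> real" where
  "coth x = cosh x / sinh x"

end

theory Submission
  imports Defs "HOL-Real_Asymp.Real_Asymp"
begin

text \<open>
  With \<open>W s = (1 + s) U (s / (1 + s))\<close> the bridge becomes a Gaussian process with the covariance of
  Brownian motion, and \<open>- a \<le> U \<le> b\<close> says that \<open>W\<close> stays between the lines \<open>- a (1 + s)\<close> and
  \<open>b (1 + s)\<close>. Following Doob, a signed sum over reflection images of the exponential martingales
  \<open>exp (m W s - m\<^sup>2 (1 + s) / 2)\<close> vanishes on both lines and tends to 1 between them as \<open>s\<close> grows, so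
  optional stopping identifies its initial value with \<open>P(M\<^sup>- \<le> a, M\<^sup>+ \<le> b)\<close>. Stopping is carried
  out on dyadic grids, where the overshoot past a line is controlled by a fourth moment of the
  increments; thus neither continuous-time stopping nor a strong Markov property is needed.

  Mixing the resulting series over \<open>\<gamma>\<close> termwise gives geometric series, which is (i). For (ii)-(iv) let
  \<open>G(a, b)\<close> be the joint distribution function and \<open>g\<close> its derivative in \<open>a\<close>. For a monotone curve
  \<open>\<phi>\<close>, the function \<open>\<beta> \<mapsto> P(\<alpha> < M\<^sup>- \<le> \<beta>, M\<^sup>+ \<le> \<phi> M\<^sup>-)\<close> has derivative \<open>g (\<beta>, \<phi> \<beta>)\<close>, and along the lines
  \<open>x - a\<close>, \<open>a + x\<close>, \<open>x a\<close> this has an explicit primitive term by term.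
\<close>

subsection \<open>Weighted laws and characteristic functions\<close>

text \<open>The Gaussian hypothesis speaks of one linear combination at a time, whereas stopping
  multiplies an exponential of an increment by indicators of the past. Independence of the increment
  from the past therefore has to be extracted from characteristic functions: weights that give the
  same integrals against all characters of \<open>X\<close> give the same integrals against all
  functions of \<open>X\<close>. Stopping on a grid has two competing errors. Small overshoots are
  paid for once per path, because exit probabilities telescope; large ones are paid for at every
  step, so their cost per step must be of smaller order than the mesh. For the three laws the work
  lies in exchanging limits with the series. For the quotient this is delicate: as \<open>a\<close>
  tends to 0 along \<open>b = x a\<close>, the Gaussian factors lose all decay in \<open>n\<close>,
  and domination comes only from cancellation among the four terms, which leaves order
  \<open>1 / n^2\<close>.\<close>

lemma (in prob_space) distr_density_eqI_char:
  fixes f1 f2 X :: "'a \<Rightarrow> real"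
  assumes [measurable]: "X \<in> borel_measurable M"
    and int: "integrable M f1" "integrable M f2"
    and nn: "\<And>\<omega>. 0 \<le> f1 \<omega>" "\<And>\<omega>. 0 \<le> f2 \<omega>"
    and eq: "\<And>c. (CLINT \<omega>|M. of_real (f1 \<omega>) * iexp (c * X \<omega>)) = (CLINT \<omega>|M. of_real (f2 \<omega>) * iexp (c * X \<omega>))"
  shows "distr (density M f1) borel X = distr (density M f2) borel X"
proof -
  have [measurable]: "f1 \<in> borel_measurable M" "f2 \<in> borel_measurable M"
    using int by auto
  define \<kappa> where "\<kappa> = expectation f1"
  have "complex_of_real (expectation f1) = of_real (expectation f2)"
    using eq[of 0] by simp
  then have \<kappa>2: "\<kappa> = expectation f2" by (simp add: \<kappa>_def)
  have "\<kappa> \<ge> 0" by (simp add: \<kappa>_def nn)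
  show ?thesis
  proof (cases "\<kappa> = 0")
    case True
    then have "AE \<omega> in M. f1 \<omega> = 0" "AE \<omega> in M. f2 \<omega> = 0"
      using integral_nonneg_eq_0_iff_AE[OF int(1)] integral_nonneg_eq_0_iff_AE[OF int(2)] nn \<kappa>_def \<kappa>2 by auto
    then have "AE \<omega> in M. ennreal (f1 \<omega>) = ennreal (f2 \<omega>)" by eventually_elim simp
    then have "density M f1 = density M f2" by (intro density_cong) auto
    then show ?thesis by simp
  next
    case False
    with \<open>\<kappa> \<ge> 0\<close> have \<kappa>: "\<kappa> > 0" by simp
    \<comment> \<open>Dividing by the total mass \<open>\<kappa>\<close>, common to both weights by
      the case \<open>c = 0\<close>, gives probability laws, to which Levy uniqueness
      applies.\<close>
    have rd: "real_distribution (distr (density M (\<lambda>\<omega>. f \<omega> / \<kappa>)) borel X)"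
      and ch: "char (distr (density M (\<lambda>\<omega>. f \<omega> / \<kappa>)) borel X) c =
        (CLINT \<omega>|M. of_real (f \<omega>) * iexp (c * X \<omega>)) / \<kappa>"
      and em: "A \<in> sets borel \<Longrightarrow> emeasure (distr (density M f) borel X) A =
         ennreal \<kappa> * emeasure (distr (density M (\<lambda>\<omega>. f \<omega> / \<kappa>)) borel X) A"
      if [measurable]: "f \<in> borel_measurable M" and f: "integrable M f" "\<And>\<omega>. 0 \<le> f \<omega>" "expectation f = \<kappa>"
      for f c A
    proof -
      have "emeasure (density M (\<lambda>\<omega>. f \<omega> / \<kappa>)) (space M) = (\<integral>\<^sup>+\<omega>. f \<omega> / \<kappa> \<partial>M)"
        by (subst emeasure_density) (auto intro!: nn_integral_cong simp: indicator_def)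
      also have "\<dots> = ennreal (\<integral>\<omega>. f \<omega> / \<kappa> \<partial>M)"
        using f \<kappa> by (intro nn_integral_eq_integral) auto
      also have "\<dots> = 1" using f(3) \<kappa> by simp
      finally interpret D: prob_space "density M (\<lambda>\<omega>. f \<omega> / \<kappa>)"
        by (intro prob_spaceI) simp
      show "real_distribution (distr (density M (\<lambda>\<omega>. f \<omega> / \<kappa>)) borel X)"
        by (auto simp: real_distribution_def real_distribution_axioms_def intro!: D.prob_space_distr)
      show "char (distr (density M (\<lambda>\<omega>. f \<omega> / \<kappa>)) borel X) c =
        (CLINT \<omega>|M. of_real (f \<omega>) * iexp (c * X \<omega>)) / \<kappa>"
        unfolding char_def
        by (subst integral_distr) (use f \<kappa> in \<open>simp_all add: integral_density scaleR_conv_of_real\<close>)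
      assume [measurable]: "A \<in> sets borel"
      show "emeasure (distr (density M f) borel X) A =
         ennreal \<kappa> * emeasure (distr (density M (\<lambda>\<omega>. f \<omega> / \<kappa>)) borel X) A"
        using \<kappa> f(2)
        by (simp add: emeasure_distr emeasure_density nn_integral_cmult[symmetric] mult.assoc[symmetric] ennreal_mult'[symmetric])
    qed
    have "distr (density M (\<lambda>\<omega>. f1 \<omega> / \<kappa>)) borel X = distr (density M (\<lambda>\<omega>. f2 \<omega> / \<kappa>)) borel X"
    proof (intro Levy_uniqueness rd ext)
      show "char (distr (density M (\<lambda>\<omega>. f1 \<omega> / \<kappa>)) borel X) c = char (distr (density M (\<lambda>\<omega>. f2 \<omega> / \<kappa>)) borel X) c" for c
        using int nn \<kappa>_def[symmetric] \<kappa>2[symmetric] eq[of c] by (subst (1 2) ch) simp_all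
    qed (use int nn \<kappa>_def[symmetric] \<kappa>2[symmetric] in auto)
    then show ?thesis
      using int nn \<kappa>_def \<kappa>2 by (intro measure_eqI) (simp_all add: em)
  qed
qed

text \<open>Both sides are integrals of \<open>g\<close> against one and the same image measure, so
  unbounded \<open>g\<close> is covered as well; the exponential of an increment is the case
  needed.\<close>

lemma (in prob_space) expectation_weighted_eqI_char:
  fixes f1 f2 X :: "'a \<Rightarrow> real" and g :: "real \<Rightarrow> real"
  assumes [measurable]: "X \<in> borel_measurable M" "g \<in> borel_measurable borel"
    and int: "integrable M f1" "integrable M f2"
    and nn: "\<And>\<omega>. 0 \<le> f1 \<omega>" "\<And>\<omega>. 0 \<le> f2 \<omega>"
    and eq: "\<And>c. (CLINT \<omega>|M. of_real (f1 \<omega>) * iexp (c * X \<omega>)) = (CLINT \<omega>|M. of_real (f2 \<omega>) * iexp (c * X \<omega>))"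
  shows "expectation (\<lambda>\<omega>. f1 \<omega> * g (X \<omega>)) = expectation (\<lambda>\<omega>. f2 \<omega> * g (X \<omega>))"
proof -
  have [measurable]: "f1 \<in> borel_measurable M" "f2 \<in> borel_measurable M"
    using int by auto
  have "expectation (\<lambda>\<omega>. f \<omega> * g (X \<omega>)) = (\<integral>x. g x \<partial>distr (density M f) borel X)"
    if "f \<in> borel_measurable M" "\<And>\<omega>. 0 \<le> f \<omega>" for f :: "'a \<Rightarrow> real"
    using that by (simp add: integral_distr integral_density)
  then show ?thesis
    using distr_density_eqI_char[OF assms(1) int nn eq] nn by simp
qed

lemma (in prob_space) integrable_bounded:
  fixes f :: "'a \<Rightarrow> 'b::{banach,second_countable_topology}"
  assumes "f \<in> borel_measurable M" "\<And>\<omega>. norm (f \<omega>) \<le> B"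
  shows "integrable M f"
  using assms by (intro integrable_const_bound[of f B]) auto

text \<open>The assumption is stable under conjugation of \<open>Z\<close> (replace \<open>c\<close>
  by \<open>- c\<close>), hence passes to real and imaginary parts. A real weight bounded by
  \<open>C\<close> becomes nonnegative after adding \<open>C\<close>.\<close>

lemma (in prob_space) expectation_times_eq_0I_char:
  fixes Z :: "'a \<Rightarrow> complex" and g :: "real \<Rightarrow> real"
  assumes [measurable]: "Z \<in> borel_measurable M" "X \<in> borel_measurable M" "g \<in> borel_measurable borel"
    and Z: "\<And>\<omega>. cmod (Z \<omega>) \<le> C" and g: "\<And>x. \<bar>g x\<bar> \<le> C'"
    and zero: "\<And>c. (CLINT \<omega>|M. Z \<omega> * iexp (c * X \<omega>)) = 0"
  shows "(CLINT \<omega>|M. Z \<omega> * of_real (g (X \<omega>))) = 0"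
proof -
  have "C \<ge> 0" using Z[of undefined] norm_ge_zero order_trans by blast
  have [measurable]: "cnj \<in> borel_measurable borel"
    by (intro borel_measurable_continuous_onI continuous_intros)
  have intZ: "integrable M Z" and intZe: "integrable M (\<lambda>\<omega>. Z \<omega> * iexp (c * X \<omega>))"
    and intcZe: "integrable M (\<lambda>\<omega>. cnj (Z \<omega>) * iexp (c * X \<omega>))" for c
    using Z by (auto intro!: integrable_bounded[where B=C] simp: norm_mult)
  have zero': "(CLINT \<omega>|M. cnj (Z \<omega>) * iexp (c * X \<omega>)) = 0" for c
  proof -
    have "(CLINT \<omega>|M. cnj (Z \<omega>) * iexp (c * X \<omega>)) = (CLINT \<omega>|M. cnj (Z \<omega> * iexp ((- c) * X \<omega>)))"
      by (intro Bochner_Integration.integral_cong) (auto simp: exp_cnj)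
    also have "\<dots> = cnj (CLINT \<omega>|M. Z \<omega> * iexp ((- c) * X \<omega>))"
      by (simp only: Bochner_Integration.integral_cnj)
    finally show ?thesis using zero[of "- c"] by simp
  qed
  have real_case: "expectation (\<lambda>\<omega>. Y \<omega> * g (X \<omega>)) = 0"
    if Y[measurable]: "Y \<in> borel_measurable M" and Yb: "\<And>\<omega>. \<bar>Y \<omega>\<bar> \<le> C"
      and Y0: "\<And>c. (CLINT \<omega>|M. of_real (Y \<omega>) * iexp (c * X \<omega>)) = 0" for Y
  proof -
    \<comment> \<open>The nonnegative weights \<open>C + Y\<close> and \<open>C\<close> have equal
      integrals against every character.\<close>
    have 1: "expectation (\<lambda>\<omega>. (C + Y \<omega>) * g (X \<omega>)) = expectation (\<lambda>\<omega>. C * g (X \<omega>))"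
    proof (rule expectation_weighted_eqI_char[where g=g and X=X and ?f2.0="\<lambda>_. C"])
      have "integrable M Y" using Yb by (intro integrable_bounded) auto
      then show "integrable M (\<lambda>\<omega>. C + Y \<omega>)" by simp
      show "0 \<le> C + Y \<omega>" for \<omega> using Yb[of \<omega>] by linarith
      show "(CLINT \<omega>|M. complex_of_real (C + Y \<omega>) * iexp (c * X \<omega>)) = (CLINT \<omega>|M. complex_of_real C * iexp (c * X \<omega>))" for c
      proof -
        have "integrable M (\<lambda>\<omega>. complex_of_real (Y \<omega>) * iexp (c * X \<omega>))"
          using Yb by (intro integrable_bounded[where B=C]) (auto simp: norm_mult)
        moreover have "integrable M (\<lambda>\<omega>. complex_of_real C * iexp (c * X \<omega>))"
          using \<open>C \<ge> 0\<close> by (intro integrable_bounded[where B=C]) (auto simp: norm_mult)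
        ultimately show ?thesis using Y0[of c] by (simp add: distrib_right)
      qed
    qed (use \<open>C \<ge> 0\<close> in auto)
    have "integrable M (\<lambda>\<omega>. Y \<omega> * g (X \<omega>))"
      using Yb g \<open>C \<ge> 0\<close> by (auto intro!: integrable_bounded[where B="C * C'"] mult_mono simp: abs_mult)
    moreover have "integrable M (\<lambda>\<omega>. g (X \<omega>))"
      using g by (auto intro!: integrable_bounded[where B="C'"])
    ultimately show ?thesis using 1 by (simp add: distrib_right)
  qed
  have re: "expectation (\<lambda>\<omega>. Re (Z \<omega>) * g (X \<omega>)) = 0"
  proof (rule real_case)
    show "\<bar>Re (Z \<omega>)\<bar> \<le> C" for \<omega> using abs_Re_le_cmod[of "Z \<omega>"] Z[of \<omega>] by linarith
    have eq: "of_real (Re z) * w = (z * w + cnj z * w) / 2" for z w :: complex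
      by (simp add: complex_eq_iff field_simps)
    show "(CLINT \<omega>|M. of_real (Re (Z \<omega>)) * iexp (c * X \<omega>)) = 0" for c
      unfolding eq using zero[of c] zero'[of c] intZe[of c] intcZe[of c] by simp
  qed simp
  have im: "expectation (\<lambda>\<omega>. Im (Z \<omega>) * g (X \<omega>)) = 0"
  proof (rule real_case)
    show "\<bar>Im (Z \<omega>)\<bar> \<le> C" for \<omega> using abs_Im_le_cmod[of "Z \<omega>"] Z[of \<omega>] by linarith
    have eq: "of_real (Im z) * w = (z * w - cnj z * w) / (2 * \<i>)" for z w :: complex
      by (simp add: left_diff_distrib[symmetric] complex_diff_cnj) (simp add: complex_eq_iff)
    show "(CLINT \<omega>|M. of_real (Im (Z \<omega>)) * iexp (c * X \<omega>)) = 0" for c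
      unfolding eq using zero[of c] zero'[of c] intZe[of c] intcZe[of c] by simp
  qed simp
  have intg: "integrable M (\<lambda>\<omega>. Z \<omega> * of_real (g (X \<omega>)))"
    using Z g \<open>C \<ge> 0\<close> by (auto intro!: integrable_bounded[where B="C * C'"] mult_mono simp: norm_mult)
  show ?thesis
    using re im integral_Re[OF intg] integral_Im[OF intg]
    by (simp add: complex_eq_iff)
qed

text \<open>A constant with mean 0 is almost surely 0, so the degenerate law obeys the same formula
  with variance 0; only the density asks for positive variance.\<close>

lemma (in prob_space) centered_gaussian_rv:
  assumes X: "gaussian_rv M X" and mean: "expectation X = 0"
  shows centered_gaussian_rv_integrable: "integrable M (\<lambda>\<omega>. (X \<omega>)\<^sup>2)"
    and centered_gaussian_rv_char: "(CLINT \<omega>|M. iexp (X \<omega>)) = of_real (exp (- expectation (\<lambda>\<omega>. (X \<omega>)\<^sup>2) / 2))"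
    and centered_gaussian_rv_normal: "0 < expectation (\<lambda>\<omega>. (X \<omega>)\<^sup>2) \<Longrightarrow>
      distributed M lborel X (normal_density 0 (sqrt (expectation (\<lambda>\<omega>. (X \<omega>)\<^sup>2))))"
proof -
  have [measurable]: "X \<in> borel_measurable M" using X by (simp add: gaussian_rv_def)
  have "integrable M (\<lambda>\<omega>. (X \<omega>)\<^sup>2) \<and> (CLINT \<omega>|M. iexp (X \<omega>)) = of_real (exp (- expectation (\<lambda>\<omega>. (X \<omega>)\<^sup>2) / 2))
    \<and> (0 < expectation (\<lambda>\<omega>. (X \<omega>)\<^sup>2) \<longrightarrow>
      distributed M lborel X (normal_density 0 (sqrt (expectation (\<lambda>\<omega>. (X \<omega>)\<^sup>2)))))"
    using X unfolding gaussian_rv_def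
  proof (elim conjE disjE exE)
    fix \<mu> \<sigma> :: real assume \<sigma>: "0 < \<sigma>" and D: "distributed M lborel X (\<lambda>x. ennreal (normal_density \<mu> \<sigma> x))"
    have \<mu>: "\<mu> = 0" using normal_distributed_expectation[OF \<sigma> D] mean by simp
    have v: "expectation (\<lambda>\<omega>. (X \<omega>)\<^sup>2) = \<sigma>\<^sup>2"
      using normal_distributed_variance[OF \<sigma> D] mean by simp
    have "integrable M (\<lambda>\<omega>. (X \<omega> - \<mu>)^2)"
      using distributed_integrable[OF D, of "\<lambda>x. (x - \<mu>)^2"] integrable_normal_moment[OF \<sigma>, of \<mu> 2] by simp
    then have i: "integrable M (\<lambda>\<omega>. (X \<omega>)\<^sup>2)" using \<mu> by simp
    have D': "distributed M lborel (\<lambda>\<omega>. X \<omega> / \<sigma>) std_normal_density"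
      using D \<mu> normal_standard_normal_convert[OF \<sigma>, of X 0] by simp
    have "(CLINT \<omega>|M. iexp (X \<omega>)) = (CLINT \<omega>|M. iexp (\<sigma> * (X \<omega> / \<sigma>)))" using \<sigma> by simp
    also have "\<dots> = (CLINT x|distr M lborel (\<lambda>\<omega>. X \<omega> / \<sigma>). iexp (\<sigma> * x))"
      by (subst integral_distr) auto
    also have "\<dots> = char std_normal_distribution \<sigma>"
      unfolding char_def using distributed_distr_eq_density[OF D'] by simp
    finally show ?thesis using i v D \<mu> \<sigma> by (simp add: char_std_normal_distribution)
  next
    fix \<mu> assume c: "AE \<omega> in M. X \<omega> = \<mu>"
    have "expectation X = expectation (\<lambda>_. \<mu>)" using c by (intro integral_cong_AE) auto
    then have "\<mu> = 0" using mean by (simp add: prob_space)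
    with c have c: "AE \<omega> in M. X \<omega> = 0" by simp
    then have 2: "AE \<omega> in M. (X \<omega>)\<^sup>2 = 0" by eventually_elim simp
    then have i: "integrable M (\<lambda>\<omega>. (X \<omega>)\<^sup>2)" by (subst integrable_cong_AE[where g="\<lambda>_. 0"]) auto
    have v: "expectation (\<lambda>\<omega>. (X \<omega>)\<^sup>2) = 0"
      using 2 by (intro integral_eq_zero_AE)
    have "(CLINT \<omega>|M. iexp (X \<omega>)) = (CLINT \<omega>|M. 1)"
      by (intro integral_cong_AE) (use c in auto)
    then show ?thesis using i v by (simp add: prob_space)
  qed
  then show "integrable M (\<lambda>\<omega>. (X \<omega>)\<^sup>2)"
    "(CLINT \<omega>|M. iexp (X \<omega>)) = of_real (exp (- expectation (\<lambda>\<omega>. (X \<omega>)\<^sup>2) / 2))"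
    "0 < expectation (\<lambda>\<omega>. (X \<omega>)\<^sup>2) \<Longrightarrow>
      distributed M lborel X (normal_density 0 (sqrt (expectation (\<lambda>\<omega>. (X \<omega>)\<^sup>2))))"
    by auto
qed

subsection \<open>Gaussian processes with the covariance of Brownian motion\<close>

text \<open>Completing the square: the exponential weight moves the mean to
  \<open>m * \<sigma>\<^sup>2\<close>, and the prefactor is the moment generating function.\<close>

lemma normal_density_exp_shift:
  assumes "0 < \<sigma>"
  shows "normal_density 0 \<sigma> x * exp (m * x) = exp (m\<^sup>2 * \<sigma>\<^sup>2 / 2) * normal_density (m * \<sigma>\<^sup>2) \<sigma> x"
proof -
  have "- (x - 0)\<^sup>2 / (2 * \<sigma>\<^sup>2) + m * x = m\<^sup>2 * \<sigma>\<^sup>2 / 2 + (- (x - m * \<sigma>\<^sup>2)\<^sup>2 / (2 * \<sigma>\<^sup>2))"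
    using assms by (simp add: field_simps power2_eq_square)
  then show ?thesis
    unfolding normal_density_def by (simp add: exp_add[symmetric] mult_ac)
qed

lemma gaussian_processD:
  "gaussian_process M T X \<Longrightarrow> finite J \<Longrightarrow> J \<subseteq> T \<Longrightarrow> gaussian_rv M (\<lambda>\<omega>. \<Sum>t\<in>J. c t * X t \<omega>)"
  unfolding gaussian_process_def by simp

locale brownian_gaussian = prob_space M for M :: "'a measure" +
  fixes W :: "real \<Rightarrow> 'a \<Rightarrow> real"
  assumes gauss: "gaussian_process M {0..} W"
    and mean: "\<And>s. 0 \<le> s \<Longrightarrow> expectation (W s) = 0"
    and cov: "\<And>s t. 0 \<le> s \<Longrightarrow> 0 \<le> t \<Longrightarrow> expectation (\<lambda>\<omega>. W s \<omega> * W t \<omega>) = min s t"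
begin

lemma gaussian_comb: "finite J \<Longrightarrow> J \<subseteq> {0..} \<Longrightarrow> gaussian_rv M (\<lambda>\<omega>. \<Sum>t\<in>J. c t * W t \<omega>)"
  using gauss by (rule gaussian_processD)

lemma gaussian_W: "0 \<le> s \<Longrightarrow> gaussian_rv M (W s)"
  using gaussian_comb[of "{s}" "\<lambda>_. 1"] by simp

lemma measurable_W [measurable]: "0 \<le> s \<Longrightarrow> W s \<in> borel_measurable M"
  using gaussian_W by (simp add: gaussian_rv_def)

lemma integrable_W_mult:
  assumes "0 \<le> s" "0 \<le> t" shows "integrable M (\<lambda>\<omega>. W s \<omega> * W t \<omega>)"
proof (rule Bochner_Integration.integrable_bound)
  note [measurable] = measurable_W[OF assms(1)] measurable_W[OF assms(2)]
  show "integrable M (\<lambda>\<omega>. (W s \<omega>)\<^sup>2 + (W t \<omega>)\<^sup>2)"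
    using assms by (intro Bochner_Integration.integrable_add centered_gaussian_rv_integrable gaussian_W mean)
  have "\<bar>x * y\<bar> \<le> x\<^sup>2 + y\<^sup>2" for x y :: real
    using sum_squares_bound[of "\<bar>x\<bar>" "\<bar>y\<bar>"] by (simp add: abs_mult)
      (metis abs_ge_zero abs_mult add_increasing2 add.commute dual_order.trans mult.assoc mult_2 mult_nonneg_nonneg zero_le_power2 le_add_same_cancel1)
  then show "AE \<omega> in M. norm (W s \<omega> * W t \<omega>) \<le> norm ((W s \<omega>)\<^sup>2 + (W t \<omega>)\<^sup>2)" by simp
qed (use assms in simp)

lemma integrable_W: "0 \<le> s \<Longrightarrow> integrable M (W s)"
  using integrable_W_mult[of s s] square_integrable_imp_integrable[of "W s"]
  by (simp add: power2_eq_square)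

lemma centered_comb:
  assumes "finite J" "J \<subseteq> {0..}"
  shows "expectation (\<lambda>\<omega>. \<Sum>t\<in>J. c t * W t \<omega>) = 0"
  using assms by (subst Bochner_Integration.integral_sum) (auto intro!: integrable_W sum.neutral simp: mean subset_iff)

lemma increment:
  assumes "0 \<le> s" "s \<le> t"
  shows increment_square: "expectation (\<lambda>\<omega>. (W t \<omega> - W s \<omega>)\<^sup>2) = t - s"
    and increment_normal: "s < t \<Longrightarrow> distributed M lborel (\<lambda>\<omega>. W t \<omega> - W s \<omega>) (normal_density 0 (sqrt (t - s)))"
proof -
  have t: "0 \<le> t" using assms by simp
  have "expectation (\<lambda>\<omega>. (W t \<omega> - W s \<omega>)\<^sup>2) =
    expectation (\<lambda>\<omega>. W t \<omega> * W t \<omega> - 2 * (W s \<omega> * W t \<omega>) + W s \<omega> * W s \<omega>)"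
    by (intro Bochner_Integration.integral_cong) (auto simp: power2_eq_square algebra_simps)
  also have "\<dots> = t - s"
    using assms t by (simp add: integrable_W_mult cov)
  finally show sq: "expectation (\<lambda>\<omega>. (W t \<omega> - W s \<omega>)\<^sup>2) = t - s" .
  assume "s < t"
  have eq: "(\<lambda>\<omega>. \<Sum>l\<in>{s,t}. (if l = t then 1 else -1) * W l \<omega>) = (\<lambda>\<omega>. W t \<omega> - W s \<omega>)"
    using \<open>s < t\<close> by auto
  have "gaussian_rv M (\<lambda>\<omega>. W t \<omega> - W s \<omega>)" "expectation (\<lambda>\<omega>. W t \<omega> - W s \<omega>) = 0"
    using gaussian_comb[of "{s,t}" "\<lambda>l. if l = t then 1 else -1"] assms t
      centered_comb[of "{s,t}" "\<lambda>l. if l = t then 1 else -1"] unfolding eq by auto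
  from centered_gaussian_rv_normal[OF this] show "distributed M lborel (\<lambda>\<omega>. W t \<omega> - W s \<omega>) (normal_density 0 (sqrt (t - s)))"
    using sq \<open>s < t\<close> by simp
qed

text \<open>The increment is uncorrelated with the past, so the variance of the combination is a sum
  and its characteristic function a product.\<close>

lemma char_increment_past:
  assumes s: "0 \<le> s" "s < t" and J: "finite J" "J \<subseteq> {0..s}"
  shows "(CLINT \<omega>|M. iexp (u * (W t \<omega> - W s \<omega>) + (\<Sum>l\<in>J. c l * W l \<omega>))) =
    of_real (exp (- u\<^sup>2 * (t - s) / 2)) * (CLINT \<omega>|M. iexp (\<Sum>l\<in>J. c l * W l \<omega>))"
proof -
  let ?\<xi> = "\<lambda>\<omega>. W t \<omega> - W s \<omega>" and ?Y = "\<lambda>\<omega>. \<Sum>l\<in>J. c l * W l \<omega>"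
  let ?J = "insert t (insert s J)"
  \<comment> \<open>The point \<open>s\<close> may already lie in \<open>J\<close>, so coefficients
    are added by cases.\<close>
  let ?d = "\<lambda>l. (if l \<in> J then c l else 0) + u * ((if l = t then 1 else 0) - (if l = s then 1 else 0))"
  have t: "0 \<le> t" and J0: "J \<subseteq> {0..}" using s J by auto
  have fin: "finite ?J" "?J \<subseteq> {0..}" using s J by auto
  have eq: "(\<lambda>\<omega>. \<Sum>l\<in>?J. ?d l * W l \<omega>) = (\<lambda>\<omega>. u * ?\<xi> \<omega> + ?Y \<omega>)"
  proof
    fix \<omega>
    have "(\<Sum>l\<in>?J. ?d l * W l \<omega>) = (\<Sum>l\<in>?J. (if l \<in> J then c l * W l \<omega> else 0) +
        ((if l = t then u * W l \<omega> else 0) - (if l = s then u * W l \<omega> else 0)))"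
      by (intro sum.cong) (auto simp: algebra_simps)
    also have "\<dots> = (\<Sum>l\<in>?J. if l \<in> J then c l * W l \<omega> else 0) + (u * W t \<omega> - u * W s \<omega>)"
      unfolding sum.distrib sum_subtractf by (simp only: sum.delta[OF fin(1)] insert_iff simp_thms if_True)
    also have "(\<Sum>l\<in>?J. if l \<in> J then c l * W l \<omega> else 0) = ?Y \<omega>"
      using fin(1) by (subst sum.inter_restrict[symmetric]) (auto intro!: sum.cong)
    finally show "(\<Sum>l\<in>?J. ?d l * W l \<omega>) = u * ?\<xi> \<omega> + ?Y \<omega>" by (simp add: algebra_simps)
  qed
  have g: "gaussian_rv M (\<lambda>\<omega>. u * ?\<xi> \<omega> + ?Y \<omega>)" "expectation (\<lambda>\<omega>. u * ?\<xi> \<omega> + ?Y \<omega>) = 0"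
    using gaussian_comb[OF fin, of ?d] centered_comb[OF fin, of ?d] unfolding eq by auto
  have gY: "gaussian_rv M ?Y" "expectation ?Y = 0"
    using gaussian_comb[OF J(1) J0] centered_comb[OF J(1) J0] by auto
  have i\<xi>: "integrable M (\<lambda>\<omega>. (?\<xi> \<omega>)\<^sup>2)"
  proof -
    have "(?\<xi> \<omega>)\<^sup>2 = W t \<omega> * W t \<omega> - 2 * (W s \<omega> * W t \<omega>) + W s \<omega> * W s \<omega>" for \<omega>
      by (simp add: power2_eq_square algebra_simps)
    then show ?thesis using s t by (simp add: integrable_W_mult)
  qed
  have i\<xi>l: "integrable M (\<lambda>\<omega>. ?\<xi> \<omega> * (c l * W l \<omega>))" if "l \<in> J" for l
  proof -
    have "integrable M (\<lambda>\<omega>. c l * (W t \<omega> * W l \<omega> - W s \<omega> * W l \<omega>))"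
      using that s t J0 by (intro integrable_mult_right Bochner_Integration.integrable_diff integrable_W_mult) auto
    then show ?thesis by (simp add: algebra_simps)
  qed
  have i\<xi>Y: "integrable M (\<lambda>\<omega>. ?\<xi> \<omega> * ?Y \<omega>)"
    unfolding sum_distrib_left using i\<xi>l by (rule Bochner_Integration.integrable_sum)
  have "expectation (\<lambda>\<omega>. ?\<xi> \<omega> * ?Y \<omega>) = (\<Sum>l\<in>J. expectation (\<lambda>\<omega>. ?\<xi> \<omega> * (c l * W l \<omega>)))"
    unfolding sum_distrib_left using i\<xi>l by (rule Bochner_Integration.integral_sum)
  also have "\<dots> = (\<Sum>l\<in>J. c l * (expectation (\<lambda>\<omega>. W t \<omega> * W l \<omega>) - expectation (\<lambda>\<omega>. W s \<omega> * W l \<omega>)))"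
  proof (intro sum.cong refl)
    fix l assume "l \<in> J"
    then have l: "0 \<le> l" using J by auto
    have "expectation (\<lambda>\<omega>. ?\<xi> \<omega> * (c l * W l \<omega>)) = expectation (\<lambda>\<omega>. c l * (W t \<omega> * W l \<omega> - W s \<omega> * W l \<omega>))"
      by (intro Bochner_Integration.integral_cong) (auto simp: algebra_simps)
    then show "expectation (\<lambda>\<omega>. ?\<xi> \<omega> * (c l * W l \<omega>)) = c l * (expectation (\<lambda>\<omega>. W t \<omega> * W l \<omega>) - expectation (\<lambda>\<omega>. W s \<omega> * W l \<omega>))"
      using s t l by (simp add: integrable_W_mult)
  qed
  \<comment> \<open>For \<open>l \<le> s < t\<close> both covariances equal
    \<open>l\<close>.\<close>
  also have "\<dots> = 0"
    using s t J by (intro sum.neutral) (auto simp: cov subset_iff)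
  finally have zero: "expectation (\<lambda>\<omega>. ?\<xi> \<omega> * ?Y \<omega>) = 0" .
  have "expectation (\<lambda>\<omega>. (u * ?\<xi> \<omega> + ?Y \<omega>)\<^sup>2) =
    expectation (\<lambda>\<omega>. u\<^sup>2 * (?\<xi> \<omega>)\<^sup>2 + 2 * u * (?\<xi> \<omega> * ?Y \<omega>) + (?Y \<omega>)\<^sup>2)"
    by (intro Bochner_Integration.integral_cong) (auto simp: power2_eq_square algebra_simps)
  also have "\<dots> = u\<^sup>2 * (t - s) + expectation (\<lambda>\<omega>. (?Y \<omega>)\<^sup>2)"
    using i\<xi> i\<xi>Y centered_gaussian_rv_integrable[OF gY] zero s increment_square[of s t] by simp
  finally show ?thesis
    using centered_gaussian_rv_char[OF g] centered_gaussian_rv_char[OF gY]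
    by (simp add: add_divide_distrib diff_divide_distrib exp_add[symmetric] exp_of_real[symmetric] of_real_add[symmetric] del: of_real_add)
qed

text \<open>Characters in the past values are traded for arbitrary bounded functions one coordinate at a time,
  so that one-dimensional uniqueness of characteristic functions suffices for independence.\<close>

lemma char_increment_past_prod:
  assumes s: "0 \<le> s" "s < t" and B: "finite B" "B \<subseteq> {0..s}" and C: "finite C" "C \<subseteq> {0..s}"
    and g: "\<And>l. g l \<in> borel_measurable borel" "\<And>l x. \<bar>g l x\<bar> \<le> (K::real)"
  shows "(CLINT \<omega>|M. (iexp (u * (W t \<omega> - W s \<omega>)) - of_real (exp (- u\<^sup>2 * (t - s) / 2))) *
     (\<Prod>l\<in>B. of_real (g l (W l \<omega>))) * iexp (\<Sum>l\<in>C. c l * W l \<omega>)) = 0"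
  using B C
proof (induction B arbitrary: C c rule: finite_induct)
  case empty
  let ?c = "\<lambda>\<omega>. iexp (u * (W t \<omega> - W s \<omega>)) - complex_of_real (exp (- u\<^sup>2 * (t - s) / 2))"
  have t: "0 \<le> t" using s by simp
  note [measurable] = measurable_W[OF s(1)] measurable_W[OF t]
  have [measurable]: "(\<lambda>\<omega>. \<Sum>l\<in>C. c l * W l \<omega>) \<in> borel_measurable M"
    using empty by (intro borel_measurable_sum) auto
  have "(CLINT \<omega>|M. ?c \<omega> * iexp (\<Sum>l\<in>C. c l * W l \<omega>))
    = (CLINT \<omega>|M. iexp (u * (W t \<omega> - W s \<omega>) + (\<Sum>l\<in>C. c l * W l \<omega>)) - of_real (exp (- u\<^sup>2 * (t - s) / 2)) * iexp (\<Sum>l\<in>C. c l * W l \<omega>))"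
    by (intro Bochner_Integration.integral_cong) (auto simp: distrib_left left_diff_distrib exp_add)
  also have "\<dots> = (CLINT \<omega>|M. iexp (u * (W t \<omega> - W s \<omega>) + (\<Sum>l\<in>C. c l * W l \<omega>))) - of_real (exp (- u\<^sup>2 * (t - s) / 2)) * (CLINT \<omega>|M. iexp (\<Sum>l\<in>C. c l * W l \<omega>))"
    by (subst Bochner_Integration.integral_diff)
      (auto intro!: integrable_bounded[where B=1] integrable_mult_right simp del: of_real_sum of_real_add of_real_mult of_real_exp)
  also have "\<dots> = 0" using char_increment_past[OF s empty(2,3)] by simp
  finally show ?case by simp
next
  case (insert b B)
  let ?cc = "\<lambda>\<omega>. iexp (u * (W t \<omega> - W s \<omega>)) - complex_of_real (exp (- u\<^sup>2 * (t - s) / 2))"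
  have t: "0 \<le> t" using s by simp
  have b: "0 \<le> b" and Bs: "B \<subseteq> {0..s}" using insert by auto
  note [measurable] = measurable_W[OF s(1)] measurable_W[OF t] measurable_W[OF b]
  have [measurable]: "(\<lambda>\<omega>. \<Sum>l\<in>C. c l * W l \<omega>) \<in> borel_measurable M"
    using insert by (intro borel_measurable_sum) auto
  have "(\<lambda>\<omega>. complex_of_real (g l (W l \<omega>))) \<in> borel_measurable M" if "l \<in> B" for l
    using that Bs g(1)[of l] by (intro borel_measurable_of_real measurable_compose[OF measurable_W]) auto
  then have [measurable]: "(\<lambda>\<omega>. \<Prod>l\<in>B. complex_of_real (g l (W l \<omega>))) \<in> borel_measurable M"
    by (intro borel_measurable_prod) auto
  have K: "0 \<le> K" using g(2)[of 0 0] by linarith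
  let ?Z = "\<lambda>\<omega>. ?cc \<omega> *
     (\<Prod>l\<in>B. of_real (g l (W l \<omega>))) * iexp (\<Sum>l\<in>C. c l * W l \<omega>)"
  \<comment> \<open>Uniqueness in the single variable \<open>W b\<close> reduces the factor
    \<open>g b (W b)\<close> to characters of \<open>W b\<close>. Such a character is absorbed into
    the sum over \<open>C\<close>, which is why \<open>C\<close> and \<open>c\<close> are general in
    the induction.\<close>
  have "(CLINT \<omega>|M. ?Z \<omega> * of_real (g b (W b \<omega>))) = 0"
  proof (rule expectation_times_eq_0I_char[where X="W b" and g="g b" and Z="?Z"])
    show "cmod (?Z \<omega>) \<le> 2 * K ^ card B" for \<omega>
    proof -
      have "cmod (?cc \<omega>) \<le> 1 + 1"
        using s by (intro order_trans[OF norm_triangle_ineq4] add_mono)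
          (auto simp flip: of_real_diff of_real_mult simp del: of_real_exp)
      moreover have "cmod (\<Prod>l\<in>B. complex_of_real (g l (W l \<omega>))) \<le> K ^ card B"
        using g(2) unfolding prod_norm[symmetric] prod_constant[symmetric]
        by (intro prod_mono) auto
      ultimately show ?thesis
        using mult_mono[of "cmod (?cc \<omega>)" "1 + 1"
            "cmod (\<Prod>l\<in>B. complex_of_real (g l (W l \<omega>)))" "K ^ card B"]
        by (simp add: norm_mult del: of_real_sum of_real_mult of_real_prod of_real_exp of_real_diff)
    qed
    show "\<bar>g b x\<bar> \<le> K" for x by (rule g)
    show "(CLINT \<omega>|M. ?Z \<omega> * iexp (d * W b \<omega>)) = 0" for d
    proof -
      let ?c = "\<lambda>l. (if l \<in> C then c l else 0) + (if l = b then d else 0)"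
      have "(\<Sum>l\<in>insert b C. ?c l * W l \<omega>) = (\<Sum>l\<in>C. c l * W l \<omega>) + d * W b \<omega>" for \<omega>
      proof -
        have "(\<Sum>l\<in>insert b C. ?c l * W l \<omega>) = (\<Sum>l\<in>insert b C. (if l \<in> C then c l * W l \<omega> else 0) + (if l = b then d * W l \<omega> else 0))"
          by (intro sum.cong) (auto simp: algebra_simps)
        also have "\<dots> = (\<Sum>l\<in>insert b C. if l \<in> C then c l * W l \<omega> else 0) + d * W b \<omega>"
          unfolding sum.distrib using insert.prems(2) by (simp only: sum.delta[OF finite.insertI] insert_iff simp_thms if_True)
        also have "(\<Sum>l\<in>insert b C. if l \<in> C then c l * W l \<omega> else 0) = (\<Sum>l\<in>C. c l * W l \<omega>)"
          using insert by (subst sum.inter_restrict[symmetric]) (auto intro!: sum.cong)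
        finally show ?thesis .
      qed
      then have "iexp (\<Sum>l\<in>insert b C. ?c l * W l \<omega>) = iexp (\<Sum>l\<in>C. c l * W l \<omega>) * iexp (d * W b \<omega>)" for \<omega>
        by (simp only: of_real_add distrib_left exp_add)
      then have "?Z \<omega> * iexp (d * W b \<omega>) = ?cc \<omega> *
        (\<Prod>l\<in>B. of_real (g l (W l \<omega>))) * iexp (\<Sum>l\<in>insert b C. ?c l * W l \<omega>)" for \<omega>
        by (simp only: mult.assoc)
      then show ?thesis
        using insert.IH[OF Bs, of "insert b C" ?c] insert.prems by (simp only: insert_subset finite_insert)
    qed
  qed (use g in measurable)
  then show ?case using insert by (simp add: mult_ac)
qed

text \<open>The law of the increment weighted by the past is the mean weight times its plain law, so
  the unbounded exponential can be integrated against it. Products over single times are exactly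
  what strip indicators and a factor \<open>exp (m * W s)\<close> form.\<close>

lemma exp_increment_past_prod:
  assumes s: "0 \<le> s" "s < t" and B: "finite B" "B \<subseteq> {0..s}"
    and g: "\<And>l. g l \<in> borel_measurable borel" "\<And>l x. 0 \<le> g l x" "\<And>l x. g l x \<le> (K::real)"
  shows "expectation (\<lambda>\<omega>. (\<Prod>l\<in>B. g l (W l \<omega>)) * exp (m * (W t \<omega> - W s \<omega>))) =
    exp (m\<^sup>2 * (t - s) / 2) * expectation (\<lambda>\<omega>. \<Prod>l\<in>B. g l (W l \<omega>))"
    and "integrable M (\<lambda>\<omega>. (\<Prod>l\<in>B. g l (W l \<omega>)) * exp (m * (W t \<omega> - W s \<omega>)))"
proof -
  have t: "0 \<le> t" using s by simp
  note [measurable] = measurable_W[OF s(1)] measurable_W[OF t]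
  let ?Y = "\<lambda>\<omega>. \<Prod>l\<in>B. g l (W l \<omega>)" and ?\<xi> = "\<lambda>\<omega>. W t \<omega> - W s \<omega>"
  have "(\<lambda>\<omega>. g l (W l \<omega>)) \<in> borel_measurable M" if "l \<in> B" for l
    using that B g(1)[of l] by (intro measurable_compose[OF measurable_W]) auto
  then have mY[measurable]: "?Y \<in> borel_measurable M" by (intro borel_measurable_prod) auto
  have "\<bar>?Y \<omega>\<bar> \<le> K ^ card B" for \<omega>
    unfolding abs_prod prod_constant[symmetric] using g by (intro prod_mono) auto
  then have iY: "integrable M ?Y" by (intro integrable_bounded[where B="K ^ card B"]) auto
  have Ynn: "0 \<le> ?Y \<omega>" for \<omega> using g by (intro prod_nonneg) auto
  have D: "distributed M lborel ?\<xi> (normal_density 0 (sqrt (t - s)))"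
    using s by (intro increment_normal) auto
  have sig: "0 < sqrt (t - s)" using s by simp
  have ie: "integrable M (\<lambda>\<omega>. exp (m * ?\<xi> \<omega>))"
    using distributed_integrable[OF D, of "\<lambda>x. exp (m * x)"] normal_density_exp_shift[OF sig] sig by simp
  have "expectation (\<lambda>\<omega>. exp (m * ?\<xi> \<omega>)) = (\<integral>x. normal_density 0 (sqrt (t - s)) x * exp (m * x) \<partial>lborel)"
    by (subst distributed_integral[OF D]) auto
  also have "\<dots> = exp (m\<^sup>2 * (t - s) / 2)"
    using normal_density_exp_shift[OF sig] sig s by simp
  finally have e: "expectation (\<lambda>\<omega>. exp (m * ?\<xi> \<omega>)) = exp (m\<^sup>2 * (t - s) / 2)" .
  have char_\<xi>: "(CLINT \<omega>|M. iexp (u * ?\<xi> \<omega>)) = of_real (exp (- u\<^sup>2 * (t - s) / 2))" for u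
    using char_increment_past[OF s, of "{}" u] by (simp add: prob_space)
  have ch: "(CLINT \<omega>|M. of_real (?Y \<omega>) * iexp (u * ?\<xi> \<omega>)) = (CLINT \<omega>|M. of_real (expectation ?Y) * iexp (u * ?\<xi> \<omega>))" for u
  proof -
    have "(CLINT \<omega>|M. (iexp (u * ?\<xi> \<omega>) - of_real (exp (- u\<^sup>2 * (t - s) / 2))) * of_real (?Y \<omega>)) = 0"
      using char_increment_past_prod[OF s B, of "{}" g K u "\<lambda>_. 0"] g
      by simp
    moreover have "integrable M (\<lambda>\<omega>. iexp (u * ?\<xi> \<omega>) * of_real (?Y \<omega>))"
    proof (rule Bochner_Integration.integrable_bound[OF iY])
      show "(\<lambda>\<omega>. iexp (u * ?\<xi> \<omega>) * of_real (?Y \<omega>)) \<in> borel_measurable M"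
        by (intro borel_measurable_times borel_measurable_of_real mY) measurable
    qed (auto simp: norm_mult simp del: of_real_prod of_real_mult)
    moreover have "integrable M (\<lambda>\<omega>. of_real (exp (- u\<^sup>2 * (t - s) / 2)) * complex_of_real (?Y \<omega>))"
      using iY by (simp del: of_real_prod)
    ultimately have "(CLINT \<omega>|M. iexp (u * ?\<xi> \<omega>) * of_real (?Y \<omega>)) =
        (CLINT \<omega>|M. of_real (exp (- u\<^sup>2 * (t - s) / 2)) * complex_of_real (?Y \<omega>))"
      by (simp only: left_diff_distrib Bochner_Integration.integral_diff right_minus_eq)
    then show ?thesis
      using char_\<xi>[of u] by (simp add: mult.commute del: of_real_prod of_real_mult of_real_exp of_real_diff)
  qed
  have "expectation (\<lambda>\<omega>. ?Y \<omega> * exp (m * ?\<xi> \<omega>)) = expectation (\<lambda>\<omega>. expectation ?Y * exp (m * ?\<xi> \<omega>))"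
    by (rule expectation_weighted_eqI_char[where g="\<lambda>x. exp (m * x)" and X="?\<xi>" and ?f2.0="\<lambda>_. expectation ?Y"]) (use iY Ynn ch in \<open>auto intro!: integral_nonneg\<close>)
  then show "expectation (\<lambda>\<omega>. ?Y \<omega> * exp (m * ?\<xi> \<omega>)) = exp (m\<^sup>2 * (t - s) / 2) * expectation ?Y"
    using e by simp
  show "integrable M (\<lambda>\<omega>. ?Y \<omega> * exp (m * ?\<xi> \<omega>))"
  proof (rule Bochner_Integration.integrable_bound)
    show "integrable M (\<lambda>\<omega>. K ^ card B * exp (m * ?\<xi> \<omega>))" using ie by simp
    show "AE \<omega> in M. norm (?Y \<omega> * exp (m * ?\<xi> \<omega>)) \<le> norm (K ^ card B * exp (m * ?\<xi> \<omega>))"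
      using \<open>\<And>\<omega>. \<bar>?Y \<omega>\<bar> \<le> K ^ card B\<close> abs_ge_self order_trans by (fastforce simp: abs_mult intro!: mult_right_mono)
  qed simp
qed

end

subsection \<open>Exponential martingales and reflection images\<close>

text \<open>Time is counted from \<open>s = -1\<close>, where the lines \<open>b (1 + s)\<close> and
  \<open>- a (1 + s)\<close> meet at height 0. On the upper line the exponent is then
  \<open>(1 + s) m (2 b - m) / 2\<close>, which is symmetric under
  \<open>m \<mapsto> 2 b - m\<close>; at \<open>s = 0\<close>, \<open>w = 0\<close> the value is
  \<open>exp (- m^2 / 2)\<close>.\<close>

definition exp_mart :: "real \<Rightarrow> real \<Rightarrow> real \<Rightarrow> real" where
  "exp_mart m s w = exp (m * w - m\<^sup>2 * (1 + s) / 2)"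

text \<open>The exponents \<open>2 k (a + b)\<close> carry the sign \<open>+\<close>, the exponents \<open>2 b + 2 k (a + b)\<close> the sign \<open>-\<close>;
  the two families are interchanged by \<open>m \<mapsto> 2 b - m\<close> and by \<open>m \<mapsto> - 2 a - m\<close>, the reflections in the
  two lines. Truncation at \<open>K\<close> leaves a boundary value of order \<open>exp (- 2 K\<^sup>2 (a + b)\<^sup>2)\<close>.\<close>

definition image_sum :: "real \<Rightarrow> real \<Rightarrow> nat \<Rightarrow> (real \<Rightarrow> real) \<Rightarrow> real" where
  "image_sum a b K F = (\<Sum>n=1..K. F (2 * real n * (a + b)) + F (- (2 * real n * (a + b)))
     - F (2 * real n * (a + b) - 2 * a) - F (2 * b - 2 * real n * (a + b)))"

text \<open>The leading 1 is the image with \<open>m = 0\<close>.\<close>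

definition image_mart :: "real \<Rightarrow> real \<Rightarrow> nat \<Rightarrow> real \<Rightarrow> real \<Rightarrow> real" where
  "image_mart a b K s w = 1 + image_sum a b K (\<lambda>m. exp_mart m s w)"

text \<open>Changing the sign of the path changes the sign of all exponents and exchanges the two
  lines, so estimates are needed at the upper line only.\<close>

lemma image_mart_swap: "image_mart a b K s w = image_mart b a K s (- w)"
  unfolding image_mart_def image_sum_def exp_mart_def
  by (auto intro!: sum.cong simp: algebra_simps power2_eq_square)

section \<open>Estimates of the image sum on, beyond and between the lines\<close>

lemma image_sum_diff: "image_sum a b K (\<lambda>m. F m - G m) = image_sum a b K F - image_sum a b K G"
  by (simp add: image_sum_def sum_subtractf[symmetric] algebra_simps)

text \<open>All exponents lie outside \<open>(- 2 a, 2 b)\<close>, and the four with index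
  \<open>n\<close> have modulus at least \<open>2 (n - 1) (a + b)\<close>. The result is four times
  a geometric series, uniformly in the truncation \<open>K\<close>.\<close>

lemma image_sum_bound:
  assumes ab: "a > 0" "b > 0" and c: "c \<ge> 0"
    and F: "\<And>m. m \<ge> 2 * b \<or> m \<le> - 2 * a \<Longrightarrow> \<bar>F m\<bar> \<le> c * exp (- \<bar>m\<bar>)"
  shows "\<bar>image_sum a b K F\<bar> \<le> c * (4 / (1 - exp (- 2 * (a + b))))"
proof -
  let ?L = "a + b" and ?q = "exp (- 2 * (a + b))"
  have q: "0 < ?q" "?q < 1" using ab by auto
  have term_le: "\<bar>F (2 * real n * ?L) + F (- (2 * real n * ?L)) - F (2 * real n * ?L - 2 * a) - F (2 * b - 2 * real n * ?L)\<bar>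
      \<le> 4 * c * ?q ^ (n - 1)" if n: "n \<ge> 1" for n
  proof -
    define d where "d = real (n - 1) * ?L"
    have d: "0 \<le> d" "2 * real n * ?L = 2 * d + 2 * ?L"
      using ab by (simp add: d_def) (use n in \<open>simp add: d_def of_nat_diff algebra_simps\<close>)
    have *: "\<bar>F m\<bar> \<le> c * ?q ^ (n - 1)" if m: "m \<ge> 2 * b \<or> m \<le> - 2 * a" "\<bar>m\<bar> \<ge> 2 * d" for m
    proof -
      have "\<bar>F m\<bar> \<le> c * exp (- \<bar>m\<bar>)" using F m by simp
      also have "\<dots> \<le> c * exp (real (n - 1) * (- 2 * ?L))" using c m by (intro mult_left_mono) (auto simp: d_def algebra_simps)
      finally show ?thesis by (simp only: exp_of_nat_mult)
    qed
    have "\<bar>F (2 * real n * ?L)\<bar> \<le> c * ?q ^ (n - 1)"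
      unfolding d(2) by (rule *) (use d(1) ab in \<open>auto simp: abs_if\<close>)
    moreover have "\<bar>F (- (2 * real n * ?L))\<bar> \<le> c * ?q ^ (n - 1)"
      unfolding d(2) by (rule *) (use d(1) ab in \<open>auto simp: abs_if\<close>)
    moreover have "\<bar>F (2 * real n * ?L - 2 * a)\<bar> \<le> c * ?q ^ (n - 1)"
      unfolding d(2) by (rule *) (use d(1) ab in \<open>auto simp: abs_if\<close>)
    moreover have "\<bar>F (2 * b - 2 * real n * ?L)\<bar> \<le> c * ?q ^ (n - 1)"
      unfolding d(2) by (rule *) (use d(1) ab in \<open>auto simp: abs_if\<close>)
    ultimately show ?thesis by linarith
  qed
  have "\<bar>image_sum a b K F\<bar> \<le> (\<Sum>n=1..K. 4 * c * ?q ^ (n - 1))"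
    unfolding image_sum_def by (rule order_trans[OF sum_abs sum_mono]) (rule term_le, simp)
  also have "\<dots> = 4 * c * (\<Sum>n<K. ?q ^ n)"
    unfolding sum_distrib_left by (rule sum.reindex_bij_witness[of _ Suc "\<lambda>n. n - 1"]) auto
  also have "\<dots> \<le> 4 * c * (1 / (1 - ?q))"
    using c q by (intro mult_left_mono) (auto simp: sum_gp_strict divide_simps)
  finally show ?thesis by (simp add: mult.commute)
qed

text \<open>On the upper line reflection makes the first and fourth image of index \<open>n\<close>
  cancel, while the second equals the third of index \<open>n + 1\<close>. Everything telescopes to
  the single image \<open>2 K (a + b) + 2 b\<close>, the initial 1 being the image
  \<open>2 b\<close>.\<close>

lemma image_mart_boundary:
  assumes "s \<ge> 0" "a > 0" "b > 0"
  shows "0 \<le> image_mart a b K s (b * (1 + s))" and "image_mart a b K s (b * (1 + s)) \<le> exp (- 2 * (real K)\<^sup>2 * (a + b)\<^sup>2)"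
proof -
  let ?E = "\<lambda>m. exp_mart m s (b * (1 + s))"
  have refl: "?E m = ?E (2 * b - m)" for m
    unfolding exp_mart_def by (intro arg_cong[where f=exp]) (simp add: algebra_simps power2_eq_square diff_divide_distrib add_divide_distrib)
  have "image_mart a b K s (b * (1 + s)) = ?E (2 * real K * (a + b) + 2 * b)"
  proof (induction K)
    case 0 then show ?case by (simp add: image_mart_def image_sum_def exp_mart_def power2_eq_square algebra_simps)
  next
    case (Suc K)
    have "image_mart a b (Suc K) s (b * (1 + s)) = image_mart a b K s (b * (1 + s)) +
       (?E (2 * real (Suc K) * (a + b)) + ?E (- (2 * real (Suc K) * (a + b)))
        - ?E (2 * real (Suc K) * (a + b) - 2 * a) - ?E (2 * b - 2 * real (Suc K) * (a + b)))"
      by (simp add: image_mart_def image_sum_def)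
    moreover have "?E (2 * real (Suc K) * (a + b)) = ?E (2 * b - 2 * real (Suc K) * (a + b))" by (rule refl)
    moreover have "?E (- (2 * real (Suc K) * (a + b))) = ?E (2 * real (Suc K) * (a + b) + 2 * b)"
      by (subst refl) (simp add: algebra_simps)
    moreover have "2 * real K * (a + b) + 2 * b = 2 * real (Suc K) * (a + b) - 2 * a" by (simp add: algebra_simps)
    ultimately show ?case using Suc by simp
  qed
  moreover have "?E (2 * real K * (a + b) + 2 * b) \<le> exp (- 2 * (real K)\<^sup>2 * (a + b)\<^sup>2)"
  proof -
    have "(2 * real K * (a + b) + 2 * b) * (b * (1 + s)) - (2 * real K * (a + b) + 2 * b)\<^sup>2 * (1 + s) / 2
      = - 2 * (real K)\<^sup>2 * (a + b)\<^sup>2 - (2 * (real K)\<^sup>2 * (a + b)\<^sup>2 * s + 2 * real K * (a + b) * b * (1 + s))"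
      by (simp add: algebra_simps power2_eq_square diff_divide_distrib add_divide_distrib)
    moreover have "0 \<le> 2 * (real K)\<^sup>2 * (a + b)\<^sup>2 * s + 2 * real K * (a + b) * b * (1 + s)"
      using assms by simp
    ultimately show ?thesis unfolding exp_mart_def exp_le_cancel_iff by linarith
  qed
  ultimately show "0 \<le> image_mart a b K s (b * (1 + s))" "image_mart a b K s (b * (1 + s)) \<le> exp (- 2 * (real K)\<^sup>2 * (a + b)\<^sup>2)"
    by (auto simp: exp_mart_def)
qed

text \<open>The first factor absorbs what remains after completing squares in the exponents, the
  second is the geometric series of \<open>image_sum_bound\<close>; neither time nor
  \<open>K\<close> enters.\<close>

definition image_const :: "real \<Rightarrow> real \<Rightarrow> real" where
  "image_const a b = exp ((a + b + 2)\<^sup>2) * (4 / (1 - exp (- 2 * (a + b))))"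

lemma image_const_pos: "a > 0 \<Longrightarrow> b > 0 \<Longrightarrow> 0 < image_const a b"
  by (simp add: image_const_def)

text \<open>Convexity bounds the difference by \<open>\<bar>x - y\<bar>\<close> times the larger
  exponential, and \<open>y + \<bar>x - y\<bar>\<close> dominates both exponents.\<close>

lemma abs_exp_diff_le: "\<bar>exp x - exp y\<bar> \<le> \<bar>x - y\<bar> * exp (y + \<bar>x - y\<bar>)" for x y :: real
proof -
  have *: "exp u - exp v \<le> (u - v) * exp u" for u v :: real
  proof -
    have "exp u * (1 + (v - u)) \<le> exp u * exp (v - u)" by (intro mult_left_mono exp_ge_add_one_self) simp
    then show ?thesis by (simp add: exp_diff algebra_simps)
  qed
  show ?thesis
  proof (cases "y \<le> x")
    case True then show ?thesis using *[of x y] by simp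
  next
    case False
    then have "\<bar>exp x - exp y\<bar> \<le> \<bar>x - y\<bar> * exp y" using *[of y x] by simp
    also have "\<dots> \<le> \<bar>x - y\<bar> * exp (y + \<bar>x - y\<bar>)" by (intro mult_left_mono) auto
    finally show ?thesis .
  qed
qed

text \<open>Each image is compared with its value on the line. What matters is uniformity in
  \<open>s\<close>, since one constant has to serve all grid times.\<close>

lemma image_mart_overshoot_upper:
  assumes s: "s \<ge> 0" and ab: "a > 0" "b > 0" and w: "b * (1 + s) \<le> w" "w \<le> b * (1 + s) + r"
  shows "\<bar>image_mart a b K s w\<bar> \<le> exp (- 2 * (real K)\<^sup>2 * (a + b)\<^sup>2) + image_const a b * (r * exp (r\<^sup>2))"
proof -
  let ?w0 = "b * (1 + s)"
  have r: "r \<ge> 0" using w by linarith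
  have "\<bar>image_sum a b K (\<lambda>m. exp_mart m s w - exp_mart m s ?w0)\<bar> \<le>
    (exp ((a + b + 2)\<^sup>2) * (r * exp (r\<^sup>2))) * (4 / (1 - exp (- 2 * (a + b))))"
  proof (rule image_sum_bound[OF ab])
    show "0 \<le> exp ((a + b + 2)\<^sup>2) * (r * exp (r\<^sup>2))" using r by simp
    fix m :: real assume m: "m \<ge> 2 * b \<or> m \<le> - 2 * a"
    have "\<bar>exp_mart m s w - exp_mart m s ?w0\<bar> \<le> \<bar>m * (w - ?w0)\<bar> * exp (m * ?w0 - m\<^sup>2 * (1 + s) / 2 + \<bar>m * (w - ?w0)\<bar>)"
      using abs_exp_diff_le[of "m * w - m\<^sup>2 * (1 + s) / 2" "m * ?w0 - m\<^sup>2 * (1 + s) / 2"]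
      by (simp add: exp_mart_def right_diff_distrib)
    also have "\<dots> \<le> (\<bar>m\<bar> * r) * exp (m * b - m\<^sup>2 / 2 + \<bar>m\<bar> * r)"
    proof (intro mult_mono)
      show mr: "\<bar>m * (w - ?w0)\<bar> \<le> \<bar>m\<bar> * r" using w unfolding abs_mult by (intro mult_left_mono) auto
      \<comment> \<open>On the line every occurring exponent has a nonpositive rate, so the factor
        \<open>1 + s\<close> only improves the estimate and may be replaced by 1.\<close>
      have "m * (b - m / 2) \<le> 0" using m ab by (auto intro: mult_nonneg_nonpos mult_nonpos_nonneg)
      then have "m * b - m\<^sup>2 / 2 \<le> 0" by (simp add: power2_eq_square algebra_simps)
      then have "(m * b - m\<^sup>2 / 2) * (1 + s) \<le> (m * b - m\<^sup>2 / 2) * 1" using s by (intro mult_left_mono_neg) auto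
      then show "exp (m * ?w0 - m\<^sup>2 * (1 + s) / 2 + \<bar>m * (w - ?w0)\<bar>) \<le> exp (m * b - m\<^sup>2 / 2 + \<bar>m\<bar> * r)"
        using mr unfolding exp_le_cancel_iff by (simp add: algebra_simps add_divide_distrib diff_divide_distrib)
    qed (use r in auto)
    also have "\<dots> \<le> (exp \<bar>m\<bar> * r) * exp (m * b - m\<^sup>2 / 2 + \<bar>m\<bar> * r)"
    proof -
      have "\<bar>m\<bar> \<le> exp \<bar>m\<bar>" using exp_ge_add_one_self[of "\<bar>m\<bar>"] by linarith
      then show ?thesis using r by (intro mult_right_mono) auto
    qed
    also have "\<dots> = r * exp (m * b - m\<^sup>2 / 2 + \<bar>m\<bar> * r + \<bar>m\<bar>)"
      by (simp add: exp_add mult_ac)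
    also have "\<dots> \<le> r * exp ((a + b + 2)\<^sup>2 + r\<^sup>2 - \<bar>m\<bar>)"
    proof -
      \<comment> \<open>The quadratic \<open>m^2 / 2\<close> has to beat
        \<open>\<bar>m\<bar> * (b + 2 + r)\<close>: of the 2, one part comes from
        \<open>\<bar>m\<bar> \<le> exp \<bar>m\<bar>\<close>, the other buys the decay
        \<open>exp (- \<bar>m\<bar>)\<close>.\<close>
      have "m * b \<le> \<bar>m\<bar> * b" using ab by (intro mult_right_mono) auto
      moreover have "0 \<le> (\<bar>m\<bar> - (b + 2 + r))\<^sup>2" by simp
      then have "\<bar>m\<bar> * (b + 2 + r) \<le> m\<^sup>2 / 2 + (b + 2 + r)\<^sup>2 / 2"
        unfolding power2_diff by simp
      moreover have "0 \<le> (b + 2 - r)\<^sup>2" by simp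
      then have "(b + 2 + r)\<^sup>2 / 2 \<le> (b + 2)\<^sup>2 + r\<^sup>2" by (simp add: power2_eq_square algebra_simps)
      moreover have "(b + 2)\<^sup>2 \<le> (a + b + 2)\<^sup>2" using ab by (intro power_mono) auto
      ultimately have "m * b - m\<^sup>2 / 2 + \<bar>m\<bar> * r + \<bar>m\<bar> \<le> (a + b + 2)\<^sup>2 + r\<^sup>2 - \<bar>m\<bar>" by (simp add: algebra_simps)
      then show ?thesis using r by (intro mult_left_mono) auto
    qed
    also have "\<dots> = exp ((a + b + 2)\<^sup>2) * (r * exp (r\<^sup>2)) * exp (- \<bar>m\<bar>)"
      by (simp add: exp_add exp_diff exp_minus field_simps)
    finally show "\<bar>exp_mart m s w - exp_mart m s ?w0\<bar> \<le> exp ((a + b + 2)\<^sup>2) * (r * exp (r\<^sup>2)) * exp (- \<bar>m\<bar>)" .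
  qed
  then have "\<bar>image_mart a b K s w - image_mart a b K s ?w0\<bar> \<le> image_const a b * (r * exp (r\<^sup>2))"
    by (simp add: image_mart_def image_sum_diff image_const_def mult_ac)
  moreover have "\<bar>image_mart a b K s ?w0\<bar> \<le> exp (- 2 * (real K)\<^sup>2 * (a + b)\<^sup>2)"
    using image_mart_boundary[OF s ab, of K] by linarith
  ultimately show ?thesis by linarith
qed

lemma image_mart_overshoot_lower:
  assumes s: "s \<ge> 0" and ab: "a > 0" "b > 0" and w: "w \<le> - (a * (1 + s))" "- (a * (1 + s)) - r \<le> w"
  shows "\<bar>image_mart a b K s w\<bar> \<le> exp (- 2 * (real K)\<^sup>2 * (a + b)\<^sup>2) + image_const a b * (r * exp (r\<^sup>2))"
proof -
  have "image_const b a = image_const a b" by (simp add: image_const_def add_ac)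
  then show ?thesis
    using image_mart_overshoot_upper[OF s ab(2,1), of "- w" r K] w
    by (simp add: image_mart_swap[of a b] add.commute[of b a])
qed

text \<open>With slope \<open>u = w / (1 + s)\<close> and \<open>\<kappa> = min a b / 2\<close>, a
  path with \<open>\<bar>u\<bar> \<le> \<kappa>\<close> is far from both lines and every image
  decays exponentially in \<open>s\<close>. Other paths are charged \<open>u^2 / \<kappa>^2\<close>,
  whose expectation vanishes for large times.\<close>

lemma image_mart_inside:
  assumes s: "s \<ge> 0" and ab: "a > 0" "b > 0" and w: "- (a * (1 + s)) \<le> w" "w \<le> b * (1 + s)"
  shows "\<bar>image_mart a b K s w - 1\<bar> \<le> image_const a b * (exp (- (min a b)\<^sup>2 * s) + 4 * w\<^sup>2 / ((1 + s)\<^sup>2 * (min a b)\<^sup>2))"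
proof -
  define \<kappa> where "\<kappa> = min a b / 2"
  define u where "u = w / (1 + s)"
  have \<kappa>: "\<kappa> > 0" "2 * \<kappa> \<le> a" "2 * \<kappa> \<le> b" using ab by (auto simp: \<kappa>_def)
  have wu: "w = u * (1 + s)" using s by (simp add: u_def)
  have u: "- a \<le> u" "u \<le> b" using w s by (auto simp: u_def field_simps)
  define X where "X = exp (- (min a b)\<^sup>2 * s) + 4 * w\<^sup>2 / ((1 + s)\<^sup>2 * (min a b)\<^sup>2)"
  have X: "X = exp (- 4 * \<kappa>\<^sup>2 * s) + u\<^sup>2 / \<kappa>\<^sup>2"
    by (simp add: X_def \<kappa>_def u_def power_divide field_simps)
  have "X \<ge> 0" unfolding X by simp
  have "\<bar>image_sum a b K (\<lambda>m. exp_mart m s w)\<bar> \<le> (exp ((a + b + 2)\<^sup>2) * X) * (4 / (1 - exp (- 2 * (a + b))))"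
  proof (rule image_sum_bound[OF ab])
    show "0 \<le> exp ((a + b + 2)\<^sup>2) * X" using \<open>X \<ge> 0\<close> by simp
    fix m :: real assume m: "m \<ge> 2 * b \<or> m \<le> - 2 * a"
    have E: "exp_mart m s w = exp ((1 + s) * (m * (u - m / 2)))"
      unfolding exp_mart_def wu by (simp add: algebra_simps power2_eq_square)
    show "\<bar>exp_mart m s w\<bar> \<le> exp ((a + b + 2)\<^sup>2) * X * exp (- \<bar>m\<bar>)"
    proof (cases "\<bar>u\<bar> \<le> \<kappa>")
      case True
      have m4: "\<bar>m\<bar> \<ge> 4 * \<kappa>" using m \<kappa> ab by linarith
      have "m * u \<le> \<bar>m\<bar> * \<kappa>" 
        using mult_left_mono[OF True, of "\<bar>m\<bar>"] abs_ge_self[of "m * u"] by (simp add: abs_mult)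
      moreover have "\<bar>m\<bar> * (4 * \<kappa>) \<le> \<bar>m\<bar> * \<bar>m\<bar>" using m4 by (intro mult_left_mono) auto
      ultimately have 1: "m * (u - m / 2) \<le> - (m\<^sup>2 / 4)"
        by (simp add: algebra_simps power2_eq_square)
      have "(4 * \<kappa>)\<^sup>2 \<le> \<bar>m\<bar>\<^sup>2" using m4 \<kappa> by (intro power_mono) auto
      then have 2: "4 * \<kappa>\<^sup>2 \<le> m\<^sup>2 / 4" by (simp add: power_mult_distrib)
      have "0 \<le> (\<bar>m\<bar> - 2)\<^sup>2" by simp
      then have 3: "\<bar>m\<bar> - 1 \<le> m\<^sup>2 / 4" by (simp add: power2_eq_square algebra_simps)
      have "(1 + s) * (m * (u - m / 2)) \<le> (1 + s) * (- (m\<^sup>2 / 4))" using 1 s by (intro mult_left_mono) auto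
      also have "\<dots> = - (m\<^sup>2 / 4) * s - m\<^sup>2 / 4" by (simp add: algebra_simps)
      also have "\<dots> \<le> - 4 * \<kappa>\<^sup>2 * s + (1 - \<bar>m\<bar>)" using mult_right_mono[OF 2 s] 3 by simp
      finally have "exp_mart m s w \<le> exp (- 4 * \<kappa>\<^sup>2 * s) * exp (1 - \<bar>m\<bar>)" unfolding E exp_add[symmetric] by simp
      also have "\<dots> \<le> X * (exp ((a + b + 2)\<^sup>2) * exp (- \<bar>m\<bar>))"
      proof (intro mult_mono)
        show "exp (- 4 * \<kappa>\<^sup>2 * s) \<le> X" unfolding X by simp
        have "1\<^sup>2 \<le> (a + b + 2)\<^sup>2" using ab by (intro power_mono) auto
        then show "exp (1 - \<bar>m\<bar>) \<le> exp ((a + b + 2)\<^sup>2) * exp (- \<bar>m\<bar>)" by (simp flip: exp_add)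
      qed (use \<open>X \<ge> 0\<close> in auto)
      finally show ?thesis by (simp add: exp_mart_def mult_ac)
    next
      case False
      have "\<kappa>\<^sup>2 \<le> \<bar>u\<bar>\<^sup>2" using False \<kappa> by (intro power_mono) auto
      then have "1 \<le> u\<^sup>2 / \<kappa>\<^sup>2" using \<kappa> by simp
      \<comment> \<open>No decay in \<open>s\<close> is available here; the quadratic part of
        \<open>X\<close> alone pays for a bound by
        \<open>exp ((a + b + 2)^2 - \<bar>m\<bar>)\<close>.\<close>
      then have X1: "1 \<le> X" unfolding X using exp_gt_zero[of "- 4 * \<kappa>\<^sup>2 * s"] by linarith
      have neg: "m * (u - m / 2) \<le> 0" using m u ab by (auto intro: mult_nonneg_nonpos mult_nonpos_nonneg)
      have "(1 + s) * (m * (u - m / 2)) \<le> 1 * (m * (u - m / 2))" using neg s by (intro mult_right_mono_neg) auto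
      also have "\<dots> \<le> (a + b + 2)\<^sup>2 - \<bar>m\<bar>"
      proof -
        have "m * u \<le> \<bar>m\<bar> * (a + b)"
          using mult_left_mono[of "\<bar>u\<bar>" "a + b" "\<bar>m\<bar>"] abs_ge_self[of "m * u"] u ab by (simp add: abs_mult abs_le_iff)
        moreover have "0 \<le> (\<bar>m\<bar> - (a + b + 1))\<^sup>2" by simp
        then have "\<bar>m\<bar> * (a + b + 1) \<le> m\<^sup>2 / 2 + (a + b + 1)\<^sup>2 / 2"
          unfolding power2_diff by simp
        moreover have "(a + b + 1)\<^sup>2 \<le> (a + b + 2)\<^sup>2" using ab by (intro power_mono) auto
        moreover have "0 \<le> (a + b + 1)\<^sup>2" by simp
        moreover have "\<bar>m\<bar> * (a + b + 1) = \<bar>m\<bar> * (a + b) + \<bar>m\<bar>" "1 * (m * (u - m / 2)) = m * u - m\<^sup>2 / 2"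
          by (simp_all add: algebra_simps power2_eq_square)
        ultimately show ?thesis by linarith
      qed
      finally have "exp_mart m s w \<le> exp ((a + b + 2)\<^sup>2) * exp (- \<bar>m\<bar>)" unfolding E exp_add[symmetric] by simp
      also have "\<dots> \<le> X * (exp ((a + b + 2)\<^sup>2) * exp (- \<bar>m\<bar>))" using X1 by simp
      finally show ?thesis by (simp add: exp_mart_def mult_ac)
    qed
  qed
  then show ?thesis unfolding image_mart_def image_const_def X_def[symmetric] by (simp add: mult_ac)
qed

lemma image_sum_mult_right: "image_sum a b K F * c = image_sum a b K (\<lambda>m. F m * c)"
  by (simp add: image_sum_def sum_distrib_right left_diff_distrib distrib_right)

context prob_space
begin

lemma expectation_image_sum:
  assumes "\<And>m. integrable M (F m)"
  shows "integrable M (\<lambda>\<omega>. image_sum a b K (\<lambda>m. F m \<omega>))"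
    and "expectation (\<lambda>\<omega>. image_sum a b K (\<lambda>m. F m \<omega>)) = image_sum a b K (\<lambda>m. expectation (F m))"
  using assms by (simp_all add: image_sum_def)

end

section \<open>Optional stopping along a grid\<close>

definition small_jump :: "real \<Rightarrow> real" where
  "small_jump r = \<bar>r\<bar> * exp (r\<^sup>2)"

text \<open>Jumps above \<open>\<eta>\<close> satisfy
  \<open>\<bar>r\<bar> \<le> r^4 / \<eta>^3\<close>. The fourth moment of an increment is of order
  \<open>\<delta>^2\<close>, so its sum over the order of \<open>1 / \<delta>\<close> steps vanishes
  with the mesh; a second moment would leave a constant.\<close>

lemma small_jump_le:
  assumes "\<eta> > 0"
  shows "small_jump r \<le> small_jump \<eta> + r ^ 4 * exp (r\<^sup>2) / \<eta> ^ 3"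
proof (cases "\<bar>r\<bar> \<le> \<eta>")
  case True
  then have "r\<^sup>2 \<le> \<eta>\<^sup>2" using abs_le_square_iff[of r \<eta>] assms by simp
  then have "small_jump r \<le> small_jump \<eta>"
    using True assms unfolding small_jump_def by (intro mult_mono) auto
  also have "\<dots> \<le> small_jump \<eta> + r ^ 4 * exp (r\<^sup>2) / \<eta> ^ 3" using assms by simp
  finally show ?thesis .
next
  case False
  have "\<bar>r\<bar> * \<eta> ^ 3 \<le> \<bar>r\<bar> * \<bar>r\<bar> ^ 3" using False assms by (intro mult_left_mono power_mono) auto
  also have "\<dots> = r ^ 4" by (simp add: power_eq_if)
  finally have "\<bar>r\<bar> \<le> r ^ 4 / \<eta> ^ 3" using assms by (simp add: field_simps)
  then have "small_jump r \<le> r ^ 4 / \<eta> ^ 3 * exp (r\<^sup>2)" unfolding small_jump_def by (intro mult_right_mono) auto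
  also have "\<dots> \<le> small_jump \<eta> + r ^ 4 * exp (r\<^sup>2) / \<eta> ^ 3" by (simp add: small_jump_def)
  finally show ?thesis .
qed

definition grid :: "real \<Rightarrow> nat \<Rightarrow> real set" where
  "grid \<delta> n = (\<lambda>j. real j * \<delta>) ` {..n}"

lemma grid_Suc: "grid \<delta> (Suc n) = insert (real n * \<delta> + \<delta>) (grid \<delta> n)"
  by (simp add: grid_def atMost_Suc algebra_simps)

lemma grid_props: "finite (grid \<delta> n)" "0 < \<delta> \<Longrightarrow> grid \<delta> n \<subseteq> {0..real n * \<delta>}" "real n * \<delta> \<in> grid \<delta> n"
  by (auto simp: grid_def)

definition strip :: "real \<Rightarrow> real \<Rightarrow> real \<Rightarrow> real set" where
  "strip a b s = {- (a * (1 + s))..b * (1 + s)}"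

context brownian_gaussian
begin

text \<open>A product of indicators, one per grid time, is the form of past weight for which
  \<open>exp_increment_past_prod\<close> is available.\<close>

definition inside :: "real \<Rightarrow> real \<Rightarrow> real set \<Rightarrow> 'a \<Rightarrow> real" where
  "inside a b B \<omega> = (\<Prod>l\<in>B. indicator (strip a b l) (W l \<omega>))"

lemma inside_eq: "finite B \<Longrightarrow> inside a b B \<omega> = (if \<forall>l\<in>B. W l \<omega> \<in> strip a b l then 1 else 0)"
  unfolding inside_def by (auto intro: prod.neutral simp: indicator_def)

lemma measurable_inside [measurable]: "B \<subseteq> {0..} \<Longrightarrow> inside a b B \<in> borel_measurable M"
  unfolding inside_def strip_def by (intro borel_measurable_prod) auto

lemma inside_bounds: "0 \<le> inside a b B \<omega>" "inside a b B \<omega> \<le> 1"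
  unfolding inside_def by (auto intro: prod_nonneg prod_le_1 simp: indicator_def)

lemma exp_mart_step:
  assumes s: "0 \<le> s" "s < t" and B: "finite B" "B \<subseteq> {0..s}" "s \<in> B" and ab: "a > 0" "b > 0"
  shows "integrable M (\<lambda>\<omega>. exp_mart m t (W t \<omega>) * inside a b B \<omega>)"
    and "integrable M (\<lambda>\<omega>. exp_mart m s (W s \<omega>) * inside a b B \<omega>)"
    and "expectation (\<lambda>\<omega>. exp_mart m t (W t \<omega>) * inside a b B \<omega>) = expectation (\<lambda>\<omega>. exp_mart m s (W s \<omega>) * inside a b B \<omega>)"
proof -
  \<comment> \<open>The factor \<open>exp (m * W s)\<close> is attached to the coordinate
    \<open>s\<close>. It becomes bounded there because \<open>s \<in> B\<close> confines
    \<open>W s\<close> to a compact strip.\<close>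
  define g where "g = (\<lambda>l x. indicator (strip a b l) x * (if l = s then exp (m * x) else (1::real)))"
  let ?K = "exp (\<bar>m\<bar> * ((a + b) * (1 + s)))"
  have t: "0 \<le> t" using s by simp
  note [measurable] = measurable_W[OF s(1)] measurable_W[OF t]
  have gm: "g l \<in> borel_measurable borel" for l unfolding g_def strip_def by measurable
  have gnn: "0 \<le> g l x" for l x by (auto simp: g_def)
  have gK: "g l x \<le> ?K" for l x
  proof (cases "l = s \<and> x \<in> strip a b s")
    case True
    have as: "0 \<le> a * s" "0 \<le> b * s" using ab s by auto
    then have "\<bar>x\<bar> \<le> (a + b) * (1 + s)" using True ab unfolding strip_def by (auto simp: algebra_simps abs_le_iff)
    then have "\<bar>m * x\<bar> \<le> \<bar>m\<bar> * ((a + b) * (1 + s))" unfolding abs_mult by (intro mult_left_mono) auto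
    then show ?thesis using True by (auto simp: g_def)
  next
    case False
    then have "g l x \<le> 1" by (auto simp: g_def indicator_def)
    also have "1 \<le> ?K" using s ab by simp
    finally show ?thesis .
  qed
  have prod: "(\<Prod>l\<in>B. g l (W l \<omega>)) = inside a b B \<omega> * exp (m * W s \<omega>)" for \<omega>
    using B unfolding g_def prod.distrib inside_def by (simp add: prod.delta)
  note E = exp_increment_past_prod[where g=g and K="?K" and m=m, OF s B(1,2) gm gnn gK, unfolded prod]
  have eqt: "exp_mart m t (W t \<omega>) * inside a b B \<omega> =
     exp (- m\<^sup>2 * (1 + t) / 2) * (inside a b B \<omega> * exp (m * W s \<omega>) * exp (m * (W t \<omega> - W s \<omega>)))" for \<omega>
    by (simp add: exp_mart_def exp_add[symmetric] exp_diff exp_minus field_simps)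
  have eqs: "exp_mart m s (W s \<omega>) * inside a b B \<omega> = exp (- m\<^sup>2 * (1 + s) / 2) * (inside a b B \<omega> * exp (m * W s \<omega>))" for \<omega>
    by (simp add: exp_mart_def exp_add[symmetric] diff_divide_distrib)
  show "integrable M (\<lambda>\<omega>. exp_mart m t (W t \<omega>) * inside a b B \<omega>)"
    unfolding eqt using E(2) by (intro integrable_mult_right)
  have bd: "\<bar>inside a b B \<omega> * exp (m * W s \<omega>)\<bar> \<le> ?K ^ card B" for \<omega>
    unfolding prod[symmetric] abs_prod prod_constant[symmetric] using gK gnn by (intro prod_mono) auto
  have [measurable]: "inside a b B \<in> borel_measurable M" using B by (intro measurable_inside) auto
  have "integrable M (\<lambda>\<omega>. inside a b B \<omega> * exp (m * W s \<omega>))"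
    using bd by (intro integrable_bounded) auto
  then show "integrable M (\<lambda>\<omega>. exp_mart m s (W s \<omega>) * inside a b B \<omega>)"
    unfolding eqs by (intro integrable_mult_right)
  have "expectation (\<lambda>\<omega>. exp_mart m t (W t \<omega>) * inside a b B \<omega>) = exp (- m\<^sup>2 * (1 + t) / 2) * (exp (m\<^sup>2 * (t - s) / 2) * expectation (\<lambda>\<omega>. inside a b B \<omega> * exp (m * W s \<omega>)))"
    unfolding eqt using E(1) by simp
  also have "\<dots> = exp (- m\<^sup>2 * (1 + s) / 2) * expectation (\<lambda>\<omega>. inside a b B \<omega> * exp (m * W s \<omega>))"
  proof -
    have "- m\<^sup>2 * (1 + t) / 2 + m\<^sup>2 * (t - s) / 2 = - m\<^sup>2 * (1 + s) / 2"
      by (simp add: algebra_simps diff_divide_distrib add_divide_distrib)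
    then show ?thesis by (simp only: mult.assoc[symmetric] exp_add[symmetric])
  qed
  also have "\<dots> = expectation (\<lambda>\<omega>. exp_mart m s (W s \<omega>) * inside a b B \<omega>)" unfolding eqs by simp
  finally show "expectation (\<lambda>\<omega>. exp_mart m t (W t \<omega>) * inside a b B \<omega>) = expectation (\<lambda>\<omega>. exp_mart m s (W s \<omega>) * inside a b B \<omega>)" .
qed

lemma image_mart_step:
  assumes s: "0 \<le> s" "s < t" and B: "finite B" "B \<subseteq> {0..s}" "s \<in> B" and ab: "a > 0" "b > 0"
  shows "integrable M (\<lambda>\<omega>. image_mart a b K t (W t \<omega>) * inside a b B \<omega>)"
    and "integrable M (\<lambda>\<omega>. image_mart a b K s (W s \<omega>) * inside a b B \<omega>)"
    and "expectation (\<lambda>\<omega>. image_mart a b K t (W t \<omega>) * inside a b B \<omega>) = expectation (\<lambda>\<omega>. image_mart a b K s (W s \<omega>) * inside a b B \<omega>)"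
proof -
  have [measurable]: "inside a b B \<in> borel_measurable M" using B by (intro measurable_inside) auto
  have iI: "integrable M (inside a b B)" using inside_bounds by (intro integrable_bounded[where B=1]) auto
  note st = exp_mart_step[OF s B ab]
  have eq: "image_mart a b K r w * inside a b B \<omega> = inside a b B \<omega> + image_sum a b K (\<lambda>m. exp_mart m r w * inside a b B \<omega>)" for r w \<omega>
    by (simp add: image_mart_def distrib_right image_sum_mult_right)
  show "integrable M (\<lambda>\<omega>. image_mart a b K t (W t \<omega>) * inside a b B \<omega>)"
    "integrable M (\<lambda>\<omega>. image_mart a b K s (W s \<omega>) * inside a b B \<omega>)"
    "expectation (\<lambda>\<omega>. image_mart a b K t (W t \<omega>) * inside a b B \<omega>) = expectation (\<lambda>\<omega>. image_mart a b K s (W s \<omega>) * inside a b B \<omega>)"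
    unfolding eq using iI st expectation_image_sum[of "\<lambda>m \<omega>. exp_mart m t (W t \<omega>) * inside a b B \<omega>"]
      expectation_image_sum[of "\<lambda>m \<omega>. exp_mart m s (W s \<omega>) * inside a b B \<omega>"] by simp_all
qed

text \<open>For \<open>\<delta> \<le> 1 / 4\<close> the factor \<open>exp (x^2)\<close> at most
  doubles the variance: \<open>- x^2 / (2 \<delta>) + x^2 \<le> - x^2 / (4 \<delta>)\<close>. The
  normalisations differ by \<open>sqrt 2\<close>, and the fourth moment at variance
  \<open>2 \<delta>\<close> is \<open>3 (2 \<delta>)^2\<close>.\<close>

lemma increment_moment:
  assumes "0 \<le> s" "0 < \<delta>" "\<delta> \<le> 1 / 4"
  shows "integrable M (\<lambda>\<omega>. (W (s + \<delta>) \<omega> - W s \<omega>) ^ 4 * exp ((W (s + \<delta>) \<omega> - W s \<omega>)\<^sup>2))"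
    and "expectation (\<lambda>\<omega>. (W (s + \<delta>) \<omega> - W s \<omega>) ^ 4 * exp ((W (s + \<delta>) \<omega> - W s \<omega>)\<^sup>2)) \<le> 12 * sqrt 2 * \<delta>\<^sup>2"
proof -
  have D: "distributed M lborel (\<lambda>\<omega>. W (s + \<delta>) \<omega> - W s \<omega>) (normal_density 0 (sqrt \<delta>))"
    using increment_normal[of s "s + \<delta>"] assms by simp
  have le: "normal_density 0 (sqrt \<delta>) x * (x ^ 4 * exp (x\<^sup>2)) \<le> sqrt 2 * (normal_density 0 (sqrt (2 * \<delta>)) x * (x - 0) ^ 4)" for x
  proof -
    have "x\<^sup>2 * (4 * \<delta>) \<le> x\<^sup>2 * 1" using assms by (intro mult_left_mono) auto
    then have "- x\<^sup>2 / (2 * \<delta>) + x\<^sup>2 \<le> - x\<^sup>2 / (4 * \<delta>)" using assms by (simp add: field_simps)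
    then have "exp (- x\<^sup>2 / (2 * \<delta>)) * exp (x\<^sup>2) \<le> exp (- x\<^sup>2 / (4 * \<delta>))" by (simp flip: exp_add)
    then have "(1 / sqrt (2 * pi * \<delta>) * x ^ 4) * (exp (- x\<^sup>2 / (2 * \<delta>)) * exp (x\<^sup>2)) \<le> (1 / sqrt (2 * pi * \<delta>) * x ^ 4) * exp (- x\<^sup>2 / (4 * \<delta>))"
      using assms by (intro mult_left_mono) auto
    moreover have "sqrt 2 * (1 / sqrt (2 * pi * (sqrt (2 * \<delta>))\<^sup>2)) = 1 / sqrt (2 * pi * \<delta>)"
      using assms by (simp add: real_sqrt_mult)
    then have "sqrt 2 * (normal_density 0 (sqrt (2 * \<delta>)) x * (x - 0) ^ 4) = (1 / sqrt (2 * pi * \<delta>) * x ^ 4) * exp (- x\<^sup>2 / (4 * \<delta>))"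
      unfolding normal_density_def using assms by (simp only: mult.assoc[symmetric]) simp
    ultimately show ?thesis using assms by (simp add: normal_density_def mult_ac)
  qed
  have m4: "has_bochner_integral lborel (\<lambda>x. normal_density 0 (sqrt (2 * \<delta>)) x * (x - 0) ^ (2 * 2)) (fact (2 * 2) / ((2 / (sqrt (2 * \<delta>))\<^sup>2) ^ 2 * fact 2))"
    using assms by (intro normal_moment_even) auto
  then have i4: "integrable lborel (\<lambda>x. normal_density 0 (sqrt (2 * \<delta>)) x * (x - 0) ^ 4)"
    and v4: "(\<integral>x. normal_density 0 (sqrt (2 * \<delta>)) x * (x - 0) ^ 4 \<partial>lborel) = 12 * \<delta>\<^sup>2"
    using assms by (auto simp: has_bochner_integral_iff fact_numeral power_divide field_simps power2_eq_square)
  have i: "integrable lborel (\<lambda>x. normal_density 0 (sqrt \<delta>) x * (x ^ 4 * exp (x\<^sup>2)))"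
  proof (rule Bochner_Integration.integrable_bound)
    show "integrable lborel (\<lambda>x. sqrt 2 * (normal_density 0 (sqrt (2 * \<delta>)) x * (x - 0) ^ 4))"
      using i4 by (intro integrable_mult_right)
    show "AE x in lborel. norm (normal_density 0 (sqrt \<delta>) x * (x ^ 4 * exp (x\<^sup>2))) \<le> norm (sqrt 2 * (normal_density 0 (sqrt (2 * \<delta>)) x * (x - 0) ^ 4))"
      using le by (simp add: abs_mult)
  qed simp
  then show "integrable M (\<lambda>\<omega>. (W (s + \<delta>) \<omega> - W s \<omega>) ^ 4 * exp ((W (s + \<delta>) \<omega> - W s \<omega>)\<^sup>2))"
    using distributed_integrable[OF D, of "\<lambda>x. x ^ 4 * exp (x\<^sup>2)"] by simp
  have "expectation (\<lambda>\<omega>. (W (s + \<delta>) \<omega> - W s \<omega>) ^ 4 * exp ((W (s + \<delta>) \<omega> - W s \<omega>)\<^sup>2)) =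
     (\<integral>x. normal_density 0 (sqrt \<delta>) x * (x ^ 4 * exp (x\<^sup>2)) \<partial>lborel)"
    by (subst distributed_integral[OF D, of "\<lambda>x. x ^ 4 * exp (x\<^sup>2)", symmetric]) simp_all
  also have "\<dots> \<le> (\<integral>x. sqrt 2 * (normal_density 0 (sqrt (2 * \<delta>)) x * (x - 0) ^ 4) \<partial>lborel)"
    using i i4 le by (intro integral_mono integrable_mult_right)
  also have "\<dots> = 12 * sqrt 2 * \<delta>\<^sup>2" using v4 by simp
  finally show "expectation (\<lambda>\<omega>. (W (s + \<delta>) \<omega> - W s \<omega>) ^ 4 * exp ((W (s + \<delta>) \<omega> - W s \<omega>)\<^sup>2)) \<le> 12 * sqrt 2 * \<delta>\<^sup>2" .
qed

text \<open>The strip widens with time, so the overshoot past the line at the new time is at most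
  the increment.\<close>

lemma image_mart_exit:
  assumes \<delta>: "0 < \<delta>" and s: "0 \<le> s" and ab: "a > 0" "b > 0"
    and "W s \<omega> \<in> strip a b s" "W (s + \<delta>) \<omega> \<notin> strip a b (s + \<delta>)"
  shows "\<bar>image_mart a b K (s + \<delta>) (W (s + \<delta>) \<omega>)\<bar> \<le>
    exp (- 2 * (real K)\<^sup>2 * (a + b)\<^sup>2) + image_const a b * small_jump (W (s + \<delta>) \<omega> - W s \<omega>)"
proof -
  have pos: "0 < a * \<delta>" "0 < b * \<delta>" using \<delta> ab by auto
  have t: "0 \<le> s + \<delta>" using s \<delta> by simp
  from assms(6) consider "b * (1 + (s + \<delta>)) < W (s + \<delta>) \<omega>" | "W (s + \<delta>) \<omega> < - (a * (1 + (s + \<delta>)))"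
    unfolding strip_def by (auto simp: not_le)
  then show ?thesis
  proof cases
    case 1
    then have "W (s + \<delta>) \<omega> \<le> b * (1 + (s + \<delta>)) + \<bar>W (s + \<delta>) \<omega> - W s \<omega>\<bar>"
      using assms(5) pos by (auto simp: strip_def algebra_simps)
    from image_mart_overshoot_upper[OF t ab less_imp_le[OF 1] this] show ?thesis by (simp add: small_jump_def)
  next
    case 2
    then have "- (a * (1 + (s + \<delta>))) - \<bar>W (s + \<delta>) \<omega> - W s \<omega>\<bar> \<le> W (s + \<delta>) \<omega>"
      using assms(5) pos by (auto simp: strip_def algebra_simps)
    from image_mart_overshoot_lower[OF t ab less_imp_le[OF 2] this] show ?thesis by (simp add: small_jump_def)
  qed
qed

text \<open>The martingale property moves the time forward with the old weight. Replacing the old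
  weight by the new one affects only paths that leave the strip at this very step; their probability
  multiplies the first error, while the large-jump error is additive.\<close>

lemma image_mart_grid_step:
  fixes K :: nat
  assumes \<delta>: "0 < \<delta>" "\<delta> \<le> 1 / 4" and \<eta>: "\<eta> > 0" and ab: "a > 0" "b > 0"
  defines "\<rho> \<equiv> exp (- 2 * (real K)\<^sup>2 * (a + b)\<^sup>2)" and "C \<equiv> image_const a b"
  shows "\<bar>expectation (\<lambda>\<omega>. image_mart a b K (real n * \<delta>) (W (real n * \<delta>) \<omega>) * inside a b (grid \<delta> n) \<omega>)
      - expectation (\<lambda>\<omega>. image_mart a b K (real (Suc n) * \<delta>) (W (real (Suc n) * \<delta>) \<omega>) * inside a b (grid \<delta> (Suc n)) \<omega>)\<bar>
    \<le> (\<rho> + C * small_jump \<eta>) * (expectation (inside a b (grid \<delta> n)) - expectation (inside a b (grid \<delta> (Suc n))))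
      + C * (12 * sqrt 2 * \<delta>\<^sup>2 / \<eta> ^ 3)"
proof -
  define s where "s = real n * \<delta>"
  define t where "t = s + \<delta>"
  have st: "0 \<le> s" "s < t" "0 \<le> t" using \<delta> by (auto simp: s_def t_def)
  have t: "real (Suc n) * \<delta> = t" by (simp add: t_def s_def algebra_simps)
  define I J where "I = inside a b (grid \<delta> n)" and "J = inside a b (grid \<delta> (Suc n))"
  define \<xi> where "\<xi> = (\<lambda>\<omega>. W t \<omega> - W s \<omega>)"
  have C: "C > 0" using ab by (simp add: C_def image_const_pos)
  have \<rho>: "\<rho> \<ge> 0" by (simp add: \<rho>_def)
  note G = grid_props(1)[of \<delta> n] grid_props(2)[OF \<delta>(1), of n, folded s_def] grid_props(3)[of n \<delta>, folded s_def]
  note G' = grid_props(1)[of \<delta> "Suc n"] grid_props(2)[OF \<delta>(1), of "Suc n", unfolded t] grid_props(3)[of "Suc n" \<delta>, unfolded t]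
  note step = image_mart_step[OF st(1,2) G ab, of K, folded I_def]
  have JI: "J \<omega> = I \<omega> * indicator (strip a b t) (W t \<omega>)" for \<omega>
    using G(1) G' unfolding J_def I_def by (auto simp: inside_eq grid_Suc t_def s_def)
  note [measurable] = measurable_W[OF st(1)] measurable_W[OF st(3)]
  have [measurable]: "I \<in> borel_measurable M" "J \<in> borel_measurable M"
    using G G' by (auto simp: I_def J_def intro!: measurable_inside)
  have I01: "I \<omega> = 0 \<or> I \<omega> = 1" for \<omega> using G(1) by (auto simp: I_def inside_eq)
  have JI': "0 \<le> I \<omega> - J \<omega>" "I \<omega> - J \<omega> \<le> 1" "\<bar>J \<omega>\<bar> \<le> 1" "\<bar>I \<omega>\<bar> \<le> 1" for \<omega> using I01[of \<omega>] by (auto simp: JI indicator_def)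
  have iI: "integrable M I" "integrable M J" using JI' by (auto intro!: integrable_bounded[where B=1])
  let ?N = "\<lambda>\<omega>. image_mart a b K t (W t \<omega>)"
  have mN[measurable]: "?N \<in> borel_measurable M" unfolding image_mart_def image_sum_def exp_mart_def by measurable
  have iJ: "integrable M (\<lambda>\<omega>. ?N \<omega> * J \<omega>)"
  proof (rule Bochner_Integration.integrable_bound[OF step(1)])
    show "AE \<omega> in M. norm (?N \<omega> * J \<omega>) \<le> norm (?N \<omega> * I \<omega>)" by (auto simp: JI indicator_def)
  qed measurable
  have mom: "integrable M (\<lambda>\<omega>. \<xi> \<omega> ^ 4 * exp ((\<xi> \<omega>)\<^sup>2))" "expectation (\<lambda>\<omega>. \<xi> \<omega> ^ 4 * exp ((\<xi> \<omega>)\<^sup>2)) \<le> 12 * sqrt 2 * \<delta>\<^sup>2"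
    using increment_moment[OF st(1) \<delta>] by (simp_all add: \<xi>_def t_def)
  have pw: "\<bar>?N \<omega> * I \<omega> - ?N \<omega> * J \<omega>\<bar> \<le> (\<rho> + C * small_jump \<eta>) * (I \<omega> - J \<omega>) + C / \<eta> ^ 3 * (\<xi> \<omega> ^ 4 * exp ((\<xi> \<omega>)\<^sup>2))" for \<omega>
  proof (cases "I \<omega> = 1 \<and> W t \<omega> \<notin> strip a b t")
    case True
    then have "W s \<omega> \<in> strip a b s" using G(1,3) by (auto simp: I_def inside_eq split: if_splits)
    with True have "\<bar>?N \<omega>\<bar> \<le> \<rho> + C * small_jump (\<xi> \<omega>)"
      using image_mart_exit[OF \<delta>(1) st(1) ab, of \<omega> K] by (simp add: \<rho>_def C_def t_def \<xi>_def)
    also have "\<dots> \<le> \<rho> + C * (small_jump \<eta> + \<xi> \<omega> ^ 4 * exp ((\<xi> \<omega>)\<^sup>2) / \<eta> ^ 3)"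
      using small_jump_le[OF \<eta>] C by (intro add_mono mult_left_mono) auto
    finally show ?thesis using True by (simp add: JI distrib_left mult_ac)
  next
    case False
    then have "I \<omega> = J \<omega>" using I01[of \<omega>] by (auto simp: JI)
    then show ?thesis using C \<eta> by simp
  qed
  have "\<bar>expectation (\<lambda>\<omega>. ?N \<omega> * I \<omega>) - expectation (\<lambda>\<omega>. ?N \<omega> * J \<omega>)\<bar> = \<bar>expectation (\<lambda>\<omega>. ?N \<omega> * I \<omega> - ?N \<omega> * J \<omega>)\<bar>"
    using step(1) iJ by simp
  also have "\<dots> \<le> expectation (\<lambda>\<omega>. \<bar>?N \<omega> * I \<omega> - ?N \<omega> * J \<omega>\<bar>)" by (rule integral_abs_bound)
  also have "\<dots> \<le> expectation (\<lambda>\<omega>. (\<rho> + C * small_jump \<eta>) * (I \<omega> - J \<omega>) + C / \<eta> ^ 3 * (\<xi> \<omega> ^ 4 * exp ((\<xi> \<omega>)\<^sup>2)))"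
    using step(1) iJ iI mom(1) pw
    by (intro integral_mono Bochner_Integration.integrable_add integrable_mult_right Bochner_Integration.integrable_diff integrable_abs)
  also have "\<dots> = (\<rho> + C * small_jump \<eta>) * (expectation I - expectation J) + C / \<eta> ^ 3 * expectation (\<lambda>\<omega>. \<xi> \<omega> ^ 4 * exp ((\<xi> \<omega>)\<^sup>2))"
    using iI mom(1) by (simp add: integrable_mult_right)
  also have "\<dots> \<le> (\<rho> + C * small_jump \<eta>) * (expectation I - expectation J) + C / \<eta> ^ 3 * (12 * sqrt 2 * \<delta>\<^sup>2)"
    using mom(2) C \<eta> by (intro add_left_mono mult_left_mono) auto
  finally show ?thesis
    using step(3) unfolding t s_def[symmetric] I_def[symmetric] J_def[symmetric] by simp
qed

text \<open>The exit probabilities of the steps telescope to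
  \<open>1 - expectation (inside a b (grid \<delta> n))\<close>, so the boundary error does not
  accumulate; only the \<open>\<delta>^2\<close> error is multiplied by \<open>n\<close>.\<close>

lemma image_mart_grid:
  fixes K :: nat
  assumes \<delta>: "0 < \<delta>" "\<delta> \<le> 1 / 4" and \<eta>: "\<eta> > 0" and ab: "a > 0" "b > 0"
  defines "\<rho> \<equiv> exp (- 2 * (real K)\<^sup>2 * (a + b)\<^sup>2)" and "C \<equiv> image_const a b"
  shows "\<bar>image_mart a b K 0 0
      - expectation (\<lambda>\<omega>. image_mart a b K (real n * \<delta>) (W (real n * \<delta>) \<omega>) * inside a b (grid \<delta> n) \<omega>)\<bar>
    \<le> (\<rho> + C * small_jump \<eta>) * (1 - expectation (inside a b (grid \<delta> n))) + real n * (C * (12 * sqrt 2 * \<delta>\<^sup>2 / \<eta> ^ 3))"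
proof (induction n)
  case 0
  have m0[measurable]: "W 0 \<in> borel_measurable M" by simp
  \<comment> \<open>The covariance hypothesis fixes the start only through its variance 0, hence up
    to a null set.\<close>
  have "AE \<omega> in M. W 0 \<omega> * W 0 \<omega> = 0"
    using integral_nonneg_eq_0_iff_AE[OF integrable_W_mult[of 0 0]] cov[of 0 0] by simp
  then have ae: "AE \<omega> in M. W 0 \<omega> = 0" by eventually_elim simp
  have "expectation (inside a b {0}) = expectation (\<lambda>_. 1)"
    by (intro integral_cong_AE) (use ae ab in \<open>auto simp: inside_def strip_def\<close>)
  moreover have "expectation (\<lambda>\<omega>. image_mart a b K 0 (W 0 \<omega>) * inside a b {0} \<omega>) = expectation (\<lambda>_. image_mart a b K 0 0)"
  proof (rule integral_cong_AE)
    show "(\<lambda>\<omega>. image_mart a b K 0 (W 0 \<omega>) * inside a b {0} \<omega>) \<in> borel_measurable M"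
      unfolding image_mart_def image_sum_def exp_mart_def by measurable
    show "AE \<omega> in M. image_mart a b K 0 (W 0 \<omega>) * inside a b {0} \<omega> = image_mart a b K 0 0"
      using ae by eventually_elim (use ab in \<open>auto simp: inside_def strip_def\<close>)
  qed simp
  ultimately show ?case by (simp add: grid_def prob_space)
next
  case (Suc n)
  have chain: "\<bar>e - y\<bar> \<le> D * (1 - q) + k' * c"
    if "\<bar>e - x\<bar> \<le> D * (1 - p) + k * c" "\<bar>x - y\<bar> \<le> D * (p - q) + c" "k' = k + 1" for e x y D p q c k k' :: real
    using that by (simp add: algebra_simps)
  show ?case
    by (rule chain[OF Suc image_mart_grid_step[OF \<delta> \<eta> ab, of K n, folded \<rho>_def C_def]]) simp
qed

text \<open>Between the lines the deviation from 1 is controlled by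
  \<open>(W T)^2 / (1 + T)^2\<close>, whose mean \<open>T / (1 + T)^2\<close> is at most
  \<open>1 / (1 + T)\<close>.\<close>

lemma image_mart_final:
  assumes T: "T \<ge> 0" and B: "finite B" "B \<subseteq> {0..T}" "T \<in> B" and ab: "a > 0" "b > 0"
  shows "\<bar>expectation (\<lambda>\<omega>. image_mart a b K T (W T \<omega>) * inside a b B \<omega>) - expectation (inside a b B)\<bar>
    \<le> image_const a b * (exp (- (min a b)\<^sup>2 * T) + 4 / ((1 + T) * (min a b)\<^sup>2))"
proof -
  let ?C = "image_const a b" and ?N = "\<lambda>\<omega>. image_mart a b K T (W T \<omega>)" and ?I = "inside a b B"
  let ?X = "\<lambda>\<omega>. exp (- (min a b)\<^sup>2 * T) + 4 * (W T \<omega>)\<^sup>2 / ((1 + T)\<^sup>2 * (min a b)\<^sup>2)"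
  have C: "?C > 0" using ab by (rule image_const_pos)
  have [measurable]: "?I \<in> borel_measurable M" using B by (intro measurable_inside) auto
  have iI: "integrable M ?I" using inside_bounds by (intro integrable_bounded[where B=1]) auto
  \<comment> \<open>Any later time would do in place of \<open>T + 1\<close>; only the integrability
    at the earlier time is used.\<close>
  have iN: "integrable M (\<lambda>\<omega>. ?N \<omega> * ?I \<omega>)"
    using T by (rule image_mart_step(2)[OF _ _ B ab, of "T + 1"]) simp
  have i2: "integrable M (\<lambda>\<omega>. (W T \<omega>)\<^sup>2)" "expectation (\<lambda>\<omega>. (W T \<omega>)\<^sup>2) = T"
    using integrable_W_mult[OF T T] cov[OF T T] by (simp_all add: power2_eq_square)
  have mp: "min a b > 0" using ab by simp
  have "\<bar>expectation (\<lambda>\<omega>. ?N \<omega> * ?I \<omega>) - expectation ?I\<bar> = \<bar>expectation (\<lambda>\<omega>. ?N \<omega> * ?I \<omega> - ?I \<omega>)\<bar>"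
    using iI iN by simp
  also have "\<dots> \<le> expectation (\<lambda>\<omega>. \<bar>?N \<omega> * ?I \<omega> - ?I \<omega>\<bar>)" by (rule integral_abs_bound)
  also have "\<dots> \<le> expectation (\<lambda>\<omega>. ?C * ?X \<omega>)"
  proof (rule integral_mono)
    show "integrable M (\<lambda>\<omega>. \<bar>?N \<omega> * ?I \<omega> - ?I \<omega>\<bar>)" using iI iN by simp
    show "integrable M (\<lambda>\<omega>. ?C * ?X \<omega>)" using i2 by simp
    fix \<omega>
    show "\<bar>?N \<omega> * ?I \<omega> - ?I \<omega>\<bar> \<le> ?C * ?X \<omega>"
    proof (cases "?I \<omega> = 1")
      case True
      then have "W T \<omega> \<in> strip a b T" using B by (auto simp: inside_eq split: if_splits)
      then show ?thesis using image_mart_inside[OF T ab, of "W T \<omega>" K] True by (simp add: strip_def)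
    next
      case False
      then have "?I \<omega> = 0" using B(1) by (simp add: inside_eq split: if_splits)
      then show ?thesis using C by simp
    qed
  qed
  also have "\<dots> = ?C * (exp (- (min a b)\<^sup>2 * T) + 4 * T / ((1 + T)\<^sup>2 * (min a b)\<^sup>2))"
    using i2 by (simp add: prob_space)
  also have "\<dots> \<le> ?C * (exp (- (min a b)\<^sup>2 * T) + 4 / ((1 + T) * (min a b)\<^sup>2))"
  proof -
    have "4 * T / ((1 + T)\<^sup>2 * (min a b)\<^sup>2) = T / (1 + T) * (4 / ((1 + T) * (min a b)\<^sup>2))"
      using T by (simp add: power2_eq_square mult_ac)
    also have "\<dots> \<le> 1 * (4 / ((1 + T) * (min a b)\<^sup>2))" using T by (intro mult_right_mono) auto
    finally show ?thesis using C by (intro mult_left_mono add_mono) auto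
  qed
  finally show ?thesis .
qed

end

context brownian_gaussian
begin

text \<open>With mesh \<open>2^(-i)\<close> and horizon \<open>i\<close> there are
  \<open>i 2^i\<close> steps, and the accumulated jump error is of order \<open>i / 2^i\<close>. The
  limits are taken in the order \<open>i\<close>, then \<open>\<eta>\<close>, then \<open>K\<close>:
  the threshold must be fixed while the mesh shrinks, and the truncation is harmless only at the
  end.\<close>

lemma image_mart_tendsto:
  assumes ab: "a > 0" "b > 0"
    and lim: "(\<lambda>i. expectation (inside a b (grid (1 / 2 ^ i) (i * 2 ^ i)))) \<longlonglongrightarrow> p"
  shows "(\<lambda>K. image_mart a b K 0 0) \<longlonglongrightarrow> p"
proof -
  let ?C = "image_const a b" and ?\<kappa> = "min a b"
  let ?\<rho> = "\<lambda>K. exp (- 2 * (real K)\<^sup>2 * (a + b)\<^sup>2)"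
  have C: "?C > 0" using ab by (rule image_const_pos)
  have \<kappa>: "?\<kappa> > 0" using ab by simp
  have lim1: "(\<lambda>i. exp (- k * real i)) \<longlonglongrightarrow> 0" and lim2: "(\<lambda>i. 4 / ((1 + real i) * k)) \<longlonglongrightarrow> 0"
    and lim3: "(\<lambda>i. exp (- 2 * (real i)\<^sup>2 * k)) \<longlonglongrightarrow> 0" if "0 < k" for k :: real
    using that by real_asymp+
  have 1: "\<bar>image_mart a b K 0 0 - p\<bar> \<le> ?\<rho> K + ?C * small_jump \<eta>" if \<eta>: "\<eta> > 0" for K \<eta>
  proof (rule LIMSEQ_le)
    let ?R = "\<lambda>i. ?\<rho> K + ?C * small_jump \<eta> + ?C * (12 * sqrt 2 / \<eta> ^ 3) * (real i / 2 ^ i)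
       + ?C * (exp (- ?\<kappa>\<^sup>2 * real i) + 4 / ((1 + real i) * ?\<kappa>\<^sup>2))"
    let ?p = "\<lambda>i. expectation (inside a b (grid (1 / 2 ^ i) (i * 2 ^ i)))"
    show "(\<lambda>i. \<bar>image_mart a b K 0 0 - ?p i\<bar>) \<longlonglongrightarrow> \<bar>image_mart a b K 0 0 - p\<bar>"
      using lim by (intro tendsto_intros)
    have "(\<lambda>i. real i / 2 ^ i) \<longlonglongrightarrow> 0" by real_asymp
    moreover have "(\<lambda>i. exp (- ?\<kappa>\<^sup>2 * real i)) \<longlonglongrightarrow> 0"
      by (rule lim1[OF zero_less_power[OF \<kappa>]])
    moreover have "(\<lambda>i. 4 / ((1 + real i) * ?\<kappa>\<^sup>2)) \<longlonglongrightarrow> 0"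
      by (rule lim2[OF zero_less_power[OF \<kappa>]])
    ultimately have "?R \<longlonglongrightarrow> ?\<rho> K + ?C * small_jump \<eta> + ?C * (12 * sqrt 2 / \<eta> ^ 3) * 0 + ?C * (0 + 0)"
      by (intro tendsto_intros)
    then show "?R \<longlonglongrightarrow> ?\<rho> K + ?C * small_jump \<eta>" by simp
    have "\<bar>image_mart a b K 0 0 - ?p i\<bar> \<le> ?R i" if i: "i \<ge> 2" for i
    proof -
      define \<delta> where "\<delta> = 1 / (2::real) ^ i"
      define n where "n = i * 2 ^ i"
      have "(2::real) ^ 2 \<le> 2 ^ i" using i by (intro power_increasing) auto
      then have \<delta>: "0 < \<delta>" "\<delta> \<le> 1 / 4" by (auto simp: \<delta>_def field_simps)
      have n\<delta>: "real n * \<delta> = real i" by (simp add: n_def \<delta>_def)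
      have "0 \<le> expectation (inside a b (grid \<delta> n))" by (simp add: inside_bounds)
      then have f1: "(?\<rho> K + ?C * small_jump \<eta>) * (1 - expectation (inside a b (grid \<delta> n))) \<le> (?\<rho> K + ?C * small_jump \<eta>) * 1"
        using C by (intro mult_left_mono) (auto simp: small_jump_def)
      have f2: "real n * (?C * (12 * sqrt 2 * \<delta>\<^sup>2 / \<eta> ^ 3)) = ?C * (12 * sqrt 2 / \<eta> ^ 3) * (real i / 2 ^ i)"
        by (simp add: n_def \<delta>_def power2_eq_square mult_ac)
      have f3: "\<bar>expectation (\<lambda>\<omega>. image_mart a b K (real n * \<delta>) (W (real n * \<delta>) \<omega>) * inside a b (grid \<delta> n) \<omega>) - expectation (inside a b (grid \<delta> n))\<bar>
          \<le> ?C * (exp (- ?\<kappa>\<^sup>2 * real i) + 4 / ((1 + real i) * ?\<kappa>\<^sup>2))"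
        using image_mart_final[OF _ grid_props(1) grid_props(2)[OF \<delta>(1)] grid_props(3) ab, of n K] \<delta> unfolding n\<delta> by simp
      have chain: "\<bar>e - q\<bar> \<le> D + c + g" if "D * (1 - q) \<le> D * 1" "B = c" "\<bar>e - x\<bar> \<le> D * (1 - q) + B" "\<bar>x - q\<bar> \<le> g"
        for e x q D B c g :: real using that by (simp only: mult_1_right)
      show ?thesis
        unfolding \<delta>_def[symmetric] n_def[symmetric]
        by (rule chain[OF f1 f2 image_mart_grid[OF \<delta> \<eta> ab, of K n] f3])
    qed
    then show "\<exists>N. \<forall>i\<ge>N. \<bar>image_mart a b K 0 0 - ?p i\<bar> \<le> ?R i" by blast
  qed
  have 2: "\<bar>image_mart a b K 0 0 - p\<bar> \<le> ?\<rho> K" for K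
  proof (rule tendsto_lowerbound)
    have "continuous (at_right 0) (\<lambda>\<eta>. ?\<rho> K + ?C * small_jump \<eta>)"
      unfolding small_jump_def by (intro continuous_intros)
    then show "((\<lambda>\<eta>. ?\<rho> K + ?C * small_jump \<eta>) \<longlongrightarrow> ?\<rho> K) (at_right 0)"
      by (simp add: continuous_within small_jump_def)
    show "\<forall>\<^sub>F \<eta> in at_right 0. \<bar>image_mart a b K 0 0 - p\<bar> \<le> ?\<rho> K + ?C * small_jump \<eta>"
      using 1 by (auto simp: eventually_at_filter)
  qed simp
  have "?\<rho> \<longlonglongrightarrow> 0"
    by (rule lim3) (use ab in simp)
  then have "(\<lambda>K. image_mart a b K 0 0 - p) \<longlonglongrightarrow> 0"
    by (rule Lim_null_comparison[rotated]) (use 2 in auto)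
  then show ?thesis by (simp add: LIM_zero_iff)
qed

end

text \<open>\<open>kol c = P(M\<^sup>+ > c)\<close> is the one-sided Kolmogorov tail. The terms of the joint law are grouped so that
  their derivatives along \<open>b = x a\<close> have absolutely summable integrals, which fails for the usual
  grouping \<open>2 kol (n L) - kol (n L - a) - kol (n L - b)\<close>.\<close>

definition kol :: "real \<Rightarrow> real" where
  "kol c = exp (- 2 * c\<^sup>2)"

definition kterm :: "nat \<Rightarrow> real \<Rightarrow> real \<Rightarrow> real" where
  "kterm n a b = kol (real n * (a + b)) + kol ((real n + 1) * (a + b)) - kol ((real n + 1) * a + real n * b) - kol (real n * a + (real n + 1) * b)"

subsection \<open>The joint law of the extrema of the bridge\<close>

text \<open>With \<open>\<phi> s = s / (1 + s)\<close> one has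
  \<open>1 - \<phi> t = 1 / (1 + t)\<close>, so the bridge covariance
  \<open>\<phi> s * (1 - \<phi> t)\<close> times \<open>(1 + s) * (1 + t)\<close> is
  \<open>s\<close> for \<open>s \<le> t\<close>.\<close>

lemma (in prob_space) bridge_imp_brownian_gaussian:
  assumes "standard_brownian_bridge M U"
  shows "brownian_gaussian M (\<lambda>s \<omega>. (1 + s) * U (s / (1 + s)) \<omega>)"
proof
  define \<phi> :: "real \<Rightarrow> real" where "\<phi> s = s / (1 + s)" for s
  define \<psi> :: "real \<Rightarrow> real" where "\<psi> t = t / (1 - t)" for t
  have \<phi>: "\<phi> s \<in> {0..1}" and \<psi>: "\<psi> (\<phi> s) = s" if "0 \<le> s" for s
  proof -
    show "\<phi> s \<in> {0..1}" using that by (simp add: \<phi>_def)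
    have "1 - s / (1 + s) = 1 / (1 + s)" using that by (simp add: field_simps)
    then show "\<psi> (\<phi> s) = s" using that by (simp add: \<phi>_def \<psi>_def)
  qed
  have U: "gaussian_process M {0..1} U" "\<And>t. t \<in> {0..1} \<Longrightarrow> expectation (U t) = 0"
    "\<And>s t. s \<in> {0..1} \<Longrightarrow> t \<in> {0..1} \<Longrightarrow> covar M (U s) (U t) = min s t - s * t"
    using assms by (auto simp: standard_brownian_bridge_def)
  show "gaussian_process M {0..} (\<lambda>s \<omega>. (1 + s) * U (s / (1 + s)) \<omega>)"
    unfolding gaussian_process_def
  proof (intro allI impI, elim conjE)
    fix J :: "real set" and c :: "real \<Rightarrow> real" assume J: "finite J" "J \<subseteq> {0..}"
    \<comment> \<open>Distinct times stay distinct under \<open>\<phi>\<close>, so a linear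
      combination of the new process is one of \<open>U\<close> with coefficients transported by the
      inverse \<open>\<psi>\<close>.\<close>
    have inj: "inj_on \<phi> J" using \<psi> J(2) by (intro inj_on_inverseI[of _ \<psi>]) auto
    have "(\<Sum>s\<in>J. c s * ((1 + s) * U (s / (1 + s)) \<omega>)) = (\<Sum>t\<in>\<phi> ` J. (c (\<psi> t) * (1 + \<psi> t)) * U t \<omega>)" for \<omega>
      unfolding sum.reindex[OF inj] o_def using \<psi> J(2) by (intro sum.cong) (auto simp: \<phi>_def[symmetric])
    moreover have "gaussian_rv M (\<lambda>\<omega>. \<Sum>t\<in>\<phi> ` J. (c (\<psi> t) * (1 + \<psi> t)) * U t \<omega>)"
      by (rule gaussian_processD[OF U(1)]) (use J \<phi> in auto)
    ultimately show "gaussian_rv M (\<lambda>\<omega>. \<Sum>s\<in>J. c s * ((1 + s) * U (s / (1 + s)) \<omega>))" by simp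
  qed
  show "expectation (\<lambda>\<omega>. (1 + s) * U (s / (1 + s)) \<omega>) = 0" if "0 \<le> s" for s
    using U(2)[OF \<phi>[OF that]] by (simp add: \<phi>_def)
  have cov: "expectation (\<lambda>\<omega>. (1 + s) * U (s / (1 + s)) \<omega> * ((1 + t) * U (t / (1 + t)) \<omega>)) = s" if "0 \<le> s" "s \<le> t" for s t
  proof -
    have t: "0 \<le> t" using that by simp
    have le: "\<phi> s \<le> \<phi> t" using that t by (simp add: \<phi>_def divide_simps) (simp add: algebra_simps)
    have "(1 + s) * U (s / (1 + s)) \<omega> * ((1 + t) * U (t / (1 + t)) \<omega>) = ((1 + s) * (1 + t)) * (U (\<phi> s) \<omega> * U (\<phi> t) \<omega>)" for \<omega>
      by (simp only: \<phi>_def mult_ac)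
    then have "expectation (\<lambda>\<omega>. (1 + s) * U (s / (1 + s)) \<omega> * ((1 + t) * U (t / (1 + t)) \<omega>)) =
        ((1 + s) * (1 + t)) * expectation (\<lambda>\<omega>. U (\<phi> s) \<omega> * U (\<phi> t) \<omega>)"
      by (simp only: integral_mult_right_zero)
    also have "expectation (\<lambda>\<omega>. U (\<phi> s) \<omega> * U (\<phi> t) \<omega>) = covar M (U (\<phi> s)) (U (\<phi> t))"
      unfolding covar_def U(2)[OF \<phi>[OF that(1)]] U(2)[OF \<phi>[OF t]] by simp
    also have "\<dots> = \<phi> s - \<phi> s * \<phi> t"
      using U(3)[OF \<phi>[OF that(1)] \<phi>[OF t]] min_absorb1[OF le] by simp
    also have "\<phi> s - \<phi> s * \<phi> t = \<phi> s * (1 / (1 + t))"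
    proof -
      have "1 - \<phi> t = 1 / (1 + t)" using t by (simp add: \<phi>_def field_simps)
      then show ?thesis by (metis mult.right_neutral right_diff_distrib)
    qed
    also have "((1 + s) * (1 + t)) * (\<phi> s * (1 / (1 + t))) = s" using that t by (simp add: \<phi>_def)
    finally show ?thesis .
  qed
  show "expectation (\<lambda>\<omega>. (1 + s) * U (s / (1 + s)) \<omega> * ((1 + t) * U (t / (1 + t)) \<omega>)) = min s t"
    if "0 \<le> s" "0 \<le> t" for s t
    using cov[of s t] cov[of t s] that by (cases "s \<le> t") (simp_all add: min_def mult.commute)
qed

section \<open>From dyadic times to whole paths\<close>

definition dyadic_grid :: "nat \<Rightarrow> real set" where
  "dyadic_grid i = grid (1 / 2 ^ i) (i * 2 ^ i)"

lemma dyadic_grid_nonneg: "s \<in> dyadic_grid i \<Longrightarrow> 0 \<le> s"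
  by (auto simp: dyadic_grid_def grid_def)

lemma finite_dyadic_grid: "finite (dyadic_grid i)"
  by (simp add: dyadic_grid_def grid_def)

lemma dyadic_grid_mono: "dyadic_grid i \<subseteq> dyadic_grid (Suc i)"
proof
  fix s assume "s \<in> dyadic_grid i"
  then obtain j where j: "j \<le> i * 2 ^ i" "s = real j * (1 / 2 ^ i)" by (auto simp: dyadic_grid_def grid_def)
  have "2 * j \<le> Suc i * 2 ^ Suc i" using j(1) by simp
  moreover have "s = real (2 * j) * (1 / 2 ^ Suc i)" using j(2) by simp
  ultimately show "s \<in> dyadic_grid (Suc i)" unfolding dyadic_grid_def grid_def by blast
qed

text \<open>Times \<open>t < 1\<close> correspond to \<open>s = t / (1 - t)\<close>, which dyadic
  points approximate from below; \<open>t = 1\<close> corresponds to no finite \<open>s\<close> and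
  is reached by a second limit.\<close>

lemma closed_path_dyadic:
  fixes f :: "real \<Rightarrow> real"
  assumes f: "continuous_on {0..1} f" and S: "closed S" and grid: "\<And>i s. s \<in> dyadic_grid i \<Longrightarrow> f (s / (1 + s)) \<in> S"
    and t: "t \<in> {0..1}"
  shows "f t \<in> S"
proof -
  define D where "D = {t \<in> {0..1}. f t \<in> S}"
  have D: "closed D" unfolding D_def using continuous_closed_preimage[OF f _ S] by (simp add: vimage_def Int_def)
  have less1: "t \<in> D" if t: "0 \<le> t" "t < 1" for t
  proof -
    define s where "s = t / (1 - t)"
    have s: "0 \<le> s" "s / (1 + s) = t" using t by (auto simp: s_def field_simps)
    \<comment> \<open>The dyadic floor of \<open>s\<close> at level \<open>i\<close>; it lies in the
      grid as soon as the horizon \<open>i\<close> exceeds \<open>s\<close>.\<close>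
    define q where "q i = real (nat \<lfloor>s * 2 ^ i\<rfloor>) * (1 / 2 ^ i)" for i :: nat
    have fl: "real (nat \<lfloor>s * 2 ^ i\<rfloor>) = of_int \<lfloor>s * 2 ^ i\<rfloor>" for i using s by simp
    have q1: "s - 1 / 2 ^ i \<le> q i" "q i \<le> s" for i
    proof -
      have "(s * 2 ^ i - 1) * (1 / 2 ^ i) \<le> of_int \<lfloor>s * 2 ^ i\<rfloor> * (1 / 2 ^ i)" "of_int \<lfloor>s * 2 ^ i\<rfloor> * (1 / 2 ^ i) \<le> (s * 2 ^ i) * (1 / 2 ^ i)"
        by (intro mult_right_mono; simp; linarith)+
      then show "s - 1 / 2 ^ i \<le> q i" "q i \<le> s" unfolding q_def fl by (simp_all add: diff_divide_distrib)
    qed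
    have q0: "0 \<le> q i" for i by (simp add: q_def)
    have "(\<lambda>i. s - 1 / 2 ^ i) \<longlonglongrightarrow> s - 0"
      by (intro tendsto_intros LIMSEQ_divide_realpow_zero) simp
    then have "q \<longlonglongrightarrow> s"
      using q1 by (intro tendsto_sandwich[of "\<lambda>i. s - 1 / 2 ^ i" q _ "\<lambda>_. s"]) auto
    then have lim: "(\<lambda>i. q i / (1 + q i)) \<longlonglongrightarrow> t"
      unfolding s(2)[symmetric] using s(1) by (intro tendsto_intros) auto
    have ev: "eventually (\<lambda>i. q i / (1 + q i) \<in> D) sequentially"
      using eventually_ge_at_top[of "nat \<lceil>s\<rceil>"]
    proof eventually_elim
      case (elim i)
      then have "s \<le> real i" by linarith
      from mult_right_mono[OF this, of "2 ^ i"] have "s * 2 ^ i \<le> real (i * 2 ^ i)" by simp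
      then have "\<lfloor>s * 2 ^ i\<rfloor> \<le> int (i * 2 ^ i)" by linarith
      then have "nat \<lfloor>s * 2 ^ i\<rfloor> \<le> i * 2 ^ i" by (simp only: nat_le_iff)
      then have "q i \<in> dyadic_grid i" unfolding dyadic_grid_def grid_def q_def by blast
      then have "f (q i / (1 + q i)) \<in> S" by (rule grid)
      then show ?case using q0[of i] by (auto simp: D_def field_simps)
    qed
    show ?thesis by (rule Lim_in_closed_set[OF D ev _ lim]) simp
  qed
  have "t \<in> D"
  proof (cases "t < 1")
    case False
    have "(\<lambda>n. 1 - 1 / real (Suc n)) \<longlonglongrightarrow> 1 - 0"
      by (intro tendsto_intros LIMSEQ_Suc lim_1_over_n)
    moreover have "eventually (\<lambda>n. 1 - 1 / real (Suc n) \<in> D) sequentially"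
      by (intro always_eventually allI less1) (auto simp: field_simps)
    ultimately have "1 \<in> D" using D by (intro Lim_in_closed_set[of D "\<lambda>n. 1 - 1 / real (Suc n)" sequentially 1]) auto
    then show ?thesis using False t by (simp add: antisym)
  qed (use t less1 in auto)
  then show ?thesis by (simp add: D_def)
qed

text \<open>Regrouping splits each pair of equal terms \<open>kol (n (a + b))\<close> between two
  neighbouring summands; the last half-pair is left over and tends to 0. In this grouping
  \<open>kterm\<close> is a mixed second difference of \<open>kol\<close> with steps
  \<open>a\<close> and \<open>b\<close> from \<open>n (a + b)\<close>.\<close>

lemma sum_kterm: "(\<Sum>n<K. kterm n a b) = image_mart a b K 0 0 - kol (real K * (a + b))"
proof (induction K)
  case 0 then show ?case by (simp add: image_mart_def image_sum_def kol_def)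
next
  case (Suc K)
  have e: "exp_mart m 0 0 = kol (m / 2)" for m by (simp add: exp_mart_def kol_def power2_eq_square)
  define m where "m = 2 * real (Suc K) * (a + b)"
  have "image_mart a b (Suc K) 0 0 = image_mart a b K 0 0 + (kol (m / 2) + kol (- m / 2) - kol ((m - 2 * a) / 2) - kol ((2 * b - m) / 2))"
    unfolding m_def by (simp add: image_mart_def image_sum_def e del: of_nat_Suc)
  moreover have "m / 2 = (real K + 1) * (a + b)" "- m / 2 = - ((real K + 1) * (a + b))"
    "(m - 2 * a) / 2 = real K * a + (real K + 1) * b" "(2 * b - m) / 2 = - ((real K + 1) * a + real K * b)"
    by (simp_all add: m_def field_simps)
  moreover have "kol (- x) = kol x" for x by (simp add: kol_def)
  ultimately have "image_mart a b (Suc K) 0 0 = image_mart a b K 0 0 + (kol ((real K + 1) * (a + b)) + kol ((real K + 1) * (a + b))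
      - kol (real K * a + (real K + 1) * b) - kol ((real K + 1) * a + real K * b))"
    by metis
  moreover have "real (Suc K) = real K + 1" by simp
  ultimately show ?case unfolding sum.lessThan_Suc Suc unfolding kterm_def by (simp only:)
qed

locale brownian_bridge = prob_space M for M :: "'a measure" +
  fixes U :: "real \<Rightarrow> 'a \<Rightarrow> real"
  assumes bridge: "standard_brownian_bridge M U"
begin

sublocale W: brownian_gaussian M "\<lambda>s \<omega>. (1 + s) * U (s / (1 + s)) \<omega>"
  by (rule bridge_imp_brownian_gaussian[OF bridge])

lemma continuous_path: "\<omega> \<in> space M \<Longrightarrow> continuous_on {0..1} (\<lambda>t. U t \<omega>)"
  using bridge by (simp add: standard_brownian_bridge_def)

lemma measurable_U: "t \<in> {0..1} \<Longrightarrow> U t \<in> borel_measurable M"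
proof -
  assume t: "t \<in> {0..1}"
  have "gaussian_process M {0..1} U" using bridge by (simp add: standard_brownian_bridge_def)
  from gaussian_processD[OF this, of "{t}" "\<lambda>_. 1"] have "gaussian_rv M (U t)" using t by simp
  then show ?thesis by (simp add: gaussian_rv_def)
qed

lemma dyadic_time: "s \<in> dyadic_grid i \<Longrightarrow> s / (1 + s) \<in> {0..1}"
  using dyadic_grid_nonneg[of s i] by (auto simp: field_simps)

text \<open>A countable intersection of finite-dimensional events: the source of measurability of
  the extrema, and of the passage from grid probabilities to path probabilities.\<close>

lemma path_event_eq:
  assumes "closed S"
  shows "{\<omega>\<in>space M. \<forall>t\<in>{0..1}. U t \<omega> \<in> S} = (\<Inter>i. {\<omega>\<in>space M. \<forall>s\<in>dyadic_grid i. U (s / (1 + s)) \<omega> \<in> S})"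
proof (intro set_eqI iffI)
  fix \<omega> assume "\<omega> \<in> {\<omega>\<in>space M. \<forall>t\<in>{0..1}. U t \<omega> \<in> S}"
  then show "\<omega> \<in> (\<Inter>i. {\<omega>\<in>space M. \<forall>s\<in>dyadic_grid i. U (s / (1 + s)) \<omega> \<in> S})"
    using dyadic_time by blast
next
  fix \<omega> assume "\<omega> \<in> (\<Inter>i. {\<omega>\<in>space M. \<forall>s\<in>dyadic_grid i. U (s / (1 + s)) \<omega> \<in> S})"
  then have \<omega>: "\<omega> \<in> space M" "\<And>i s. s \<in> dyadic_grid i \<Longrightarrow> U (s / (1 + s)) \<omega> \<in> S" by blast+
  show "\<omega> \<in> {\<omega>\<in>space M. \<forall>t\<in>{0..1}. U t \<omega> \<in> S}"
  proof (intro CollectI conjI ballI \<omega>(1))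
    fix t :: real assume "t \<in> {0..1}"
    then show "U t \<omega> \<in> S"
      by (rule closed_path_dyadic[OF continuous_path[OF \<omega>(1)] assms, rotated]) (rule \<omega>(2))
  qed
qed

lemma path_event_sets: "closed S \<Longrightarrow> {\<omega>\<in>space M. \<forall>t\<in>{0..1}. U t \<omega> \<in> S} \<in> sets M"
proof (subst path_event_eq, assumption)
  assume S: "closed S"
  have "{\<omega>\<in>space M. U (s / (1 + s)) \<omega> \<in> S} \<in> sets M" if "s \<in> dyadic_grid i" for s i
    using measurable_sets[OF measurable_U[OF dyadic_time[OF that]], of S] S by (simp add: vimage_def Int_def conj_commute)
  then show "(\<Inter>i. {\<omega>\<in>space M. \<forall>s\<in>dyadic_grid i. U (s / (1 + s)) \<omega> \<in> S}) \<in> sets M"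
    by (intro sets.countable_INT' sets.sets_Collect_finite_All) (auto simp: finite_dyadic_grid)
qed

lemma bounded_path: "\<omega> \<in> space M \<Longrightarrow> bdd_above ((\<lambda>t. U t \<omega>) ` {0..1}) \<and> bdd_below ((\<lambda>t. U t \<omega>) ` {0..1})"
  using compact_imp_bounded[OF compact_continuous_image[OF continuous_path compact_Icc]]
  by (auto intro: bounded_imp_bdd_above bounded_imp_bdd_below)

lemma Mplus_le_iff: "\<omega> \<in> space M \<Longrightarrow> Mplus U \<omega> \<le> b \<longleftrightarrow> (\<forall>t\<in>{0..1}. U t \<omega> \<le> b)"
  unfolding Mplus_def using bounded_path by (subst cSUP_le_iff) auto

lemma Mminus_le_iff: "\<omega> \<in> space M \<Longrightarrow> Mminus U \<omega> \<le> a \<longleftrightarrow> (\<forall>t\<in>{0..1}. - a \<le> U t \<omega>)"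
  unfolding Mminus_def using bounded_path le_cINF_iff[of "{0..1}" "\<lambda>t. U t \<omega>" "- a"] by auto

lemma range_event_eq:
  "{\<omega>\<in>space M. Mminus U \<omega> \<le> a \<and> Mplus U \<omega> \<le> b} = {\<omega>\<in>space M. \<forall>t\<in>{0..1}. U t \<omega> \<in> {- a..b}}"
  by (auto simp: Mplus_le_iff Mminus_le_iff)

lemma measurable_Mplus [measurable]: "Mplus U \<in> borel_measurable M"
  unfolding borel_measurable_iff_le
proof
  fix c
  have "{\<omega>\<in>space M. Mplus U \<omega> \<le> c} = {\<omega>\<in>space M. \<forall>t\<in>{0..1}. U t \<omega> \<in> {..c}}" by (auto simp: Mplus_le_iff)
  then show "{\<omega>\<in>space M. Mplus U \<omega> \<le> c} \<in> sets M" using path_event_sets[of "{..c}"] by simp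
qed

lemma measurable_Mminus [measurable]: "Mminus U \<in> borel_measurable M"
  unfolding borel_measurable_iff_le
proof
  fix c
  have "{\<omega>\<in>space M. Mminus U \<omega> \<le> c} = {\<omega>\<in>space M. \<forall>t\<in>{0..1}. U t \<omega> \<in> {- c..}}" by (auto simp: Mminus_le_iff)
  then show "{\<omega>\<in>space M. Mminus U \<omega> \<le> c} \<in> sets M" using path_event_sets[of "{- c..}"] by simp
qed

theorem joint_law:
  assumes ab: "a > 0" "b > 0"
  shows "(\<lambda>n. kterm n a b) sums prob {\<omega>\<in>space M. Mminus U \<omega> \<le> a \<and> Mplus U \<omega> \<le> b}"
proof -
  let ?E = "\<lambda>i. {\<omega>\<in>space M. \<forall>s\<in>dyadic_grid i. U (s / (1 + s)) \<omega> \<in> {- a..b}}"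
  have strip: "(1 + s) * x \<in> strip a b s \<longleftrightarrow> x \<in> {- a..b}" if "0 \<le> s" for s x
  proof -
    have "0 < 1 + s" using that by simp
    from mult_le_cancel_left_pos[OF this, of "- a" x] mult_le_cancel_left_pos[OF this, of x b]
    show ?thesis unfolding strip_def by (simp only: atLeastAtMost_iff mult.commute[of "1 + s"] mult_minus_left)
  qed
  have meas: "?E i \<in> sets M" for i
  proof (intro sets.sets_Collect_finite_All finite_dyadic_grid)
    fix s assume "s \<in> dyadic_grid i"
    note [measurable] = measurable_U[OF dyadic_time[OF this]]
    show "{\<omega>\<in>space M. U (s / (1 + s)) \<omega> \<in> {- a..b}} \<in> sets M" by measurable
  qed
  have "expectation (W.inside a b (dyadic_grid i)) = expectation (indicator (?E i))" for i
    by (intro Bochner_Integration.integral_cong)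
      (auto simp: W.inside_eq finite_dyadic_grid indicator_def strip dyadic_grid_nonneg)
  then have eq: "expectation (W.inside a b (dyadic_grid i)) = prob (?E i)" for i
    using meas by simp
  have "decseq ?E"
    using dyadic_grid_mono by (intro decseq_SucI) blast
  then have "(\<lambda>i. prob (?E i)) \<longlonglongrightarrow> prob (\<Inter>i. ?E i)"
    using meas by (intro finite_Lim_measure_decseq) auto
  then have "(\<lambda>i. expectation (W.inside a b (grid (1 / 2 ^ i) (i * 2 ^ i)))) \<longlonglongrightarrow> prob {\<omega>\<in>space M. Mminus U \<omega> \<le> a \<and> Mplus U \<omega> \<le> b}"
    unfolding eq[symmetric] range_event_eq path_event_eq[OF closed_atLeastAtMost] by (simp add: dyadic_grid_def)
  from W.image_mart_tendsto[OF ab this]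
  have "(\<lambda>K. image_mart a b K 0 0) \<longlonglongrightarrow> prob {\<omega>\<in>space M. Mminus U \<omega> \<le> a \<and> Mplus U \<omega> \<le> b}" .
  moreover have "(\<lambda>K. kol (real K * (a + b))) \<longlonglongrightarrow> 0"
  proof -
    have "0 < k \<Longrightarrow> (\<lambda>i. exp (- 2 * (real i * k)\<^sup>2)) \<longlonglongrightarrow> 0" for k :: real by real_asymp
    then show ?thesis using ab by (simp add: kol_def)
  qed
  ultimately show ?thesis
    unfolding sums_def sum_kterm by (auto dest: tendsto_diff)
qed

end

subsection \<open>Probabilities below a curve\<close>

definition dkol :: "real \<Rightarrow> real" where
  "dkol c = - 4 * c * kol c"

lemma DERIV_kol: "(kol has_real_derivative dkol c) (at c within S)"
  unfolding kol_def dkol_def by (auto intro!: derivative_eq_intros)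

lemmas DERIV_kol' [derivative_intros] = DERIV_chain2[OF DERIV_kol]

lemma continuous_on_kol [continuous_intros]: "continuous_on S f \<Longrightarrow> continuous_on S (\<lambda>x. kol (f x))"
  unfolding kol_def by (intro continuous_intros)

lemma continuous_on_dkol [continuous_intros]: "continuous_on S f \<Longrightarrow> continuous_on S (\<lambda>x. dkol (f x))"
  unfolding dkol_def by (intro continuous_intros)

lemma kol_0 [simp]: "kol 0 = 1" by (simp add: kol_def)

lemma kol_pos: "0 < kol c" and kol_le_1: "kol c \<le> 1"
  by (simp_all add: kol_def)

lemma kol_antimono: "0 \<le> u \<Longrightarrow> u \<le> v \<Longrightarrow> kol v \<le> kol u"
  by (simp add: kol_def)

lemma exp_ge_poly: "1 + y + y\<^sup>2 / 2 + y ^ 3 / 6 \<le> exp y" if "0 \<le> y" for y :: real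
proof -
  have "(\<Sum>n<4. y ^ n /\<^sub>R fact n) \<le> exp y"
    unfolding exp_def using that by (intro sum_le_suminf summable_exp_generic) auto
  moreover have "{..<4} = {0, 1, 2, 3::nat}" by auto
  ultimately show ?thesis by (simp add: fact_numeral)
qed

text \<open>Cubic Taylor bound of \<open>exp\<close> at \<open>2 v^2\<close>. Dropping summands
  yields all later bounds on powers of \<open>v\<close> times \<open>kol v\<close>.\<close>

lemma kol_poly_le: "kol v * (1 + 2 * v\<^sup>2 + 2 * v ^ 4 + 4 / 3 * v ^ 6) \<le> 1"
proof -
  have "1 + 2 * v\<^sup>2 + 2 * v ^ 4 + 4 / 3 * v ^ 6 \<le> exp (2 * v\<^sup>2)"
    using exp_ge_poly[of "2 * v\<^sup>2"] by (simp add: power_mult_distrib power_mult[symmetric])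
  then have "kol v * (1 + 2 * v\<^sup>2 + 2 * v ^ 4 + 4 / 3 * v ^ 6) \<le> kol v * exp (2 * v\<^sup>2)"
    using kol_pos[of v] by (intro mult_left_mono) auto
  also have "\<dots> = 1" by (simp add: kol_def exp_add[symmetric])
  finally show ?thesis .
qed

lemma abs_dkol_le_2: "\<bar>dkol v\<bar> \<le> 2"
proof -
  have "0 \<le> (\<bar>v\<bar> - 1)\<^sup>2" by simp
  then have "4 * \<bar>v\<bar> \<le> 2 + 2 * v\<^sup>2" by (simp add: power2_eq_square algebra_simps)
  also have "\<dots> \<le> 2 * (1 + 2 * v\<^sup>2)" by simp
  also have "\<dots> \<le> 2 * (1 + 2 * v\<^sup>2 + 2 * v ^ 4 + 4 / 3 * v ^ 6)" by simp
  finally have "\<bar>dkol v\<bar> \<le> 2 * (kol v * (1 + 2 * v\<^sup>2 + 2 * v ^ 4 + 4 / 3 * v ^ 6))"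
    using kol_pos[of v] by (simp add: dkol_def abs_mult mult.commute mult_left_mono mult.left_commute)
  also have "\<dots> \<le> 2 * 1" using kol_poly_le[of v] by (intro mult_left_mono) auto
  finally show ?thesis by simp
qed

lemma abs_dkol_le:
  assumes "0 < u" "u \<le> v" shows "\<bar>dkol v\<bar> \<le> 3 / u ^ 5"
proof -
  have v: "0 < v" using assms by simp
  have nn: "0 \<le> kol v * (1 + 2 * v\<^sup>2 + 2 * v ^ 4)" using kol_pos[of v] by (intro mult_nonneg_nonneg) auto
  have "\<bar>dkol v\<bar> * v ^ 5 = 4 * (kol v * v ^ 6)" using v kol_pos[of v] by (simp add: dkol_def abs_mult power_eq_if)
  also have "\<dots> \<le> 3"
    using kol_poly_le[of v] nn by (simp add: distrib_left)
  finally have "\<bar>dkol v\<bar> \<le> 3 / v ^ 5" using v by (simp add: field_simps)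
  also have "\<dots> \<le> 3 / u ^ 5" using assms by (intro divide_left_mono power_mono) auto
  finally show ?thesis .
qed

lemma summable_inverse_square: "summable (\<lambda>n. C / (real n + 1)\<^sup>2)"
proof -
  have "summable (\<lambda>n. inverse (real (Suc n) ^ 2))"
    using inverse_power_summable[of 2, where 'a=real] by (subst summable_Suc_iff) simp
  then have "summable (\<lambda>n. C * inverse (real (Suc n) ^ 2))" by (rule summable_mult)
  then show ?thesis by (simp add: divide_inverse add.commute)
qed

lemma inverse_square_shift: "n \<ge> 1 \<Longrightarrow> 1 / (real n)\<^sup>2 \<le> 4 / (real n + 1)\<^sup>2"
proof -
  assume "n \<ge> 1"
  then have "(real n + 1)\<^sup>2 \<le> (2 * real n)\<^sup>2" by (intro power_mono) auto
  then show ?thesis using \<open>n \<ge> 1\<close> by (simp add: power_mult_distrib field_simps)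
qed

definition kder :: "nat \<Rightarrow> real \<Rightarrow> real \<Rightarrow> real" where
  "kder n a b = real n * dkol (real n * (a + b)) + (real n + 1) * dkol ((real n + 1) * (a + b))
     - (real n + 1) * dkol ((real n + 1) * a + real n * b) - real n * dkol (real n * a + (real n + 1) * b)"

lemma DERIV_kterm: "((\<lambda>a. kterm n a b) has_real_derivative kder n a b) (at a within S)"
  unfolding kterm_def kder_def by (auto intro!: derivative_eq_intros simp: algebra_simps)

text \<open>For \<open>n \<ge> 1\<close> all four arguments are at least \<open>n l\<close>, so only
  \<open>a + b\<close> has to stay away from 0. One coordinate may vanish, which admits closed
  segments and half-lines touching the axes.\<close>

lemma kder_bound:
  assumes l: "0 < l" and ab: "0 \<le> a" "0 \<le> b" "l \<le> a + b"
  shows "\<bar>kder n a b\<bar> \<le> (4 + 96 / l ^ 5) / (real n + 1)\<^sup>2"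
proof (cases "n = 0")
  case True
  then have "\<bar>kder n a b\<bar> \<le> 4" using abs_dkol_le_2[of "a + b"] abs_dkol_le_2[of a] by (simp add: kder_def)
  also have "\<dots> \<le> 4 + 96 / l ^ 5" using l by simp
  finally show ?thesis using True by simp
next
  case False
  then have n: "n \<ge> 1" by simp
  let ?u = "real n * l"
  define R where "R = 3 / (real n * l) ^ 5"
  have u: "0 < ?u" using n l by simp
  have nl: "?u \<le> real n * (a + b)" using ab by (intro mult_left_mono) auto
  have args: "?u \<le> (real n + 1) * (a + b)" "?u \<le> (real n + 1) * a + real n * b" "?u \<le> real n * a + (real n + 1) * b"
    using nl ab by (simp_all add: algebra_simps)
  have R: "0 \<le> R" using n l by (simp add: R_def)
  have "\<bar>real n * dkol (real n * (a + b))\<bar> \<le> (real n + 1) * R" "\<bar>(real n + 1) * dkol ((real n + 1) * (a + b))\<bar> \<le> (real n + 1) * R"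
    "\<bar>(real n + 1) * dkol ((real n + 1) * a + real n * b)\<bar> \<le> (real n + 1) * R" "\<bar>real n * dkol (real n * a + (real n + 1) * b)\<bar> \<le> (real n + 1) * R"
    using abs_dkol_le[OF u nl] abs_dkol_le[OF u args(1)] abs_dkol_le[OF u args(2)] abs_dkol_le[OF u args(3)] R
    unfolding abs_mult R_def[symmetric] by (auto intro!: mult_mono)
  then have "\<bar>kder n a b\<bar> \<le> 4 * ((real n + 1) * R)" unfolding kder_def by linarith
  also have "\<dots> \<le> 4 * ((2 * real n) * R)" using n R by (intro mult_left_mono mult_right_mono) auto
  also have "\<dots> = 24 / l ^ 5 * (1 / real n ^ 4)" using n by (simp add: R_def field_simps power_eq_if)
  also have "\<dots> \<le> 24 / l ^ 5 * (1 / (real n)\<^sup>2)"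
    using n l by (intro mult_left_mono divide_left_mono power_increasing) auto
  also have "\<dots> \<le> 24 / l ^ 5 * (4 / (real n + 1)\<^sup>2)"
    using inverse_square_shift[OF n] l by (intro mult_left_mono) auto
  also have "\<dots> = (96 / l ^ 5) / (real n + 1)\<^sup>2" by simp
  also have "\<dots> \<le> (4 + 96 / l ^ 5) / (real n + 1)\<^sup>2" by (intro divide_right_mono) auto
  finally show ?thesis .
qed

lemma kder_uniform:
  assumes "0 < l" and S: "\<And>x. x \<in> S \<Longrightarrow> 0 \<le> f x \<and> 0 \<le> h x \<and> l \<le> f x + h x"
  shows "uniform_limit S (\<lambda>N x. \<Sum>n<N. kder n (f x) (h x)) (\<lambda>x. \<Sum>n. kder n (f x) (h x)) sequentially"
proof (rule Weierstrass_m_test)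
  show "norm (kder n (f x) (h x)) \<le> (4 + 96 / l ^ 5) / (real n + 1)\<^sup>2" if "x \<in> S" for n x
    using kder_bound[OF assms(1)] S[OF that] by simp
qed (rule summable_inverse_square)

definition range_cdf :: "real \<Rightarrow> real \<Rightarrow> real" where
  "range_cdf a b = (\<Sum>n. kterm n a b)"

definition range_cdf_deriv :: "real \<Rightarrow> real \<Rightarrow> real" where
  "range_cdf_deriv a b = (\<Sum>n. kder n a b)"

lemma range_cdf_at_0: "kterm n 0 b = 0"
  by (simp add: kterm_def)

text \<open>The end point \<open>a = 0\<close> is included so that continuity there can show that
  \<open>Mminus\<close> is almost surely positive.\<close>

lemma DERIV_range_cdf_within:
  assumes "0 < b" "0 \<le> a"
  shows "((\<lambda>a. range_cdf a b) has_real_derivative range_cdf_deriv a b) (at a within {0..})"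
proof -
  have "\<exists>G. \<forall>x\<in>{0..}. (\<lambda>n. kterm n x b) sums G x \<and> (G has_real_derivative range_cdf_deriv x b) (at x within {0..})"
  proof (rule has_field_derivative_series[where ?x0.0=0])
    show "uniform_limit {0..} (\<lambda>n x. \<Sum>i<n. kder i x b) (\<lambda>x. range_cdf_deriv x b) sequentially"
      unfolding range_cdf_deriv_def using assms by (intro kder_uniform[of b]) auto
    show "((\<lambda>a. kterm n a b) has_real_derivative kder n x b) (at x within {0..})" for n x
      by (rule DERIV_kterm)
  qed (auto simp: range_cdf_at_0 intro: exI[of _ 0])
  then obtain G where G: "\<And>x. 0 \<le> x \<Longrightarrow> (\<lambda>n. kterm n x b) sums G x"
    "\<And>x. 0 \<le> x \<Longrightarrow> (G has_real_derivative range_cdf_deriv x b) (at x within {0..})" by auto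
  have "range_cdf x b = G x" if "0 \<le> x" for x using G(1)[OF that] by (simp add: range_cdf_def sums_iff)
  then show ?thesis
    using G(2)[OF assms(2)] assms by (intro has_field_derivative_transform_within[OF G(2)[OF assms(2)] zero_less_one]) auto
qed

lemma DERIV_range_cdf:
  assumes "0 < b" "0 < a"
  shows "((\<lambda>a. range_cdf a b) has_real_derivative range_cdf_deriv a b) (at a)"
proof -
  have "a \<in> interior {0..}" using assms by simp
  then show ?thesis using DERIV_range_cdf_within[of b a] assms by (simp only: at_within_interior)
qed

lemma continuous_range_cdf_deriv:
  "continuous_on ({0<..} \<times> {0<..}) (\<lambda>p. range_cdf_deriv (fst p) (snd p))"
proof (subst continuous_on_eq_continuous_at, simp add: open_Times, intro ballI)
  fix p :: "real \<times> real" assume "p \<in> {0<..} \<times> {0<..}"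
  then have p: "0 < fst p" "0 < snd p" by auto
  let ?S = "{fst p / 2<..} \<times> {0<..} :: (real \<times> real) set"
  have "continuous_on ?S (\<lambda>p. range_cdf_deriv (fst p) (snd p))"
    unfolding range_cdf_deriv_def
  proof (rule uniform_limit_theorem)
    show "uniform_limit ?S (\<lambda>N x. \<Sum>n<N. kder n (fst x) (snd x)) (\<lambda>x. \<Sum>n. kder n (fst x) (snd x)) sequentially"
      using p by (intro kder_uniform[of "fst p / 2"]) auto
    show "\<forall>\<^sub>F N in sequentially. continuous_on ?S (\<lambda>x. \<Sum>n<N. kder n (fst x) (snd x))"
      unfolding kder_def by (intro always_eventually allI continuous_intros)
  qed simp
  moreover have S: "open ?S" and "p \<in> ?S" using p by (auto simp: open_Times mem_Times_iff)
  ultimately show "isCont (\<lambda>p. range_cdf_deriv (fst p) (snd p)) p"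
    by (simp only: continuous_on_eq_continuous_at[OF S])
qed

text \<open>The sandwich hypothesis covers increasing and decreasing curves, and for increasing ones also the
  strict inequality \<open>B < \<phi> A\<close>.\<close>

lemma (in prob_space) prob_below_curve:
  fixes A B :: "'a \<Rightarrow> real"
  assumes [measurable]: "A \<in> borel_measurable M" "B \<in> borel_measurable M" "Measurable.pred M Pr"
    and cdf: "\<And>a b. 0 < a \<Longrightarrow> 0 < b \<Longrightarrow> prob {\<omega>\<in>space M. A \<omega> \<le> a \<and> B \<omega> \<le> b} = G a b"
    and G: "\<And>a b. 0 < a \<Longrightarrow> 0 < b \<Longrightarrow> ((\<lambda>a. G a b) has_real_derivative g a b) (at a)"
    and g: "continuous_on ({0<..} \<times> {0<..}) (\<lambda>p. g (fst p) (snd p))"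
    and J: "open J" "is_interval J" "J \<subseteq> {0<..}" and \<phi>: "continuous_on J \<phi>" "\<And>a. a \<in> J \<Longrightarrow> 0 < \<phi> a"
    and sandwich: "\<And>p q. p \<in> J \<Longrightarrow> q \<in> J \<Longrightarrow> p < q \<Longrightarrow> \<exists>u\<in>{\<phi> p, \<phi> q}. \<exists>v\<in>{\<phi> p, \<phi> q}.
        \<forall>\<omega>\<in>space M. p < A \<omega> \<longrightarrow> A \<omega> \<le> q \<longrightarrow> (B \<omega> \<le> u \<longrightarrow> Pr \<omega>) \<and> (Pr \<omega> \<longrightarrow> B \<omega> \<le> v)"
    and H: "\<And>a. a \<in> J \<Longrightarrow> (H has_real_derivative g a (\<phi> a)) (at a)"
    and \<alpha>\<beta>: "\<alpha> \<in> J" "\<beta> \<in> J" "\<alpha> < \<beta>"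
  shows "prob {\<omega>\<in>space M. \<alpha> < A \<omega> \<and> A \<omega> \<le> \<beta> \<and> Pr \<omega>} = H \<beta> - H \<alpha>"
proof -
  have Jc: "x \<in> J" if "p \<in> J" "q \<in> J" "p \<le> x" "x \<le> q" for p q x :: real
    by (rule mem_is_interval_1_I[OF J(2) that])
  obtain e where e: "e > 0" "ball \<alpha> e \<subseteq> J" using open_contains_ball[of J] J(1) \<alpha>\<beta>(1) by blast
  \<comment> \<open>Counting starts slightly to the left of \<open>\<alpha>\<close>, which makes
    \<open>D\<close> differentiable from both sides at \<open>\<alpha>\<close> itself.\<close>
  define \<alpha>0 where "\<alpha>0 = \<alpha> - e / 2"
  have \<alpha>0: "\<alpha>0 \<in> J" "\<alpha>0 < \<alpha>" using e by (auto simp: \<alpha>0_def dist_real_def subset_iff)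
  define D where "D x = prob {\<omega>\<in>space M. \<alpha>0 < A \<omega> \<and> A \<omega> \<le> x \<and> Pr \<omega>}" for x
  have Ddiff: "prob {\<omega>\<in>space M. p < A \<omega> \<and> A \<omega> \<le> q \<and> Pr \<omega>} = D q - D p" if "\<alpha>0 \<le> p" "p \<le> q" for p q
  proof -
    have "prob ({\<omega>\<in>space M. \<alpha>0 < A \<omega> \<and> A \<omega> \<le> q \<and> Pr \<omega>} - {\<omega>\<in>space M. \<alpha>0 < A \<omega> \<and> A \<omega> \<le> p \<and> Pr \<omega>}) = D q - D p"
      unfolding D_def using that by (intro finite_measure_Diff) auto
    moreover have "{\<omega>\<in>space M. \<alpha>0 < A \<omega> \<and> A \<omega> \<le> q \<and> Pr \<omega>} - {\<omega>\<in>space M. \<alpha>0 < A \<omega> \<and> A \<omega> \<le> p \<and> Pr \<omega>} = {\<omega>\<in>space M. p < A \<omega> \<and> A \<omega> \<le> q \<and> Pr \<omega>}"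
      using that by auto
    ultimately show ?thesis by simp
  qed
  \<comment> \<open>At a fixed height \<open>u\<close> the mass of a vertical strip is a difference
    of the joint distribution function, to which the mean value theorem applies.\<close>
  have slope: "\<exists>\<zeta>. p < \<zeta> \<and> \<zeta> < q \<and> prob {\<omega>\<in>space M. p < A \<omega> \<and> A \<omega> \<le> q \<and> B \<omega> \<le> u} = (q - p) * g \<zeta> u"
    if "p \<in> J" "q \<in> J" "p < q" "0 < u" for p q u
  proof -
    have p: "0 < p" using that J(3) by auto
    have "prob ({\<omega>\<in>space M. A \<omega> \<le> q \<and> B \<omega> \<le> u} - {\<omega>\<in>space M. A \<omega> \<le> p \<and> B \<omega> \<le> u}) = G q u - G p u"
      using that p by (subst finite_measure_Diff) (auto simp: cdf)
    moreover have "{\<omega>\<in>space M. A \<omega> \<le> q \<and> B \<omega> \<le> u} - {\<omega>\<in>space M. A \<omega> \<le> p \<and> B \<omega> \<le> u} = {\<omega>\<in>space M. p < A \<omega> \<and> A \<omega> \<le> q \<and> B \<omega> \<le> u}"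
      using that by auto
    moreover have "\<exists>\<zeta>>p. \<zeta> < q \<and> G q u - G p u = (q - p) * g \<zeta> u"
      using that(3,4) p by (intro MVT2 G) auto
    ultimately show ?thesis by auto
  qed
  have DD: "(D has_real_derivative g x (\<phi> x)) (at x)" if x: "x \<in> J" "\<alpha>0 < x" for x
    unfolding has_field_derivative_iff tendsto_iff
  proof (intro allI impI)
    fix \<epsilon> :: real assume \<epsilon>: "\<epsilon> > 0"
    have x0: "0 < x" "0 < \<phi> x" using x J(3) \<phi>(2) by auto
    have "isCont (\<lambda>p. g (fst p) (snd p)) (x, \<phi> x)"
      using g x0 by (subst (asm) continuous_on_eq_continuous_at) (auto simp: open_Times)
    then obtain d1 where d1: "d1 > 0" "\<And>p. dist p (x, \<phi> x) < d1 \<Longrightarrow> dist (g (fst p) (snd p)) (g x (\<phi> x)) < \<epsilon>"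
      using \<epsilon> by (auto simp: continuous_at_eps_delta)
    have "isCont \<phi> x" using \<phi>(1) J(1) x by (simp add: continuous_on_eq_continuous_at)
    then obtain d2 where d2: "d2 > 0" "\<And>y. dist y x < d2 \<Longrightarrow> dist (\<phi> y) (\<phi> x) < d1 / 2"
      using d1(1) unfolding continuous_at_eps_delta by (meson half_gt_zero)
    obtain d3 where d3: "d3 > 0" "ball x d3 \<subseteq> J" using J(1) x by (auto simp: open_contains_ball)
    define d where "d = min (min (d1 / 2) d2) (min d3 (x - \<alpha>0))"
    have d: "d > 0" using d1 d2 d3 x by (simp add: d_def)
    have close: "dist (g a b) (g x (\<phi> x)) < \<epsilon>" if "dist a x < d1 / 2" "dist b (\<phi> x) < d1 / 2" for a b
    proof -
      have "dist (a, b) (x, \<phi> x) \<le> dist a x + dist b (\<phi> x)" by (simp add: dist_Pair_Pair sqrt_sum_squares_le_sum)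
      then have "dist (a, b) (x, \<phi> x) < d1" using that by simp
      from d1(2)[OF this] show ?thesis by simp
    qed
    \<comment> \<open>Over \<open>(p, q]\<close> the event lies between two strips of constant
      heights, both values of \<open>\<phi>\<close> at end points. Their slopes are values of
      \<open>g\<close> near \<open>(x, \<phi> x)\<close>, so continuity of \<open>g\<close> squeezes
      the quotient.\<close>
    have main: "dist ((D q - D p) / (q - p)) (g x (\<phi> x)) < \<epsilon>" if pq: "p < q" "dist p x < d" "dist q x < d" "p \<le> x" "x \<le> q" for p q
    proof -
      have pJ: "p \<in> J" "q \<in> J" using pq d3(2) by (auto simp: d_def dist_commute subset_iff)
      have "\<alpha>0 \<le> p" using pq by (auto simp: d_def dist_real_def)
      obtain u v where uv: "u \<in> {\<phi> p, \<phi> q}" "v \<in> {\<phi> p, \<phi> q}"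
        "\<And>\<omega>. \<omega> \<in> space M \<Longrightarrow> p < A \<omega> \<Longrightarrow> A \<omega> \<le> q \<Longrightarrow> (B \<omega> \<le> u \<longrightarrow> Pr \<omega>) \<and> (Pr \<omega> \<longrightarrow> B \<omega> \<le> v)"
        using sandwich[OF pJ pq(1)] by meson
      have uv0: "0 < u" "0 < v" using uv(1,2) \<phi>(2) pJ by auto
      have uvd: "dist u (\<phi> x) < d1 / 2" "dist v (\<phi> x) < d1 / 2" using uv(1,2) d2(2) pq by (auto simp: d_def)
      obtain \<zeta> where \<zeta>: "p < \<zeta>" "\<zeta> < q" "prob {\<omega>\<in>space M. p < A \<omega> \<and> A \<omega> \<le> q \<and> B \<omega> \<le> u} = (q - p) * g \<zeta> u"
        using slope[OF pJ pq(1) uv0(1)] by auto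
      obtain \<eta> where \<eta>: "p < \<eta>" "\<eta> < q" "prob {\<omega>\<in>space M. p < A \<omega> \<and> A \<omega> \<le> q \<and> B \<omega> \<le> v} = (q - p) * g \<eta> v"
        using slope[OF pJ pq(1) uv0(2)] by auto
      have "dist \<zeta> x < d1 / 2" "dist \<eta> x < d1 / 2" using \<zeta>(1,2) \<eta>(1,2) pq by (auto simp: d_def dist_real_def abs_if)
      then have c: "dist (g \<zeta> u) (g x (\<phi> x)) < \<epsilon>" "dist (g \<eta> v) (g x (\<phi> x)) < \<epsilon>" using close uvd by auto
      have "(q - p) * g \<zeta> u \<le> D q - D p"
        unfolding \<zeta>(3)[symmetric] Ddiff[OF \<open>\<alpha>0 \<le> p\<close> less_imp_le[OF pq(1)], symmetric] using uv(3) by (intro finite_measure_mono) auto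
      moreover have "D q - D p \<le> (q - p) * g \<eta> v"
        unfolding \<eta>(3)[symmetric] Ddiff[OF \<open>\<alpha>0 \<le> p\<close> less_imp_le[OF pq(1)], symmetric] using uv(3) by (intro finite_measure_mono) auto
      ultimately have "g \<zeta> u \<le> (D q - D p) / (q - p)" "(D q - D p) / (q - p) \<le> g \<eta> v"
        using pq(1) by (simp_all add: pos_le_divide_eq pos_divide_le_eq mult.commute)
      then show ?thesis using c unfolding dist_real_def abs_less_iff by linarith
    qed
    have "dist ((D y - D x) / (y - x)) (g x (\<phi> x)) < \<epsilon>" if "y \<noteq> x" "dist y x < d" for y
    proof (cases "x < y")
      case True then show ?thesis using main[of x y] that d by simp
    next
      case False
      then have "dist ((D x - D y) / (x - y)) (g x (\<phi> x)) < \<epsilon>" using main[of y x] that d by simp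
      moreover have "(D x - D y) / (x - y) = (D y - D x) / (y - x)" by (metis minus_diff_eq minus_divide_divide)
      ultimately show ?thesis by simp
    qed
    then show "\<forall>\<^sub>F y in at x. dist ((D y - D x) / (y - x)) (g x (\<phi> x)) < \<epsilon>"
      unfolding eventually_at using d by auto
  qed
  have "\<exists>c. \<forall>x\<in>{\<alpha>..\<beta>}. D x - H x = c"
  proof (rule has_field_derivative_zero_constant)
    fix x assume "x \<in> {\<alpha>..\<beta>}"
    then have x: "x \<in> J" "\<alpha>0 < x" using Jc[OF \<alpha>\<beta>(1,2)] \<alpha>0 by auto
    show "((\<lambda>x. D x - H x) has_real_derivative 0) (at x within {\<alpha>..\<beta>})"
      using DERIV_diff[OF DD[OF x] H[OF x(1)]] by (simp add: has_field_derivative_at_within)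
  qed simp
  then obtain c where c: "\<forall>x\<in>{\<alpha>..\<beta>}. D x - H x = c" by (rule exE)
  have "D \<alpha> - H \<alpha> = c" "D \<beta> - H \<beta> = c" using \<alpha>\<beta>(3) by (auto intro: bspec[OF c])
  then have "D \<beta> - D \<alpha> = H \<beta> - H \<alpha>" by linarith
  then show ?thesis using Ddiff[of \<alpha> \<beta>] \<alpha>0 \<alpha>\<beta>(3) by simp
qed

text \<open>Uniform convergence of the derivatives, together with convergence at one base point
  \<open>x0\<close>, gives a primitive on all of \<open>S\<close>.\<close>

lemma curve_antiderivative:
  assumes S: "convex S" and l: "0 < l" and curve: "\<And>x. x \<in> S \<Longrightarrow> 0 \<le> x \<and> 0 \<le> \<phi> x \<and> l \<le> x + \<phi> x"
    and h: "\<And>n x. x \<in> S \<Longrightarrow> (h n has_real_derivative kder n x (\<phi> x)) (at x within S)"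
    and x0: "x0 \<in> S" "summable (\<lambda>n. h n x0)" and x: "x \<in> S"
  shows "summable (\<lambda>n. h n x)"
    and "((\<lambda>x. \<Sum>n. h n x) has_real_derivative range_cdf_deriv x (\<phi> x)) (at x within S)"
proof -
  have "\<exists>G. \<forall>x\<in>S. (\<lambda>n. h n x) sums G x \<and> (G has_real_derivative range_cdf_deriv x (\<phi> x)) (at x within S)"
  proof (rule has_field_derivative_series[OF S h _ x0])
    show "uniform_limit S (\<lambda>n x. \<Sum>i<n. kder i x (\<phi> x)) (\<lambda>x. range_cdf_deriv x (\<phi> x)) sequentially"
      unfolding range_cdf_deriv_def using curve by (intro kder_uniform[OF l]) auto
  qed
  then obtain G where G: "\<And>x. x \<in> S \<Longrightarrow> (\<lambda>n. h n x) sums G x"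
    "\<And>x. x \<in> S \<Longrightarrow> (G has_real_derivative range_cdf_deriv x (\<phi> x)) (at x within S)" by auto
  show "summable (\<lambda>n. h n x)" using G(1)[OF x] by (rule sums_summable)
  have "(\<Sum>n. h n y) = G y" if "y \<in> S" for y using G(1)[OF that] by (simp add: sums_iff)
  then show "((\<lambda>x. \<Sum>n. h n x) has_real_derivative range_cdf_deriv x (\<phi> x)) (at x within S)"
    using x by (intro has_field_derivative_transform_within[OF G(2)[OF x] zero_less_one]) auto
qed

lemma kol_square_bound:
  assumes "0 < x"
  shows "(real n + 1)\<^sup>2 * kol (real n * x) \<le> (1 + 16 / x ^ 6) / (real n + 1)\<^sup>2"
proof (cases "n = 0")
  case False
  then have n: "n \<ge> 1" by simp
  let ?v = "real n * x"
  have k0: "0 \<le> kol ?v" using kol_pos[of ?v] by simp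
  have "0 \<le> kol ?v * (1 + 2 * ?v\<^sup>2 + 2 * ?v ^ 4 + 1 / 3 * ?v ^ 6)" using k0 by (intro mult_nonneg_nonneg) auto
  then have "kol ?v * ?v ^ 6 \<le> 1" using kol_poly_le[of ?v] by (simp add: distrib_left)
  then have k6: "(kol ?v * real n ^ 6) * x ^ 6 \<le> 1" by (simp add: power_mult_distrib mult.assoc)
  have "real n ^ 4 \<le> real n ^ 6" using n by (intro power_increasing) auto
  then have "kol ?v * real n ^ 4 \<le> kol ?v * real n ^ 6" using k0 by (rule mult_left_mono)
  also have "\<dots> \<le> 1 / x ^ 6" using k6 zero_less_power[OF assms, of 6] by (simp only: pos_le_divide_eq)
  finally have k4: "kol ?v * real n ^ 4 \<le> 1 / x ^ 6" .
  have "(real n + 1) ^ 4 \<le> (2 * real n) ^ 4" using n by (intro power_mono) auto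
  then have "kol ?v * (real n + 1) ^ 4 \<le> kol ?v * (16 * real n ^ 4)" using k0 by (intro mult_left_mono) (simp_all add: power_mult_distrib)
  also have "\<dots> \<le> 16 * (1 / x ^ 6)" using k4 by linarith
  also have "\<dots> \<le> 1 + 16 / x ^ 6" by simp
  finally have "((real n + 1)\<^sup>2 * kol ?v) * (real n + 1)\<^sup>2 \<le> 1 + 16 / x ^ 6" by (simp add: mult_ac flip: power_add)
  moreover have "0 < (real n + 1)\<^sup>2" by simp
  ultimately show ?thesis by (simp only: pos_le_divide_eq)
qed (use assms in simp)

lemma summable_square_kol:
  assumes x: "0 < x" shows "summable (\<lambda>n. (real n + 1)\<^sup>2 * kol (real n * x))"
proof (rule summable_comparison_test'[OF summable_inverse_square[of "1 + 16 / x ^ 6"], of 0])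
  fix n
  have "0 \<le> (real n + 1)\<^sup>2 * kol (real n * x)" using kol_pos[of "real n * x"] by (intro mult_nonneg_nonneg) auto
  then show "norm ((real n + 1)\<^sup>2 * kol (real n * x)) \<le> (1 + 16 / x ^ 6) / (real n + 1)\<^sup>2"
    using kol_square_bound[OF x, of n] by (simp only: real_norm_def abs_of_nonneg)
qed

lemma summable_kol: "0 < x \<Longrightarrow> summable (\<lambda>n. kol (real n * x))"
proof (rule summable_comparison_test'[OF summable_square_kol[of x], of 0])
  fix n
  have "1\<^sup>2 * kol (real n * x) \<le> (real n + 1)\<^sup>2 * kol (real n * x)"
    using kol_pos[of "real n * x"] by (intro mult_right_mono power_mono) auto
  then show "norm (kol (real n * x)) \<le> (real n + 1)\<^sup>2 * kol (real n * x)" using kol_pos[of "real n * x"] by simp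
qed

lemma real_times_kol_tendsto_0: "0 < x \<Longrightarrow> (\<lambda>n. real n * kol (real n * x)) \<longlonglongrightarrow> 0"
proof (rule Lim_null_comparison)
  assume x: "0 < x"
  show "(\<lambda>n. (real n + 1)\<^sup>2 * kol (real n * x)) \<longlonglongrightarrow> 0" by (rule summable_LIMSEQ_zero[OF summable_square_kol[OF x]])
  have "real n * kol (real n * x) \<le> (real n + 1)\<^sup>2 * kol (real n * x)" for n
    using kol_pos[of "real n * x"] by (intro mult_right_mono) (auto simp: power2_eq_square algebra_simps)
  then show "\<forall>\<^sub>F n in sequentially. norm (real n * kol (real n * x)) \<le> (real n + 1)\<^sup>2 * kol (real n * x)"
    using kol_pos by (intro always_eventually) (simp add: abs_mult less_imp_le)
qed

lemma tannery_sequentially: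
  fixes f :: "nat \<Rightarrow> nat \<Rightarrow> real"
  assumes "\<And>k. (\<lambda>i. f k i) \<longlonglongrightarrow> b k" and "\<And>k i. \<bar>f k i\<bar> \<le> m k" and "summable m"
  shows "(\<lambda>i. \<Sum>k. f k i) \<longlonglongrightarrow> (\<Sum>k. b k)"
proof -
  have "eventually (\<lambda>(k, i). norm (f k i) \<le> m k) (at_top \<times>\<^sub>F sequentially)"
    using assms(2) by (intro always_eventually allI) (simp add: case_prod_beta)
  from tannerys_theorem[OF assms(1) this assms(3)] show ?thesis by simp
qed

lemma kol_tendsto_0:
  assumes "filterlim f at_top F" shows "((\<lambda>x. kol (f x)) \<longlongrightarrow> 0) F"
proof -
  have "(kol \<longlongrightarrow> 0) at_top" unfolding kol_def by real_asymp
  then show ?thesis by (rule filterlim_compose) (rule assms)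
qed

subsection \<open>Primitives along the three curves\<close>

definition antideriv_K :: "real \<Rightarrow> nat \<Rightarrow> real \<Rightarrow> real" where
  "antideriv_K x n a = a * (real n * dkol (real n * x) + (real n + 1) * dkol ((real n + 1) * x))
     - (real n + 1) * (kol (real n * x + a) - kol (real n * x))
     + real n * (kol ((real n + 1) * x - a) - kol ((real n + 1) * x))"

text \<open>Here \<open>a + b\<close> is constant, so two of the four terms of \<open>kder\<close>
  do not depend on \<open>a\<close> and integrate to a multiple of \<open>a\<close>; the other two
  arguments have slopes \<open>1\<close> and \<open>-1\<close>. Every primitive is chosen to vanish
  at \<open>a = 0\<close>, the base point.\<close>

lemma antideriv_K:
  assumes x: "0 < x" and a: "a \<in> {0..x}"
  shows "summable (\<lambda>n. antideriv_K x n a)"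
    and "((\<lambda>a. \<Sum>n. antideriv_K x n a) has_real_derivative range_cdf_deriv a (x - a)) (at a within {0..x})"
proof -
  have D: "(antideriv_K x n has_real_derivative kder n a (x - a)) (at a within {0..x})" for n a
  proof -
    have e: "real n * x + a = (real n + 1) * a + real n * (x - a)" "(real n + 1) * x - a = real n * a + (real n + 1) * (x - a)"
      by (simp_all add: algebra_simps)
    have "(antideriv_K x n has_real_derivative (real n * dkol (real n * x) + (real n + 1) * dkol ((real n + 1) * x))
      - (real n + 1) * dkol (real n * x + a) - real n * dkol ((real n + 1) * x - a)) (at a within {0..x})"
      unfolding antideriv_K_def[abs_def] by (auto intro!: derivative_eq_intros)
    then show ?thesis by (simp add: kder_def e)
  qed
  have s0: "summable (\<lambda>n. antideriv_K x n 0)" by (simp add: antideriv_K_def)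
  note ca = curve_antiderivative[of "{0..x}" x "\<lambda>a. x - a" "antideriv_K x" 0, OF _ x _ D _ s0 a]
  show "summable (\<lambda>n. antideriv_K x n a)" using x by (intro ca(1)) auto
  show "((\<lambda>a. \<Sum>n. antideriv_K x n a) has_real_derivative range_cdf_deriv a (x - a)) (at a within {0..x})"
    using x by (intro ca(2)) auto
qed

text \<open>Pairing \<open>n\<close> with \<open>- (n + 1)\<close> matches an even summand to the
  terms \<open>t n + t (n + 1)\<close> produced by the grouping in \<open>kterm\<close>.\<close>

lemma has_sum_int_split:
  fixes f :: "int \<Rightarrow> real"
  assumes "summable (\<lambda>n. \<bar>f (int n)\<bar>)" "summable (\<lambda>n. \<bar>f (- int (Suc n))\<bar>)"
    and S: "(\<lambda>n. f (int n) + f (- int (Suc n))) sums S"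
  shows "(f has_sum S) UNIV"
proof -
  have 1: "((\<lambda>n. f (int n)) has_sum (\<Sum>n. f (int n))) UNIV" "((\<lambda>n. f (- int (Suc n))) has_sum (\<Sum>n. f (- int (Suc n)))) UNIV"
    by (rule norm_summable_imp_has_sum[OF _ summable_sums[OF summable_rabs_cancel]]; use assms(1,2) in simp)+
  have i: "inj_on int UNIV" "inj_on (\<lambda>n. - int (Suc n)) UNIV" by (simp_all add: inj_on_def)
  have "(f has_sum (\<Sum>n. f (int n))) (range int)" "(f has_sum (\<Sum>n. f (- int (Suc n)))) (range (\<lambda>n. - int (Suc n)))"
    unfolding has_sum_reindex[OF i(1)] has_sum_reindex[OF i(2)] o_def by (rule 1)+
  then have "(f has_sum ((\<Sum>n. f (int n)) + (\<Sum>n. f (- int (Suc n))))) (range int \<union> range (\<lambda>n. - int (Suc n)))"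
    by (rule has_sum_Un_disjoint) auto
  moreover have "range int \<union> range (\<lambda>n. - int (Suc n)) = UNIV"
  proof -
    have "k \<in> range int \<union> range (\<lambda>n. - int (Suc n))" for k
    proof (cases "0 \<le> k")
      case True then have "k = int (nat k)" by simp
      then show ?thesis by blast
    next
      case False
      then have "k = - int (Suc (nat (- k - 1)))" by simp
      then show ?thesis by blast
    qed
    then show ?thesis by blast
  qed
  moreover have "(\<Sum>n. f (int n)) + (\<Sum>n. f (- int (Suc n))) = S"
    using S suminf_add[OF summable_rabs_cancel[OF assms(1)] summable_rabs_cancel[OF assms(2)]] by (simp add: sums_iff)
  ultimately show ?thesis by simp
qed

lemma antideriv_K_sum:
  assumes x: "0 < x"
  shows "((\<lambda>k::int. (1 - 4 * (of_int k)\<^sup>2 * x\<^sup>2) * exp (- 2 * (of_int k)\<^sup>2 * x\<^sup>2)) has_sum (\<Sum>n. antideriv_K x n x)) UNIV"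
proof -
  define t where "t y = (1 - 4 * y\<^sup>2 * x\<^sup>2) * kol (y * x)" for y
  have t_eq: "(1 - 4 * (of_int k)\<^sup>2 * x\<^sup>2) * exp (- 2 * (of_int k)\<^sup>2 * x\<^sup>2) = t (of_int k)" for k :: int
    by (simp add: t_def kol_def power_mult_distrib)
  have t_neg: "t (- y) = t y" for y by (simp add: t_def kol_def)
  have sm: "summable (\<lambda>n. \<bar>t (real n)\<bar>)"
  proof (rule summable_comparison_test'[OF summable_mult[OF summable_square_kol[OF x], of "1 + 4 * x\<^sup>2"], of 0])
    fix n
    have n2: "(real n)\<^sup>2 \<le> (real n + 1)\<^sup>2" "1\<^sup>2 \<le> (real n + 1)\<^sup>2" by (intro power_mono; simp)+
    have "\<bar>1 - 4 * (real n)\<^sup>2 * x\<^sup>2\<bar> \<le> 1 + (real n)\<^sup>2 * (4 * x\<^sup>2)" by (simp add: abs_le_iff)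
    also have "\<dots> \<le> (real n + 1)\<^sup>2 + (real n + 1)\<^sup>2 * (4 * x\<^sup>2)" using n2 by (intro add_mono mult_right_mono) auto
    finally have "\<bar>t (real n)\<bar> \<le> ((real n + 1)\<^sup>2 + (real n + 1)\<^sup>2 * (4 * x\<^sup>2)) * kol (real n * x)"
      using kol_pos[of "real n * x"] unfolding t_def abs_mult by (intro mult_mono) auto
    then show "norm \<bar>t (real n)\<bar> \<le> (1 + 4 * x\<^sup>2) * ((real n + 1)\<^sup>2 * kol (real n * x))" by (simp add: algebra_simps)
  qed
  have sm': "summable (\<lambda>n. \<bar>t (real (Suc n))\<bar>)" using sm by (subst summable_Suc_iff)
  have "(\<lambda>n. antideriv_K x n x) sums (\<Sum>n. antideriv_K x n x)"
    using antideriv_K(1)[OF x, of x] x by (intro summable_sums) auto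
  \<comment> \<open>A telescoping series of total 0. Adding it removes the stray multiples of
    \<open>kol (n x)\<close> and \<open>kol ((n + 1) x)\<close> and leaves
    \<open>t n + t (n + 1)\<close>.\<close>
  moreover have "(\<lambda>n. 2 * (real (Suc n) * kol (real (Suc n) * x)) - 2 * (real n * kol (real n * x))) sums (2 * 0 - 2 * (real 0 * kol (real 0 * x)))"
    by (intro telescope_sums tendsto_mult tendsto_const real_times_kol_tendsto_0 x)
  ultimately have "(\<lambda>n. antideriv_K x n x + (2 * (real (Suc n) * kol (real (Suc n) * x)) - 2 * (real n * kol (real n * x)))) sums ((\<Sum>n. antideriv_K x n x) + 0)"
    by (intro sums_add) auto
  moreover have "antideriv_K x n x + (2 * (real (Suc n) * kol (real (Suc n) * x)) - 2 * (real n * kol (real n * x))) = t (real n) + t (real (Suc n))" for n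
  proof -
    have y: "real n + 1 = real (Suc n)" by simp
    have e: "real n * x + x = real (Suc n) * x" "real (Suc n) * x - x = real n * x" by (simp_all add: algebra_simps)
    have "antideriv_K x n x = x * (real n * dkol (real n * x) + real (Suc n) * dkol (real (Suc n) * x))
      - real (Suc n) * (kol (real (Suc n) * x) - kol (real n * x)) + real n * (kol (real n * x) - kol (real (Suc n) * x))"
      unfolding antideriv_K_def y e by (rule refl)
    also have "x * (real n * dkol (real n * x) + real (Suc n) * dkol (real (Suc n) * x)) =
        (t (real n) - kol (real n * x)) + (t (real (Suc n)) - kol (real (Suc n) * x))"
    proof -
      have "x * (y * dkol (y * x)) = t y - kol (y * x)" for y by (simp add: dkol_def t_def power2_eq_square algebra_simps)
      then show ?thesis by (simp only: distrib_left)
    qed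
    finally show ?thesis by (simp add: algebra_simps)
  qed
  ultimately have "(\<lambda>n. t (real n) + t (real (Suc n))) sums (\<Sum>n. antideriv_K x n x)" by simp
  then have "((\<lambda>k::int. t (of_int k)) has_sum (\<Sum>n. antideriv_K x n x)) UNIV"
    using sm sm' by (intro has_sum_int_split) (simp_all add: t_neg del: of_nat_Suc minus_add_distrib)
  then show ?thesis unfolding t_eq .
qed

section \<open>The half-line b = a + x, for the difference of the extrema\<close>

definition antideriv_L0 :: "real \<Rightarrow> nat \<Rightarrow> real \<Rightarrow> real" where
  "antideriv_L0 x n a = 1 / 2 * kol (real n * (2 * a + x)) + 1 / 2 * kol ((real n + 1) * (2 * a + x))
     - (real n + 1) / (2 * real n + 1) * kol ((2 * real n + 1) * a + real n * x)
     - real n / (2 * real n + 1) * kol ((2 * real n + 1) * a + (real n + 1) * x)"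

text \<open>In \<open>antideriv_L0\<close> each term is divided by the slope of its argument. At
  \<open>n = 0\<close> the first argument has slope 0 and a constant \<open>1 / 2\<close> remains,
  which survives for large \<open>a\<close>. Subtracting the value at 0 provides the base
  point.\<close>

definition antideriv_L :: "real \<Rightarrow> nat \<Rightarrow> real \<Rightarrow> real" where
  "antideriv_L x n a = antideriv_L0 x n a - antideriv_L0 x n 0"

lemma antideriv_L:
  assumes x: "0 < x" and a: "0 \<le> a"
  shows "((\<lambda>a. \<Sum>n. antideriv_L x n a) has_real_derivative range_cdf_deriv a (a + x)) (at a within {0..})"
proof -
  have D: "(antideriv_L x n has_real_derivative kder n a (a + x)) (at a within {0..})" for n a
  proof -
    let ?c = "2 * real n + 1"
    have c: "?c \<noteq> 0" using add_nonneg_pos[of "2 * real n" 1] by linarith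
    have e: "real n * (2 * a + x) = real n * (a + (a + x))" "(real n + 1) * (2 * a + x) = (real n + 1) * (a + (a + x))"
      "?c * a + real n * x = (real n + 1) * a + real n * (a + x)" "?c * a + (real n + 1) * x = real n * a + (real n + 1) * (a + x)"
      by (simp_all add: algebra_simps)
    have "(antideriv_L x n has_real_derivative
        1 / 2 * (dkol (real n * (2 * a + x)) * (real n * 2)) + 1 / 2 * (dkol ((real n + 1) * (2 * a + x)) * ((real n + 1) * 2))
        - (real n + 1) / ?c * (dkol (?c * a + real n * x) * ?c) - real n / ?c * (dkol (?c * a + (real n + 1) * x) * ?c)) (at a within {0..})"
      unfolding antideriv_L_def[abs_def] antideriv_L0_def by (auto intro!: derivative_eq_intros)
    also have "1 / 2 * (dkol (real n * (2 * a + x)) * (real n * 2)) + 1 / 2 * (dkol ((real n + 1) * (2 * a + x)) * ((real n + 1) * 2))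
        - (real n + 1) / ?c * (dkol (?c * a + real n * x) * ?c) - real n / ?c * (dkol (?c * a + (real n + 1) * x) * ?c) = kder n a (a + x)"
      unfolding kder_def e using c by simp
    finally show ?thesis .
  qed
  have s0: "summable (\<lambda>n. antideriv_L x n 0)" by (simp add: antideriv_L_def)
  show ?thesis
    by (rule curve_antiderivative(2)[of "{0..}" x "\<lambda>a. a + x" "antideriv_L x" 0, OF _ x _ D _ s0]) (use x a in auto)
qed

lemma abs_antideriv_L0_le:
  assumes "0 < x" "0 \<le> a" shows "\<bar>antideriv_L0 x n a\<bar> \<le> 3 * kol (real n * x)"
proof -
  have *: "\<bar>c * kol v\<bar> \<le> kol (real n * x)" if "0 \<le> c" "c \<le> 1" "real n * x \<le> v" for c v
  proof -
    have "kol v \<le> kol (real n * x)" using that assms by (intro kol_antimono) auto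
    then have "c * kol v \<le> 1 * kol (real n * x)" using that kol_pos[of v] by (intro mult_mono) auto
    then show ?thesis using that kol_pos[of v] by (simp add: abs_mult)
  qed
  have half: "\<bar>1 / 2 * kol v\<bar> \<le> 1 / 2 * kol (real n * x)" if "real n * x \<le> v" for v
    using *[of 1 v] that by simp
  have "\<bar>1 / 2 * kol (real n * (2 * a + x))\<bar> \<le> 1 / 2 * kol (real n * x)"
    using assms by (intro half mult_left_mono) auto
  moreover have "\<bar>1 / 2 * kol ((real n + 1) * (2 * a + x))\<bar> \<le> 1 / 2 * kol (real n * x)"
    using assms by (intro half mult_mono) auto
  moreover have "\<bar>(real n + 1) / (2 * real n + 1) * kol ((2 * real n + 1) * a + real n * x)\<bar> \<le> kol (real n * x)"
    using assms by (intro *) auto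
  moreover have "\<bar>real n / (2 * real n + 1) * kol ((2 * real n + 1) * a + (real n + 1) * x)\<bar> \<le> kol (real n * x)"
  proof (intro *)
    show "real n * x \<le> (2 * real n + 1) * a + (real n + 1) * x"
      using mult_nonneg_nonneg[of "2 * real n + 1" a] assms by (simp add: algebra_simps)
  qed auto
  ultimately show ?thesis unfolding antideriv_L0_def by linarith
qed

text \<open>The bound by \<open>kol (real n * x)\<close> is uniform in the end point, so the limit
  passes inside the series, where only the constant at \<open>n = 0\<close> persists.\<close>

lemma antideriv_L_limit:
  assumes x: "0 < x" and b: "filterlim b at_top sequentially" "\<And>i. 0 \<le> b i"
  shows "(\<lambda>i. \<Sum>n. antideriv_L x n (b i)) \<longlonglongrightarrow> (\<Sum>n. (if n = 0 then 1 / 2 else 0) - antideriv_L0 x n 0)"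
proof (rule tannery_sequentially)
  show "summable (\<lambda>n. 6 * kol (real n * x))" by (intro summable_mult summable_kol x)
  show "\<bar>antideriv_L x n (b i)\<bar> \<le> 6 * kol (real n * x)" for n i
    using abs_antideriv_L0_le[OF x b(2)[of i], of n] abs_antideriv_L0_le[OF x, of 0 n] by (simp add: antideriv_L_def)
  show "(\<lambda>i. antideriv_L x n (b i)) \<longlonglongrightarrow> (if n = 0 then 1 / 2 else 0) - antideriv_L0 x n 0" for n
  proof -
    have t: "filterlim (\<lambda>i. c * b i + d) at_top sequentially" if "c > 0" for c d
      using filterlim_tendsto_add_at_top[OF tendsto_const[of d] filterlim_tendsto_pos_mult_at_top[OF tendsto_const that b(1)]]
      by (simp add: add.commute)
    have k: "(\<lambda>i. kol (c * b i + d)) \<longlonglongrightarrow> 0" if "c > 0" for c d by (rule kol_tendsto_0[OF t[OF that]])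
    have "(\<lambda>i. kol (real n * (2 * b i + x))) \<longlonglongrightarrow> (if n = 0 then 1 else 0)"
      using k[of "2 * real n" "real n * x"] by (cases "n = 0") (simp_all add: algebra_simps)
    moreover have "(\<lambda>i. kol ((real n + 1) * (2 * b i + x))) \<longlonglongrightarrow> 0"
      using k[of "2 * (real n + 1)" "(real n + 1) * x"] by (simp add: algebra_simps)
    moreover have "(\<lambda>i. kol ((2 * real n + 1) * b i + real n * x)) \<longlonglongrightarrow> 0" "(\<lambda>i. kol ((2 * real n + 1) * b i + (real n + 1) * x)) \<longlonglongrightarrow> 0"
      by (rule k, simp)+
    ultimately have "(\<lambda>i. antideriv_L x n (b i)) \<longlonglongrightarrow> 1 / 2 * (if n = 0 then 1 else 0) + 1 / 2 * 0 - (real n + 1) / (2 * real n + 1) * 0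
      - real n / (2 * real n + 1) * 0 - antideriv_L0 x n 0"
      unfolding antideriv_L_def antideriv_L0_def[of x n "b _"] by (intro tendsto_intros)
    then show ?thesis by (cases "n = 0") simp_all
  qed
qed

text \<open>Summation by parts with the coefficients \<open>c n = 1 / (2 (2 n + 1))\<close>. Their
  differences are the coefficients of the claimed series, and the boundary term together with the
  constant of index 0 gives the total 1.\<close>

lemma antideriv_L_sum:
  assumes x: "0 < x"
  shows "((\<lambda>k::nat. 1 / (4 * (real k)\<^sup>2 - 1) * exp (- 2 * (real k)\<^sup>2 * x\<^sup>2)) has_sum
      (1 - (\<Sum>n. (if n = 0 then 1 / 2 else 0) - antideriv_L0 x n 0))) {1..}"
proof -
  define k where "k n = kol (real n * x)" for n :: nat
  define f where "f m = 1 / (4 * (real m)\<^sup>2 - 1) * k m" for m :: nat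
  have feq: "1 / (4 * (real m)\<^sup>2 - 1) * exp (- 2 * (real m)\<^sup>2 * x\<^sup>2) = f m" for m
    by (simp add: f_def k_def kol_def power_mult_distrib)
  have den: "1 \<le> 4 * (real m)\<^sup>2 - 1" if "m \<ge> 1" for m
  proof -
    have "1\<^sup>2 \<le> (real m)\<^sup>2" using that by (intro power_mono) auto
    then show ?thesis by simp
  qed
  have sk: "summable k" unfolding k_def by (rule summable_kol[OF x])
  have fk: "0 \<le> f m" "f m \<le> k m" if "m \<ge> 1" for m
  proof -
    have "1 / (4 * (real m)\<^sup>2 - 1) \<le> 1" "0 \<le> 1 / (4 * (real m)\<^sup>2 - 1)" using den[OF that] by (simp_all add: divide_le_eq)
    moreover have "0 \<le> k m" using kol_pos by (simp add: k_def less_imp_le)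
    ultimately have "0 * k m \<le> 1 / (4 * (real m)\<^sup>2 - 1) * k m" "1 / (4 * (real m)\<^sup>2 - 1) * k m \<le> 1 * k m"
      by (intro mult_right_mono; simp)+
    then show "0 \<le> f m" "f m \<le> k m" by (simp_all add: f_def)
  qed
  have sf: "summable (\<lambda>n. norm (f (Suc n)))"
  proof (rule summable_comparison_test'[of "\<lambda>n. k (Suc n)" 0])
    show "summable (\<lambda>n. k (Suc n))" using sk by (subst summable_Suc_iff)
    show "norm (norm (f (Suc n))) \<le> k (Suc n)" for n using fk[of "Suc n"] by simp
  qed
  let ?g = "\<lambda>n. (if n = 0 then 1 / 2 else 0) - antideriv_L0 x n 0"
  let ?c = "\<lambda>n. 1 / (2 * (2 * real n + 1))"
  have kSuc: "kol ((real n + 1) * x) = k (Suc n)" for n by (simp add: k_def add.commute)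
  have g: "?g n = (if n = 0 then 1 / 2 else 0) + ?c n * k n - ?c n * k (Suc n)" for n
  proof -
    have c: "2 * real n + 1 \<noteq> 0" using add_nonneg_pos[of "2 * real n" 1] by linarith
    have "1 / 2 - (real n + 1) / (2 * real n + 1) = - ?c n" "1 / 2 - real n / (2 * real n + 1) = ?c n"
      using c by (simp_all add: divide_simps)
    moreover have "1 / 2 * u + 1 / 2 * v - p * u - q * v = (1 / 2 - p) * u + (1 / 2 - q) * v" for p q u v :: real
      by (simp add: left_diff_distrib)
    ultimately have "antideriv_L0 x n 0 = - ?c n * k n + ?c n * k (Suc n)"
      unfolding antideriv_L0_def by (simp only: mult_zero_right add_0 kSuc k_def[symmetric])
    then show ?thesis by simp
  qed
  have ck: "(\<lambda>n. ?c n * k n) \<longlonglongrightarrow> 0"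
  proof (rule Lim_null_comparison[OF _ summable_LIMSEQ_zero[OF sk]])
    have "\<bar>?c n * k n\<bar> \<le> 1 * k n" for n
      using kol_pos[of "real n * x"] unfolding abs_mult k_def by (intro mult_mono) (auto simp: divide_le_eq)
    then show "\<forall>\<^sub>F n in sequentially. norm (?c n * k n) \<le> k n" by (intro always_eventually) simp
  qed
  have s1: "(\<lambda>n. (?c n * k n) - (?c (Suc n) * k (Suc n))) sums (?c 0 * k 0 - 0)"
    by (rule telescope_sums'[OF ck])
  have s2: "(\<lambda>n. if n = 0 then 1 / 2 else 0 :: real) sums (1 / 2)" using sums_single[of 0 "\<lambda>_. 1 / 2 :: real"] .
  have s3: "(\<lambda>n. f (Suc n)) sums (\<Sum>n. f (Suc n))" by (rule summable_sums[OF summable_norm_cancel[OF sf]])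
  have "(\<lambda>n. ((if n = 0 then 1 / 2 else 0) + ((?c n * k n) - (?c (Suc n) * k (Suc n)))) - f (Suc n)) sums ((1 / 2 + (?c 0 * k 0 - 0)) - (\<Sum>n. f (Suc n)))"
    by (rule sums_diff[OF sums_add[OF s2 s1] s3])
  moreover have "((if n = 0 then 1 / 2 else 0) + ((?c n * k n) - (?c (Suc n) * k (Suc n)))) - f (Suc n) = ?g n" for n
  proof -
    \<comment> \<open>Partial fractions of \<open>1 / ((2 n + 1) (2 n + 3))\<close>.\<close>
    have "?c (Suc n) + 1 / (4 * (real (Suc n))\<^sup>2 - 1) = ?c n"
    proof -
      have "4 * (real (Suc n))\<^sup>2 - 1 = (2 * real n + 1) * (2 * real (Suc n) + 1)" by (simp add: power2_eq_square algebra_simps)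
      moreover have "1 / (2 * q) + 1 / (p * q) = 1 / (2 * p)" if "0 < p" "0 < q" "p + 2 = q" for p q :: real
      proof -
        have "1 / (2 * q) + 1 / (p * q) = (p + 2) * (1 / (2 * p * q))" using that(1,2) by (simp add: add_divide_distrib)
        then show ?thesis using that by simp
      qed
      moreover have "0 < 2 * real n + 1" "0 < 2 * real (Suc n) + 1" "2 * real n + 1 + 2 = 2 * real (Suc n) + 1"
        using add_nonneg_pos[of "2 * real n" 1] by simp_all
      ultimately show ?thesis by (simp only:)
    qed
    then have "?c (Suc n) * k (Suc n) + f (Suc n) = ?c n * k (Suc n)"
      unfolding f_def by (metis distrib_right)
    then show ?thesis unfolding g by linarith
  qed
  moreover have "1 / 2 + (?c 0 * k 0 - 0) = 1" by (simp add: k_def)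
  ultimately have "?g sums (1 - (\<Sum>n. f (Suc n)))" by (simp only:)
  then have val: "1 - (\<Sum>n. ?g n) = (\<Sum>n. f (Suc n))" by (simp add: sums_iff)
  have "((\<lambda>n. f (Suc n)) has_sum (\<Sum>n. f (Suc n))) UNIV"
    by (rule norm_summable_imp_has_sum[OF sf summable_sums[OF summable_norm_cancel[OF sf]]])
  then have "(f has_sum (\<Sum>n. f (Suc n))) (range Suc)"
    using has_sum_reindex[of Suc UNIV f] by (simp add: o_def)
  moreover have "range Suc = {1..}" by (metis One_nat_def greaterThan_0 atLeast_Suc_greaterThan)
  ultimately show ?thesis unfolding feq val by simp
qed

section \<open>The ray b = x a, for the quotient of the extrema\<close>

lemma Digamma_reflection:
  fixes u :: real
  assumes u: "0 < u" "u < 1"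
  shows "Digamma (1 - u) - Digamma u = pi * cot (pi * u)"
proof -
  \<comment> \<open>The logarithm of Euler's reflection formula; differentiating it gives the
    claim.\<close>
  have refl: "ln_Gamma v + ln_Gamma (1 - v) = ln pi - ln (sin (pi * v))" if v: "0 < v" "v < 1" for v :: real
  proof -
    have s: "0 < sin (pi * v)" using v by (intro sin_gt_zero) auto
    have "complex_of_real (Gamma v * Gamma (1 - v)) = Gamma (of_real v) * Gamma (1 - of_real v)"
      using Gamma_complex_of_real[of v] Gamma_complex_of_real[of "1 - v"] by simp
    also have "\<dots> = of_real pi / sin (of_real pi * of_real v)" by (rule Gamma_reflection_complex)
    also have "\<dots> = of_real (pi / sin (pi * v))" by (simp add: sin_of_real flip: of_real_mult)
    finally have "Gamma v * Gamma (1 - v) = pi / sin (pi * v)" by (simp only: of_real_eq_iff)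
    moreover have "0 < Gamma v" "0 < Gamma (1 - v)" using v by (auto intro: Gamma_real_pos)
    ultimately have "ln (Gamma v) + ln (Gamma (1 - v)) = ln pi - ln (sin (pi * v))"
      using s ln_mult[of "Gamma v" "Gamma (1 - v)"] ln_div[of pi "sin (pi * v)"] by simp
    then show ?thesis using v by (simp add: ln_Gamma_real_pos)
  qed
  have s: "sin (pi * u) \<noteq> 0" using u sin_gt_zero[of "pi * u"] by auto
  have "((\<lambda>v. ln_Gamma v + ln_Gamma (1 - v)) has_real_derivative Digamma u + Digamma (1 - u) * (0 - 1)) (at u)"
    using u by (auto intro!: derivative_eq_intros)
  moreover have "((\<lambda>v. ln pi - ln (sin (pi * v))) has_real_derivative 0 - inverse (sin (pi * u)) * (cos (pi * u) * pi)) (at u)"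
    using u sin_gt_zero[of "pi * u"] by (auto intro!: derivative_eq_intros simp: divide_inverse)
  then have "((\<lambda>v. ln_Gamma v + ln_Gamma (1 - v)) has_real_derivative 0 - inverse (sin (pi * u)) * (cos (pi * u) * pi)) (at u)"
    by (rule has_field_derivative_transform_within_open[of _ _ _ "{0<..<1}"]) (use u refl in auto)
  ultimately have "Digamma u + Digamma (1 - u) * (0 - 1) = 0 - inverse (sin (pi * u)) * (cos (pi * u) * pi)"
    by (rule DERIV_unique)
  then show ?thesis by (simp add: cot_def divide_inverse mult_ac)
qed

text \<open>After dividing by \<open>1 + x\<close> the denominators are \<open>n + (1 - u)\<close>
  and \<open>n + u\<close> with \<open>u = x / (1 + x)\<close>, so the sum is a difference of two
  Digamma series.\<close>

lemma cot_partial_fraction: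
  assumes x: "0 < x"
  shows "(\<lambda>n. 1 / (real n * (1 + x) + 1) - 1 / (real n * (1 + x) + x)) sums (- pi / (1 + x) * cot (pi * x / (1 + x)))"
proof -
  let ?u = "x / (1 + x)"
  have u: "0 < ?u" "?u < 1" using x by (auto simp: field_simps)
  have "(\<lambda>n. (inverse (of_nat (Suc n)) - inverse (?u + of_nat n)) - (inverse (of_nat (Suc n)) - inverse ((1 - ?u) + of_nat n)))
      sums ((\<Sum>n. inverse (of_nat (Suc n)) - inverse (?u + of_nat n)) - (\<Sum>n. inverse (of_nat (Suc n)) - inverse ((1 - ?u) + of_nat n)))"
    using u by (intro sums_diff summable_sums summable_Digamma) auto
  also have "(\<Sum>n. inverse (of_nat (Suc n)) - inverse (?u + of_nat n)) - (\<Sum>n. inverse (of_nat (Suc n)) - inverse ((1 - ?u) + of_nat n)) = Digamma ?u - Digamma (1 - ?u)"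
    by (simp add: Digamma_def)
  also have "\<dots> = - pi * cot (pi * ?u)" using Digamma_reflection[OF u] by simp
  finally have s: "(\<lambda>n. inverse ((1 - ?u) + real n) - inverse (?u + real n)) sums (- pi * cot (pi * ?u))" by simp
  have "(\<lambda>n. 1 / (1 + x) * (inverse ((1 - ?u) + real n) - inverse (?u + real n))) sums (1 / (1 + x) * (- pi * cot (pi * ?u)))"
    by (rule sums_mult[OF s])
  moreover have "1 / (1 + x) * (inverse ((1 - ?u) + real n) - inverse (?u + real n)) = 1 / (real n * (1 + x) + 1) - 1 / (real n * (1 + x) + x)" for n
  proof -
    have "(1 + x) * ((1 - ?u) + real n) = real n * (1 + x) + 1" "(1 + x) * (?u + real n) = real n * (1 + x) + x"
    proof -
      have xu: "(1 + x) * ?u = x" using x by simp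
      show "(1 + x) * ((1 - ?u) + real n) = real n * (1 + x) + 1" "(1 + x) * (?u + real n) = real n * (1 + x) + x"
        by (simp_all only: distrib_left right_diff_distrib xu) (simp_all add: algebra_simps)
    qed
    then show ?thesis by (metis inverse_eq_divide inverse_mult_distrib right_diff_distrib)
  qed
  ultimately show ?thesis by simp
qed

text \<open>Each term of \<open>kder\<close> along \<open>b = x a\<close> is divided by the slope of
  its argument. At \<open>n = 0\<close> the first term is the constant \<open>1 / (1 + x)\<close>,
  which is the limit for large \<open>a\<close>.\<close>

definition antideriv_Q :: "real \<Rightarrow> nat \<Rightarrow> real \<Rightarrow> real" where
  "antideriv_Q x n a = 1 / (1 + x) * kol (real n * (1 + x) * a) + 1 / (1 + x) * kol ((real n + 1) * (1 + x) * a)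
     - (real n + 1) / (real n * (1 + x) + 1) * kol ((real n * (1 + x) + 1) * a)
     - real n / (real n * (1 + x) + x) * kol ((real n * (1 + x) + x) * a)"

lemma abs_antideriv_Q_le:
  assumes x: "0 < x" and a: "0 \<le> a" shows "\<bar>antideriv_Q x n a\<bar> \<le> 4 * kol (real n * a)"
proof -
  have nx: "0 \<le> real n * x" using x by simp
  have *: "\<bar>c * kol (d * a)\<bar> \<le> kol (real n * a)" if "0 \<le> c" "c \<le> 1" "real n \<le> d" for c d
  proof -
    have "kol (d * a) \<le> kol (real n * a)" using that a by (intro kol_antimono mult_right_mono) auto
    then have "c * kol (d * a) \<le> 1 * kol (real n * a)" using that kol_pos[of "d * a"] by (intro mult_mono) auto
    then show ?thesis using that kol_pos[of "d * a"] by (simp add: abs_mult)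
  qed
  have r: "0 < real n * (1 + x) + 1" "0 < real n * (1 + x) + x" using x by (auto intro: add_nonneg_pos)
  have "\<bar>1 / (1 + x) * kol (real n * (1 + x) * a)\<bar> \<le> kol (real n * a)"
    using x nx by (intro *) (auto simp: algebra_simps)
  moreover have "\<bar>1 / (1 + x) * kol ((real n + 1) * (1 + x) * a)\<bar> \<le> kol (real n * a)"
    using x nx by (intro *) (auto simp: algebra_simps)
  moreover have "\<bar>(real n + 1) / (real n * (1 + x) + 1) * kol ((real n * (1 + x) + 1) * a)\<bar> \<le> kol (real n * a)"
    using x nx r by (intro *) (auto simp: divide_le_eq algebra_simps)
  moreover have "\<bar>real n / (real n * (1 + x) + x) * kol ((real n * (1 + x) + x) * a)\<bar> \<le> kol (real n * a)"
    using x nx r by (intro *) (auto simp: divide_le_eq algebra_simps)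
  ultimately show ?thesis unfolding antideriv_Q_def by linarith
qed

lemma antideriv_Q:
  assumes x: "0 < x" and a: "0 < a"
  shows "((\<lambda>a. \<Sum>n. antideriv_Q x n a) has_real_derivative range_cdf_deriv a (x * a)) (at a)"
proof -
  \<comment> \<open>On this half-line the sum \<open>y + x * y\<close> stays above
    \<open>a / 2\<close>, as uniform convergence requires, and \<open>a\<close> is an interior
    point.\<close>
  let ?S = "{a / 2..}"
  have D: "(antideriv_Q x n has_real_derivative kder n y (x * y)) (at y within ?S)" for n y
  proof -
    let ?c = "real n * (1 + x) + 1" and ?d = "real n * (1 + x) + x"
    have cd: "?c \<noteq> 0" "?d \<noteq> 0" "1 + x \<noteq> 0"
      using add_nonneg_pos[of "real n * (1 + x)" 1] add_nonneg_pos[of "real n * (1 + x)" x] x by auto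
    have e: "real n * (1 + x) * y = real n * (y + x * y)" "(real n + 1) * (1 + x) * y = (real n + 1) * (y + x * y)"
      "?c * y = (real n + 1) * y + real n * (x * y)" "?d * y = real n * y + (real n + 1) * (x * y)"
      by (simp_all add: algebra_simps)
    have "(antideriv_Q x n has_real_derivative
        1 / (1 + x) * (dkol (real n * (1 + x) * y) * (real n * (1 + x))) + 1 / (1 + x) * (dkol ((real n + 1) * (1 + x) * y) * ((real n + 1) * (1 + x)))
        - (real n + 1) / ?c * (dkol (?c * y) * ?c) - real n / ?d * (dkol (?d * y) * ?d)) (at y within ?S)"
      unfolding antideriv_Q_def[abs_def] by (auto intro!: derivative_eq_intros)
    also have "1 / (1 + x) * (dkol (real n * (1 + x) * y) * (real n * (1 + x))) + 1 / (1 + x) * (dkol ((real n + 1) * (1 + x) * y) * ((real n + 1) * (1 + x)))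
        - (real n + 1) / ?c * (dkol (?c * y) * ?c) - real n / ?d * (dkol (?d * y) * ?d) = kder n y (x * y)"
    proof -
      have "1 / r * (z * (w * r)) = w * z" "w / r * (z * r) = w * z" if "r \<noteq> 0" for r w z :: real using that by simp_all
      with cd show ?thesis unfolding kder_def e by simp
    qed
    finally show ?thesis .
  qed
  have s0: "summable (\<lambda>n. antideriv_Q x n a)"
    by (rule summable_comparison_test'[OF summable_mult[OF summable_kol[OF a], of 4], of 0])
      (use abs_antideriv_Q_le[OF x less_imp_le[OF a]] in simp)
  have "((\<lambda>a. \<Sum>n. antideriv_Q x n a) has_real_derivative range_cdf_deriv a (x * a)) (at a within ?S)"
    by (rule curve_antiderivative(2)[of ?S "a / 2" "\<lambda>a. x * a" "antideriv_Q x" a, OF _ _ _ D _ s0]) (use x a in \<open>auto intro: add_increasing2\<close>)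
  moreover have "a \<in> interior ?S" using a by simp
  ultimately show ?thesis by (simp only: at_within_interior)
qed

lemma antideriv_Q_limit_top:
  assumes x: "0 < x" and b: "filterlim b at_top sequentially" "\<And>i. 1 \<le> b i"
  shows "(\<lambda>i. \<Sum>n. antideriv_Q x n (b i)) \<longlonglongrightarrow> 1 / (1 + x)"
proof -
  have "(\<lambda>i. \<Sum>n. antideriv_Q x n (b i)) \<longlonglongrightarrow> (\<Sum>n. if n = 0 then 1 / (1 + x) else 0)"
  proof (rule tannery_sequentially)
    show "summable (\<lambda>n. 4 * kol (real n * 1))" by (intro summable_mult summable_kol) simp
    show "\<bar>antideriv_Q x n (b i)\<bar> \<le> 4 * kol (real n * 1)" for n i
    proof -
      have b0: "0 \<le> b i" using b(2)[of i] by linarith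
      have "kol (real n * b i) \<le> kol (real n * 1)" using b(2)[of i] by (intro kol_antimono mult_left_mono) auto
      then show ?thesis using abs_antideriv_Q_le[OF x b0, of n] by linarith
    qed
    show "(\<lambda>i. antideriv_Q x n (b i)) \<longlonglongrightarrow> (if n = 0 then 1 / (1 + x) else 0)" for n
    proof -
      have k: "(\<lambda>i. kol (c * b i)) \<longlonglongrightarrow> 0" if "c > 0" for c
        by (rule kol_tendsto_0[OF filterlim_tendsto_pos_mult_at_top[OF tendsto_const that b(1)]])
      have "(\<lambda>i. kol (real n * (1 + x) * b i)) \<longlonglongrightarrow> (if n = 0 then 1 else 0)"
        using k[of "real n * (1 + x)"] x by (cases "n = 0") simp_all
      moreover have "(\<lambda>i. kol ((real n + 1) * (1 + x) * b i)) \<longlonglongrightarrow> 0" using x by (intro k mult_pos_pos) auto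
      moreover have "(\<lambda>i. kol ((real n * (1 + x) + 1) * b i)) \<longlonglongrightarrow> 0" using x by (intro k add_nonneg_pos) auto
      moreover have "(\<lambda>i. kol ((real n * (1 + x) + x) * b i)) \<longlonglongrightarrow> 0" using x by (intro k add_nonneg_pos) auto
      ultimately have "(\<lambda>i. antideriv_Q x n (b i)) \<longlonglongrightarrow> 1 / (1 + x) * (if n = 0 then 1 else 0) + 1 / (1 + x) * 0
         - (real n + 1) / (real n * (1 + x) + 1) * 0 - real n / (real n * (1 + x) + x) * 0"
        unfolding antideriv_Q_def by (intro tendsto_intros)
      then show ?thesis by (cases "n = 0") simp_all
    qed
  qed
  moreover have "(\<Sum>n::nat. if n = 0 then 1 / (1 + x) else 0) = 1 / (1 + x)"
    using sums_single[of 0 "\<lambda>_. 1 / (1 + x)"] by (rule sums_unique[symmetric])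
  ultimately show ?thesis by simp
qed

text \<open>Two mean value steps in the scale \<open>s\<close> of \<open>kol (s * a)\<close>, not in
  \<open>a\<close>: the second derivative times \<open>s^2\<close> is a bounded function of
  \<open>s * a\<close>, so the estimate is uniform in \<open>a\<close>.\<close>

lemma kol_second_difference:
  assumes c: "0 < c" and x: "0 < x"
  shows "\<bar>kol (c * a) + kol ((c + 1 + x) * a) - kol ((c + 1) * a) - kol ((c + x) * a)\<bar> \<le> x * (8 / c\<^sup>2)"
proof -
  define F1 where "F1 s = dkol (s * a) * a" for s
  define F2 where "F2 s = (16 * (s * a)\<^sup>2 - 4) * kol (s * a) * a * a" for s
  have D1: "((\<lambda>s. kol (s * a)) has_real_derivative F1 s) (at s)" for s
    unfolding F1_def by (auto intro!: derivative_eq_intros)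
  have D2: "(F1 has_real_derivative F2 s) (at s)" for s
    unfolding F1_def[abs_def] F2_def dkol_def by (auto intro!: derivative_eq_intros simp: dkol_def power2_eq_square algebra_simps)
  let ?\<Phi> = "\<lambda>s. kol ((s + 1) * a) - kol (s * a)"
  have D\<Phi>: "(?\<Phi> has_real_derivative F1 (s + 1) - F1 s) (at s)" for s
    using DERIV_diff[OF DERIV_shift[THEN iffD1, OF D1[of "s + 1"]] D1[of s]] by simp
  obtain \<xi> where \<xi>: "c < \<xi>" "?\<Phi> (c + x) - ?\<Phi> c = x * (F1 (\<xi> + 1) - F1 \<xi>)"
    using MVT2[of c "c + x" ?\<Phi> "\<lambda>s. F1 (s + 1) - F1 s"] D\<Phi> x by auto
  obtain \<zeta> where \<zeta>: "\<xi> < \<zeta>" "F1 (\<xi> + 1) - F1 \<xi> = F2 \<zeta>"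
    using MVT2[of \<xi> "\<xi> + 1" F1 F2] D2 by auto
  have z: "0 < \<zeta>" "c < \<zeta>" using \<xi> \<zeta> c by auto
  have "\<bar>F2 \<zeta>\<bar> * \<zeta>\<^sup>2 \<le> 8"
  proof -
    let ?v = "\<zeta> * a"
    have "\<bar>F2 \<zeta>\<bar> * \<zeta>\<^sup>2 = \<bar>16 * ?v\<^sup>2 - 4\<bar> * ?v\<^sup>2 * kol ?v"
      using kol_pos[of ?v] by (simp add: F2_def abs_mult power2_eq_square mult_ac)
    also have "\<dots> \<le> (16 * ?v\<^sup>2 + 4) * ?v\<^sup>2 * kol ?v"
      using kol_pos[of ?v] by (intro mult_right_mono) (auto simp: abs_le_iff)
    also have "\<dots> \<le> 8 * (kol ?v * (1 + 2 * ?v\<^sup>2 + 2 * ?v ^ 4 + 4 / 3 * ?v ^ 6))"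
    proof -
      have "(16 * ?v\<^sup>2 + 4) * ?v\<^sup>2 \<le> 8 * (1 + 2 * ?v\<^sup>2 + 2 * ?v ^ 4 + 4 / 3 * ?v ^ 6)"
      proof -
        have "(16 * ?v\<^sup>2 + 4) * ?v\<^sup>2 = 16 * ?v ^ 4 + 4 * ?v\<^sup>2" by (simp add: distrib_right mult.assoc flip: power_add)
        moreover have "0 \<le> ?v\<^sup>2" "0 \<le> ?v ^ 4" "0 \<le> ?v ^ 6" by (simp_all only: zero_le_even_power' zero_le_power2) simp_all
        ultimately show ?thesis unfolding distrib_left by linarith
      qed
      then show ?thesis using kol_pos[of ?v] by (simp only: mult.left_commute[of 8] mult.commute[of _ "kol ?v"]) (intro mult_left_mono, auto)
    qed
    also have "\<dots> \<le> 8 * 1" using kol_poly_le[of ?v] by (intro mult_left_mono) auto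
    finally show ?thesis by simp
  qed
  then have "\<bar>F2 \<zeta>\<bar> \<le> 8 / \<zeta>\<^sup>2" using z by (simp add: pos_le_divide_eq)
  also have "\<dots> \<le> 8 / c\<^sup>2" using z c by (intro divide_left_mono power_mono) auto
  finally have "x * \<bar>F2 \<zeta>\<bar> \<le> x * (8 / c\<^sup>2)" using x by (intro mult_left_mono) auto
  moreover have "kol (c * a) + kol ((c + 1 + x) * a) - kol ((c + 1) * a) - kol ((c + x) * a) = ?\<Phi> (c + x) - ?\<Phi> c"
    by (simp add: add_ac)
  ultimately show ?thesis unfolding \<xi>(2) \<zeta>(2) using x by (simp add: abs_mult)
qed

text \<open>The derivative of \<open>kol (s * a) / s\<close> in \<open>s\<close> is at most
  \<open>3 / s^2\<close>, again whatever \<open>a\<close> is.\<close>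

lemma kol_quotient_difference:
  assumes c: "0 < c" and p: "c \<le> p" "c \<le> q"
  shows "\<bar>kol (p * a) / p - kol (q * a) / q\<bar> \<le> \<bar>p - q\<bar> * (3 / c\<^sup>2)"
proof -
  define F where "F s = (dkol (s * a) * a * s - kol (s * a)) / (s * s)" for s
  have D: "((\<lambda>s. kol (s * a) / s) has_real_derivative F s) (at s)" if "0 < s" for s
    unfolding F_def using that by (auto intro!: derivative_eq_intros)
  have Fb: "\<bar>F s\<bar> \<le> 3 / c\<^sup>2" if s: "c \<le> s" for s
  proof -
    let ?v = "s * a"
    have s0: "0 < s" using s c by simp
    have "0 \<le> kol ?v * (1 + 2 * ?v ^ 4 + 4 / 3 * ?v ^ 6)" using kol_pos[of ?v] by (intro mult_nonneg_nonneg) auto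
    then have k: "kol ?v * (2 * ?v\<^sup>2) \<le> 1" using kol_poly_le[of ?v] by (simp add: distrib_left)
    have "\<bar>dkol ?v * a * s - kol ?v\<bar> \<le> \<bar>dkol ?v * a * s\<bar> + \<bar>kol ?v\<bar>" by (rule abs_triangle_ineq4)
    also have "\<bar>dkol ?v * a * s\<bar> = 2 * (kol ?v * (2 * ?v\<^sup>2))"
      using kol_pos[of ?v] by (simp add: dkol_def abs_mult power2_eq_square mult_ac)
    also have "2 * (kol ?v * (2 * ?v\<^sup>2)) + \<bar>kol ?v\<bar> \<le> 2 * 1 + 1" using k kol_pos[of ?v] kol_le_1[of ?v] by (intro add_mono) auto
    finally have "\<bar>F s\<bar> \<le> 3 / s\<^sup>2" using s0 unfolding F_def by (simp add: abs_divide power2_eq_square divide_right_mono)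
    also have "\<dots> \<le> 3 / c\<^sup>2" using s c by (intro divide_left_mono power_mono) auto
    finally show ?thesis .
  qed
  have main: "\<bar>kol (p * a) / p - kol (q * a) / q\<bar> \<le> \<bar>p - q\<bar> * (3 / c\<^sup>2)" if "c \<le> p" "p < q" for p q
  proof -
    have "\<exists>z>p. z < q \<and> kol (q * a) / q - kol (p * a) / p = (q - p) * F z"
      using that c by (intro MVT2 D) auto
    then obtain z where "p < z" "kol (q * a) / q - kol (p * a) / p = (q - p) * F z" by auto
    then have "\<bar>kol (p * a) / p - kol (q * a) / q\<bar> = (q - p) * \<bar>F z\<bar>" "c \<le> z"
      using that by (simp_all add: abs_minus_commute[of "kol (p * a) / p"] abs_mult)
    then show ?thesis using mult_left_mono[OF Fb[of z], of "q - p"] that by simp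
  qed
  show ?thesis
    using main[of p q] main[of q p] p by (cases p q rule: linorder_cases) (auto simp: abs_minus_commute)
qed

text \<open>Every coefficient is \<open>1 / (1 + x)\<close> plus a correction of order
  \<open>1 / n\<close>. The common part multiplies a second difference, the corrections pair up to a
  first difference; both are of order \<open>1 / n^2\<close>.\<close>

lemma antideriv_Q_split:
  assumes x: "0 < x" and n: "1 \<le> n"
  defines "c \<equiv> real n * (1 + x)"
  shows "antideriv_Q x n a = 1 / (1 + x) * (kol (c * a) + kol ((c + 1 + x) * a) - kol ((c + 1) * a) - kol ((c + x) * a))
     - x / (1 + x) * (kol ((c + 1) * a) / (c + 1) - kol ((c + x) * a) / (c + x))"
proof -
  have c: "0 < c" using x n by (simp add: c_def)
  have r: "1 + x \<noteq> 0" "c + 1 \<noteq> 0" "c + x \<noteq> 0" using x c by auto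
  have nc: "real n = c / (1 + x)" using r by (simp add: c_def)
  have c1: "(real n + 1) * (1 + x) = c + 1 + x" by (simp add: c_def algebra_simps)
  have plus: "(p + x) / (q * p) = 1 / q + x / q * (1 / p)" and minus: "(p - x) / (q * p) = 1 / q - x / q * (1 / p)"
    if "q \<noteq> 0" "p \<noteq> 0" for p q using that by (simp_all add: add_divide_distrib diff_divide_distrib)
  have e1: "(real n + 1) / (c + 1) = 1 / (1 + x) + x / (1 + x) * (1 / (c + 1))"
  proof -
    have "(real n + 1) / (c + 1) = ((c + 1) + x) / ((1 + x) * (c + 1))" unfolding nc using r by (simp add: field_simps)
    also have "\<dots> = 1 / (1 + x) + x / (1 + x) * (1 / (c + 1))"
      using r(1,2) by (rule plus)
    finally show ?thesis .
  qed
  have e2: "real n / (c + x) = 1 / (1 + x) - x / (1 + x) * (1 / (c + x))"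
  proof -
    have "real n / (c + x) = ((c + x) - x) / ((1 + x) * (c + x))" unfolding nc using r by (simp add: field_simps)
    also have "\<dots> = 1 / (1 + x) - x / (1 + x) * (1 / (c + x))"
      using r(1,3) by (rule minus)
    finally show ?thesis .
  qed
  show ?thesis
    unfolding antideriv_Q_def c1 c_def[symmetric] e1 e2
    by (simp add: distrib_right left_diff_distrib right_diff_distrib distrib_left)
qed

text \<open>The bound \<open>4 * kol (real n * a)\<close> is useless as \<open>a\<close> tends to 0,
  so domination rests on the two uniform difference estimates.\<close>

lemma antideriv_Q_limit_0:
  assumes x: "0 < x" and b: "b \<longlonglongrightarrow> 0" "\<And>i. 0 < b i"
  shows "(\<lambda>i. \<Sum>n. antideriv_Q x n (b i)) \<longlonglongrightarrow> (\<Sum>n. antideriv_Q x n 0)"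
proof (rule tannery_sequentially)
  let ?C = "1 / (1 + x) * (x * 8) + x / (1 + x) * (\<bar>1 - x\<bar> * 3)"
  have C: "0 \<le> ?C" using x by (intro add_nonneg_nonneg mult_nonneg_nonneg) auto
  show "summable (\<lambda>n. (4 + 4 * ?C) / (real n + 1)\<^sup>2)" by (rule summable_inverse_square)
  show "\<bar>antideriv_Q x n (b i)\<bar> \<le> (4 + 4 * ?C) / (real n + 1)\<^sup>2" for n i
  proof (cases "n = 0")
    case True
    have "\<bar>antideriv_Q x 0 (b i)\<bar> \<le> 4" using abs_antideriv_Q_le[OF x less_imp_le[OF b(2)[of i]], of 0] by simp
    then show ?thesis using True C by simp
  next
    case False
    then have n: "1 \<le> n" by simp
    let ?c = "real n * (1 + x)"
    have c: "0 < ?c" "real n \<le> ?c" using n x mult_left_mono[of 1 "1 + x" "real n"] by (auto intro: mult_pos_pos)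
    have cn: "1 / ?c\<^sup>2 \<le> 1 / (real n)\<^sup>2" using c n by (intro divide_left_mono power_mono) auto
    let ?A = "kol (?c * b i) + kol ((?c + 1 + x) * b i) - kol ((?c + 1) * b i) - kol ((?c + x) * b i)"
    let ?B = "kol ((?c + 1) * b i) / (?c + 1) - kol ((?c + x) * b i) / (?c + x)"
    have A: "\<bar>?A\<bar> \<le> x * (8 / ?c\<^sup>2)" by (rule kol_second_difference[OF c(1) x])
    have B: "\<bar>?B\<bar> \<le> \<bar>1 - x\<bar> * (3 / ?c\<^sup>2)"
      using kol_quotient_difference[OF c(1), of "?c + 1" "?c + x" "b i"] x by simp
    have "\<bar>antideriv_Q x n (b i)\<bar> \<le> \<bar>1 / (1 + x) * ?A\<bar> + \<bar>x / (1 + x) * ?B\<bar>"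
      unfolding antideriv_Q_split[OF x n] by (rule abs_triangle_ineq4)
    also have "\<dots> = 1 / (1 + x) * \<bar>?A\<bar> + x / (1 + x) * \<bar>?B\<bar>" using x by (simp add: abs_mult)
    also have "\<dots> \<le> 1 / (1 + x) * (x * (8 / ?c\<^sup>2)) + x / (1 + x) * (\<bar>1 - x\<bar> * (3 / ?c\<^sup>2))"
      using A B x by (intro add_mono mult_left_mono) auto
    also have "\<dots> = ?C * (1 / ?c\<^sup>2)"
    proof -
      have "A * (X * (8 / D)) + B * (Y * (3 / D)) = (A * (X * 8) + B * (Y * 3)) * (1 / D)" for A B X Y D :: real
        by (simp add: add_divide_distrib)
      then show ?thesis .
    qed
    also have "\<dots> \<le> ?C * (4 / (real n + 1)\<^sup>2)" using C cn inverse_square_shift[OF n] by (intro mult_left_mono) auto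
    also have "\<dots> = (4 * ?C) / (real n + 1)\<^sup>2" by simp
    also have "\<dots> \<le> (4 + 4 * ?C) / (real n + 1)\<^sup>2" by (intro divide_right_mono) auto
    finally show ?thesis .
  qed
  show "(\<lambda>i. antideriv_Q x n (b i)) \<longlonglongrightarrow> antideriv_Q x n 0" for n
  proof -
    have "isCont (antideriv_Q x n) 0" unfolding antideriv_Q_def[abs_def] kol_def by (intro continuous_intros)
    then show ?thesis using b(1) by (rule isCont_tendsto_compose)
  qed
qed

text \<open>At \<open>a = 0\<close> the second difference vanishes and only the partial fractions of
  the cotangent remain. The index 0 is checked separately because the splitting assumes
  \<open>n \<ge> 1\<close>.\<close>

lemma antideriv_Q_sum:
  assumes x: "0 < x"
  shows "1 / (1 + x) - (\<Sum>n. antideriv_Q x n 0) = 1 / (x + 1) * (1 - pi * x * cot (pi * x / (x + 1)) / (x + 1))"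
proof -
  have "antideriv_Q x n 0 = - (x / (1 + x)) * (1 / (real n * (1 + x) + 1) - 1 / (real n * (1 + x) + x))" if "1 \<le> n" for n
    using antideriv_Q_split[OF x that, of 0] by simp
  moreover have "antideriv_Q x 0 0 = - (x / (1 + x)) * (1 / (real 0 * (1 + x) + 1) - 1 / (real 0 * (1 + x) + x))"
  proof -
    have "1 / (1 + x) + x / (1 + x) = 1" "x / (1 + x) * (1 / x) = 1 / (1 + x)" using x by (simp_all flip: add_divide_distrib)
    moreover have "antideriv_Q x 0 0 = 2 * (1 / (1 + x)) - 1" by (simp add: antideriv_Q_def)
    moreover have "- (x / (1 + x)) * (1 / (real 0 * (1 + x) + 1) - 1 / (real 0 * (1 + x) + x)) = x / (1 + x) * (1 / x) - x / (1 + x)"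
      by (simp only: right_diff_distrib) simp
    ultimately show ?thesis by linarith
  qed
  ultimately have e: "antideriv_Q x n 0 = - (x / (1 + x)) * (1 / (real n * (1 + x) + 1) - 1 / (real n * (1 + x) + x))" for n
    by (cases "n = 0") auto
  have "(\<lambda>n. antideriv_Q x n 0) sums (- (x / (1 + x)) * (- pi / (1 + x) * cot (pi * x / (1 + x))))"
    unfolding e by (intro sums_mult cot_partial_fraction x)
  then have "(\<Sum>n. antideriv_Q x n 0) = x / (1 + x) * (pi / (1 + x) * cot (pi * x / (1 + x)))" by (simp add: sums_iff)
  then show ?thesis by (simp add: add.commute[of 1] right_diff_distrib mult_ac)
qed

subsection \<open>The laws of K, L and Q\<close>

lemma range_cdf_commute: "range_cdf a b = range_cdf b a"
proof -
  have "kterm n a b = kterm n b a" for n by (simp add: kterm_def add.commute)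
  then show ?thesis by (simp add: range_cdf_def)
qed

lemma range_cdf_tendsto_0:
  assumes "0 < b" shows "((\<lambda>a. range_cdf a b) \<longlongrightarrow> 0) (at_right 0)"
proof -
  have "continuous (at 0 within {0..}) (\<lambda>a. range_cdf a b)"
    by (rule DERIV_continuous[OF DERIV_range_cdf_within[OF assms order_refl]])
  then have "((\<lambda>a. range_cdf a b) \<longlongrightarrow> range_cdf 0 b) (at 0 within {0..})" by (simp add: continuous_within)
  then have "((\<lambda>a. range_cdf a b) \<longlongrightarrow> range_cdf 0 b) (at_right 0)" by (rule tendsto_within_subset) auto
  moreover have "range_cdf 0 b = 0" by (simp add: range_cdf_def range_cdf_at_0)
  ultimately show ?thesis by simp
qed

lemma (in prob_space) cdf_distr_eq:
  "X \<in> borel_measurable M \<Longrightarrow> cdf (distr M borel X) x = prob {\<omega>\<in>space M. X \<omega> \<le> x}"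
  unfolding cdf_def by (subst measure_distr) (auto simp: vimage_def Int_def conj_commute)

text \<open>The event \<open>A \<le> 0\<close>, \<open>B \<le> n + 1\<close> has probability at most
  \<open>range_cdf a (n + 1)\<close> for every \<open>a > 0\<close>, hence 0; these events exhaust
  \<open>A \<le> 0\<close>. The shift by 1 keeps the second argument positive.\<close>

lemma (in prob_space) AE_pos_of_joint_cdf:
  fixes A B :: "'a \<Rightarrow> real"
  assumes [measurable]: "A \<in> borel_measurable M" "B \<in> borel_measurable M"
    and cdf: "\<And>a b. 0 < a \<Longrightarrow> 0 < b \<Longrightarrow> prob {\<omega>\<in>space M. A \<omega> \<le> a \<and> B \<omega> \<le> b} = range_cdf a b"
  shows "AE \<omega> in M. 0 < A \<omega>"
proof -
  have "prob {\<omega>\<in>space M. A \<omega> \<le> 0 \<and> B \<omega> \<le> real n + 1} = 0" for n :: nat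
  proof -
    have "prob {\<omega>\<in>space M. A \<omega> \<le> 0 \<and> B \<omega> \<le> real n + 1} \<le> 0"
    proof (rule tendsto_lowerbound[OF range_cdf_tendsto_0])
      show "\<forall>\<^sub>F a in at_right 0. prob {\<omega>\<in>space M. A \<omega> \<le> 0 \<and> B \<omega> \<le> real n + 1} \<le> range_cdf a (real n + 1)"
        using eventually_at_right_less[of 0]
      proof eventually_elim
        case (elim a)
        then show ?case by (subst cdf[symmetric]) (auto intro!: finite_measure_mono)
      qed
    qed simp_all
    then show ?thesis using measure_nonneg[of M] by (simp add: antisym)
  qed
  then have "AE \<omega> in M. \<not> (A \<omega> \<le> 0 \<and> B \<omega> \<le> real n + 1)" for n :: nat
    by (subst AE_iff_measurable[OF _ refl]) (auto simp: emeasure_eq_measure)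
  then have "AE \<omega> in M. \<forall>n::nat. \<not> (A \<omega> \<le> 0 \<and> B \<omega> \<le> real n + 1)" unfolding AE_all_countable by (rule allI)
  then show ?thesis
  proof eventually_elim
    case (elim \<omega>)
    obtain n :: nat where "B \<omega> \<le> real n" using real_arch_simple by blast
    then have "B \<omega> \<le> real n + 1" by simp
    with spec[OF elim, of n] show ?case by (auto simp: not_le)
  qed
qed

context brownian_bridge
begin

lemma prob_range: "0 < a \<Longrightarrow> 0 < b \<Longrightarrow> prob {\<omega>\<in>space M. Mminus U \<omega> \<le> a \<and> Mplus U \<omega> \<le> b} = range_cdf a b"
  using joint_law[of a b] by (simp add: range_cdf_def sums_iff)

lemma AE_Mminus_pos: "AE \<omega> in M. 0 < Mminus U \<omega>"
  using prob_range by (rule AE_pos_of_joint_cdf[rotated 2]) simp_all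

lemma AE_Mplus_pos: "AE \<omega> in M. 0 < Mplus U \<omega>"
proof (rule AE_pos_of_joint_cdf[where B="Mminus U"])
  show "prob {\<omega>\<in>space M. Mplus U \<omega> \<le> a \<and> Mminus U \<omega> \<le> b} = range_cdf a b" if "0 < a" "0 < b" for a b
    using prob_range[OF that(2,1)] by (simp add: conj_commute range_cdf_commute[of a b])
qed simp_all

text \<open>The curve formula holds on compact pieces inside the open interval \<open>J\<close>;
  exhausting \<open>J\<close> turns the end-point values of the primitive into limits.\<close>

lemma prob_curve:
  assumes [measurable]: "Measurable.pred M Pr"
    and J: "open J" "is_interval J" "J \<subseteq> {0<..}" and \<phi>: "continuous_on J \<phi>" "\<And>a. a \<in> J \<Longrightarrow> 0 < \<phi> a"
    and sandwich: "\<And>p q. p \<in> J \<Longrightarrow> q \<in> J \<Longrightarrow> p < q \<Longrightarrow> \<exists>u\<in>{\<phi> p, \<phi> q}. \<exists>v\<in>{\<phi> p, \<phi> q}.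
        \<forall>\<omega>\<in>space M. p < Mminus U \<omega> \<longrightarrow> Mminus U \<omega> \<le> q \<longrightarrow> (Mplus U \<omega> \<le> u \<longrightarrow> Pr \<omega>) \<and> (Pr \<omega> \<longrightarrow> Mplus U \<omega> \<le> v)"
    and H: "\<And>a. a \<in> J \<Longrightarrow> (H has_real_derivative range_cdf_deriv a (\<phi> a)) (at a)"
    and seq: "\<And>n. \<alpha> n \<in> J" "\<And>n. \<beta> n \<in> J" "\<And>n. \<alpha> n < \<beta> n" "decseq \<alpha>" "incseq \<beta>"
    and cover: "\<And>a. a \<in> J \<Longrightarrow> \<exists>n. \<alpha> n < a \<and> a \<le> \<beta> n"
    and lim: "(\<lambda>n. H (\<beta> n) - H (\<alpha> n)) \<longlonglongrightarrow> p"
  shows "prob {\<omega>\<in>space M. Mminus U \<omega> \<in> J \<and> Pr \<omega>} = p"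
proof -
  let ?E = "\<lambda>n. {\<omega>\<in>space M. \<alpha> n < Mminus U \<omega> \<and> Mminus U \<omega> \<le> \<beta> n \<and> Pr \<omega>}"
  have "prob (?E n) = H (\<beta> n) - H (\<alpha> n)" for n
    by (rule prob_below_curve[OF measurable_Mminus measurable_Mplus assms(1) prob_range DERIV_range_cdf[rotated]
          continuous_range_cdf_deriv J \<phi> sandwich H seq(1,2,3)])
  moreover have "(\<lambda>n. prob (?E n)) \<longlonglongrightarrow> prob (\<Union>n. ?E n)"
  proof (rule finite_Lim_measure_incseq)
    show "incseq ?E"
    proof (rule incseq_SucI, rule subsetI)
      fix n \<omega> assume "\<omega> \<in> ?E n"
      then show "\<omega> \<in> ?E (Suc n)"
        using decseq_SucD[OF seq(4), of n] incseq_SucD[OF seq(5), of n] by auto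
    qed
  qed auto
  moreover have "(\<Union>n. ?E n) = {\<omega>\<in>space M. Mminus U \<omega> \<in> J \<and> Pr \<omega>}"
  proof (intro equalityI subsetI)
    fix \<omega> assume "\<omega> \<in> (\<Union>n. ?E n)"
    then obtain n where n: "\<omega> \<in> ?E n" by blast
    then have "Mminus U \<omega> \<in> J" using mem_is_interval_1_I[OF J(2) seq(1)[of n] seq(2)[of n], of "Mminus U \<omega>"] by simp
    then show "\<omega> \<in> {\<omega>\<in>space M. Mminus U \<omega> \<in> J \<and> Pr \<omega>}" using n by simp
  next
    fix \<omega> assume \<omega>: "\<omega> \<in> {\<omega>\<in>space M. Mminus U \<omega> \<in> J \<and> Pr \<omega>}"
    then obtain n where "\<alpha> n < Mminus U \<omega> \<and> Mminus U \<omega> \<le> \<beta> n" using cover[of "Mminus U \<omega>"] by blast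
    then show "\<omega> \<in> (\<Union>n. ?E n)" using \<omega> by blast
  qed
  ultimately have "(\<lambda>n. H (\<beta> n) - H (\<alpha> n)) \<longlonglongrightarrow> prob {\<omega>\<in>space M. Mminus U \<omega> \<in> J \<and> Pr \<omega>}" by simp
  then show ?thesis using lim by (rule LIMSEQ_unique)
qed

lemma prob_K:
  assumes x: "0 < x"
  shows "prob {\<omega>\<in>space M. Mplus U \<omega> + Mminus U \<omega> \<le> x} = (\<Sum>n. antideriv_K x n x)"
proof -
  define H where "H a = (\<Sum>n. antideriv_K x n a)" for a
  \<comment> \<open>The shift by 3 keeps \<open>?\<alpha> n\<close> below \<open>x / 2\<close> and
    thus below \<open>?\<beta> n\<close> already for \<open>n = 0\<close>.\<close>
  let ?\<alpha> = "\<lambda>n. x / (real n + 3)" and ?\<beta> = "\<lambda>n. x - x / (real n + 3)"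
  have der: "(H has_real_derivative range_cdf_deriv a (x - a)) (at a within {0..x})" if "a \<in> {0..x}" for a
    using antideriv_K(2)[OF x that] by (simp add: H_def[abs_def])
  then have cont: "continuous_on {0..x} H" by (rule DERIV_continuous_on)
  have \<alpha>: "0 < ?\<alpha> n" for n using x by simp
  have \<alpha>2: "?\<alpha> n < x / 2" for n by (intro divide_strict_left_mono) (use x in simp_all)
  have \<alpha>\<beta>: "?\<alpha> n \<in> {0..x}" "?\<beta> n \<in> {0..x}" for n
    unfolding atLeastAtMost_iff using \<alpha>[of n] \<alpha>2[of n] by linarith+
  have l0: "?\<alpha> \<longlonglongrightarrow> 0" by real_asymp
  have "prob {\<omega>\<in>space M. Mminus U \<omega> \<in> {0<..<x} \<and> Mplus U \<omega> \<le> x - Mminus U \<omega>} = H x"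
  proof (rule prob_curve[where H=H and \<phi>="\<lambda>a. x - a" and \<alpha>="?\<alpha>" and \<beta>="?\<beta>"])
    show "(H has_real_derivative range_cdf_deriv a (x - a)) (at a)" if "a \<in> {0<..<x}" for a
    proof -
      have "a \<in> interior {0..x}" using that by simp
      then show ?thesis using der[of a] that by (simp only: at_within_interior) simp
    qed
    \<comment> \<open>The curve decreases, so the right end point supplies the lower height.\<close>
    show "\<exists>u\<in>{x - p, x - q}. \<exists>v\<in>{x - p, x - q}. \<forall>\<omega>\<in>space M. p < Mminus U \<omega> \<longrightarrow> Mminus U \<omega> \<le> q \<longrightarrow>
        (Mplus U \<omega> \<le> u \<longrightarrow> Mplus U \<omega> \<le> x - Mminus U \<omega>) \<and> (Mplus U \<omega> \<le> x - Mminus U \<omega> \<longrightarrow> Mplus U \<omega> \<le> v)" for p q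
      by (rule bexI[of _ "x - q"], rule bexI[of _ "x - p"]) auto
    show "?\<alpha> n \<in> {0<..<x}" "?\<beta> n \<in> {0<..<x}" "?\<alpha> n < ?\<beta> n" for n
      unfolding greaterThanLessThan_iff using \<alpha>[of n] \<alpha>2[of n] by linarith+
    show "decseq ?\<alpha>" "incseq ?\<beta>" using x by (auto simp: decseq_def incseq_def intro!: divide_left_mono)
    show "\<exists>n. ?\<alpha> n < a \<and> a \<le> ?\<beta> n" if "a \<in> {0<..<x}" for a
    proof -
      have "eventually (\<lambda>n. ?\<alpha> n < min a (x - a)) sequentially" using that by (intro order_tendstoD(2)[OF l0]) auto
      then obtain n where "?\<alpha> n < min a (x - a)" by (auto dest: eventually_happens'[OF sequentially_bot])
      then show ?thesis by (intro exI[of _ n]) auto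
    qed
    have "(\<lambda>n. H (?\<beta> n)) \<longlonglongrightarrow> H x"
    proof (rule continuous_on_tendsto_compose[OF cont])
      show "?\<beta> \<longlonglongrightarrow> x" using tendsto_diff[OF tendsto_const[of x] l0] by simp
      show "\<forall>\<^sub>F n in sequentially. ?\<beta> n \<in> {0..x}" by (intro always_eventually allI \<alpha>\<beta>)
    qed (use x in simp)
    moreover have "(\<lambda>n. H (?\<alpha> n)) \<longlonglongrightarrow> H 0"
    proof (rule continuous_on_tendsto_compose[OF cont l0])
      show "\<forall>\<^sub>F n in sequentially. ?\<alpha> n \<in> {0..x}" by (intro always_eventually allI \<alpha>\<beta>)
    qed (use x in simp)
    moreover have "H 0 = 0" by (simp add: H_def antideriv_K_def)
    ultimately show "(\<lambda>n. H (?\<beta> n) - H (?\<alpha> n)) \<longlonglongrightarrow> H x" using tendsto_diff by fastforce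
  qed (auto intro!: continuous_intros simp: is_interval_convex_1)
  moreover have "prob {\<omega>\<in>space M. Mminus U \<omega> \<in> {0<..<x} \<and> Mplus U \<omega> \<le> x - Mminus U \<omega>} = prob {\<omega>\<in>space M. Mplus U \<omega> + Mminus U \<omega> \<le> x}"
  proof (rule finite_measure_eq_AE)
    \<comment> \<open>Since both extrema are positive, a sum of at most \<open>x\<close> forces
      \<open>Mminus\<close> into \<open>(0, x)\<close>.\<close>
    show "AE \<omega> in M. (\<omega> \<in> {\<omega>\<in>space M. Mminus U \<omega> \<in> {0<..<x} \<and> Mplus U \<omega> \<le> x - Mminus U \<omega>}) = (\<omega> \<in> {\<omega>\<in>space M. Mplus U \<omega> + Mminus U \<omega> \<le> x})"
      using AE_Mminus_pos AE_Mplus_pos by eventually_elim auto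
  qed measurable
  ultimately show ?thesis by (simp add: H_def)
qed

lemma prob_curve_ray:
  assumes [measurable]: "Measurable.pred M Pr"
    and \<phi>: "continuous_on {0<..} \<phi>" "\<And>a. 0 < a \<Longrightarrow> 0 < \<phi> a"
    and sandwich: "\<And>p q. 0 < p \<Longrightarrow> p < q \<Longrightarrow> \<exists>u\<in>{\<phi> p, \<phi> q}. \<exists>v\<in>{\<phi> p, \<phi> q}.
        \<forall>\<omega>\<in>space M. p < Mminus U \<omega> \<longrightarrow> Mminus U \<omega> \<le> q \<longrightarrow> (Mplus U \<omega> \<le> u \<longrightarrow> Pr \<omega>) \<and> (Pr \<omega> \<longrightarrow> Mplus U \<omega> \<le> v)"
    and H: "\<And>a. 0 < a \<Longrightarrow> (H has_real_derivative range_cdf_deriv a (\<phi> a)) (at a)"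
    and lim: "(\<lambda>n. H (1 / (real n + 1))) \<longlonglongrightarrow> h0" "(\<lambda>n. H (real n + 2)) \<longlonglongrightarrow> h1"
  shows "prob {\<omega>\<in>space M. Pr \<omega>} = h1 - h0"
proof -
  let ?\<alpha> = "\<lambda>n. 1 / (real n + 1)" and ?\<beta> = "\<lambda>n. real n + 2"
  have l0: "?\<alpha> \<longlonglongrightarrow> 0" by real_asymp
  have "prob {\<omega>\<in>space M. Mminus U \<omega> \<in> {0<..} \<and> Pr \<omega>} = h1 - h0"
  proof (rule prob_curve[where H=H and \<phi>=\<phi> and \<alpha>="?\<alpha>" and \<beta>="?\<beta>"])
    show "?\<alpha> n < ?\<beta> n" for n
    proof -
      have "?\<alpha> n \<le> 1" by simp
      then show ?thesis by linarith
    qed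
    show "decseq ?\<alpha>" "incseq ?\<beta>" by (auto simp: decseq_def incseq_def intro!: divide_left_mono)
    show "\<exists>n. ?\<alpha> n < a \<and> a \<le> ?\<beta> n" if "a \<in> {0<..}" for a
    proof -
      have "eventually (\<lambda>n. ?\<alpha> n < a) sequentially" using that by (intro order_tendstoD(2)[OF l0]) auto
      moreover have "eventually (\<lambda>n. real n \<ge> a) sequentially" by real_asymp
      ultimately have "eventually (\<lambda>n. ?\<alpha> n < a \<and> a \<le> ?\<beta> n) sequentially" by eventually_elim auto
      then show ?thesis by (rule eventually_happens'[OF sequentially_bot])
    qed
    show "(\<lambda>n. H (?\<beta> n) - H (?\<alpha> n)) \<longlonglongrightarrow> h1 - h0" using lim by (intro tendsto_diff)
    show "\<exists>u\<in>{\<phi> p, \<phi> q}. \<exists>v\<in>{\<phi> p, \<phi> q}. \<forall>\<omega>\<in>space M. p < Mminus U \<omega> \<longrightarrow> Mminus U \<omega> \<le> q \<longrightarrow>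
        (Mplus U \<omega> \<le> u \<longrightarrow> Pr \<omega>) \<and> (Pr \<omega> \<longrightarrow> Mplus U \<omega> \<le> v)" if "p \<in> {0<..}" "p < q" for p q
      by (rule sandwich) (use that in simp_all)
  qed (use \<phi> H in \<open>simp_all add: is_interval_convex_1\<close>)
  moreover have "prob {\<omega>\<in>space M. Mminus U \<omega> \<in> {0<..} \<and> Pr \<omega>} = prob {\<omega>\<in>space M. Pr \<omega>}"
  proof (rule finite_measure_eq_AE)
    show "AE \<omega> in M. (\<omega> \<in> {\<omega>\<in>space M. Mminus U \<omega> \<in> {0<..} \<and> Pr \<omega>}) = (\<omega> \<in> {\<omega>\<in>space M. Pr \<omega>})"
      using AE_Mminus_pos by eventually_elim auto
  qed measurable
  ultimately show ?thesis by simp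
qed

text \<open>Leaving open whether the inequality is strict gives both \<open>P(L < x)\<close> and \<open>P(L \<le> x)\<close>.\<close>

lemma prob_L:
  assumes x: "0 < x" and [measurable]: "Measurable.pred M Pr"
    and Pr: "\<And>\<omega>. \<omega> \<in> space M \<Longrightarrow> Mplus U \<omega> - Mminus U \<omega> < x \<Longrightarrow> Pr \<omega>" "\<And>\<omega>. \<omega> \<in> space M \<Longrightarrow> Pr \<omega> \<Longrightarrow> Mplus U \<omega> - Mminus U \<omega> \<le> x"
  shows "prob {\<omega>\<in>space M. Pr \<omega>} = (\<Sum>n. (if n = 0 then 1 / 2 else 0) - antideriv_L0 x n 0)"
proof -
  define H where "H a = (\<Sum>n. antideriv_L x n a)" for a
  have der: "(H has_real_derivative range_cdf_deriv a (a + x)) (at a within {0..})" if "0 \<le> a" for a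
    using antideriv_L[OF x that] by (simp add: H_def[abs_def])
  have "prob {\<omega>\<in>space M. Pr \<omega>} = (\<Sum>n. (if n = 0 then 1 / 2 else 0) - antideriv_L0 x n 0) - H 0"
  proof (rule prob_curve_ray[where H=H and \<phi>="\<lambda>a. a + x"])
    show "(H has_real_derivative range_cdf_deriv a (a + x)) (at a)" if "0 < a" for a
    proof -
      have "a \<in> interior {0..}" using that by simp
      then show ?thesis using der[of a] less_imp_le[OF that] by (simp only: at_within_interior)
    qed
    \<comment> \<open>From \<open>p < Mminus\<close> the height \<open>p + x\<close> yields even the
      strict inequality, which is all that is known to imply \<open>Pr\<close>.\<close>
    show "\<exists>u\<in>{p + x, q + x}. \<exists>v\<in>{p + x, q + x}. \<forall>\<omega>\<in>space M. p < Mminus U \<omega> \<longrightarrow> Mminus U \<omega> \<le> q \<longrightarrow>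
        (Mplus U \<omega> \<le> u \<longrightarrow> Pr \<omega>) \<and> (Pr \<omega> \<longrightarrow> Mplus U \<omega> \<le> v)" for p q
      by (rule bexI[of _ "p + x"], rule bexI[of _ "q + x"]) (use Pr in fastforce)+
    have "filterlim (\<lambda>n. real n + 2) at_top sequentially" by real_asymp
    then show "(\<lambda>n. H (real n + 2)) \<longlonglongrightarrow> (\<Sum>n. (if n = 0 then 1 / 2 else 0) - antideriv_L0 x n 0)"
      unfolding H_def by (intro antideriv_L_limit[OF x]) auto
    have "(\<lambda>n. 1 / (real n + 1)) \<longlonglongrightarrow> 0" by real_asymp
    then show "(\<lambda>n. H (1 / (real n + 1))) \<longlonglongrightarrow> H 0"
    proof (rule continuous_on_tendsto_compose[rotated])
      show "continuous_on {0..} H" using der by (intro DERIV_continuous_on) auto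
    qed auto
  qed (use x in \<open>auto intro!: continuous_intros\<close>)
  moreover have "H 0 = 0" by (simp add: H_def antideriv_L_def)
  ultimately show ?thesis by simp
qed

lemma prob_Q:
  assumes x: "0 < x"
  shows "prob {\<omega>\<in>space M. bridge_Q U \<omega> \<le> x} = 1 / (1 + x) - (\<Sum>n. antideriv_Q x n 0)"
proof (rule prob_curve_ray[where H="\<lambda>a. \<Sum>n. antideriv_Q x n a" and \<phi>="\<lambda>a. x * a"])
  show "Measurable.pred M (\<lambda>\<omega>. bridge_Q U \<omega> \<le> x)" unfolding bridge_Q_def by measurable
  show "\<exists>u\<in>{x * p, x * q}. \<exists>v\<in>{x * p, x * q}. \<forall>\<omega>\<in>space M. p < Mminus U \<omega> \<longrightarrow> Mminus U \<omega> \<le> q \<longrightarrow>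
      (Mplus U \<omega> \<le> u \<longrightarrow> bridge_Q U \<omega> \<le> x) \<and> (bridge_Q U \<omega> \<le> x \<longrightarrow> Mplus U \<omega> \<le> v)" if "0 < p" for p q
  proof (rule bexI[of _ "x * p"], rule bexI[of _ "x * q"], intro ballI impI)
    fix \<omega> assume h: "p < Mminus U \<omega>" "Mminus U \<omega> \<le> q"
    have "x * p \<le> x * Mminus U \<omega>" "x * Mminus U \<omega> \<le> x * q" using h x by (auto intro: mult_left_mono)
    \<comment> \<open>Only paths with \<open>Mminus\<close> above \<open>p > 0\<close> occur here,
      so the value of division by 0 has no influence.\<close>
    moreover have "bridge_Q U \<omega> \<le> x \<longleftrightarrow> Mplus U \<omega> \<le> x * Mminus U \<omega>" using h that by (simp add: bridge_Q_def pos_divide_le_eq)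
    ultimately show "(Mplus U \<omega> \<le> x * p \<longrightarrow> bridge_Q U \<omega> \<le> x) \<and> (bridge_Q U \<omega> \<le> x \<longrightarrow> Mplus U \<omega> \<le> x * q)" by linarith
  qed auto
  have "filterlim (\<lambda>n. real n + 2) at_top sequentially" by real_asymp
  then show "(\<lambda>n. \<Sum>k. antideriv_Q x k (real n + 2)) \<longlonglongrightarrow> 1 / (1 + x)"
    by (intro antideriv_Q_limit_top[OF x]) auto
  have "(\<lambda>n. 1 / (real n + 1)) \<longlonglongrightarrow> 0" by real_asymp
  then show "(\<lambda>n. \<Sum>k. antideriv_Q x k (1 / (real n + 1))) \<longlonglongrightarrow> (\<Sum>k. antideriv_Q x k 0)"
    by (intro antideriv_Q_limit_0[OF x]) simp_all
qed (use x antideriv_Q in \<open>auto intro!: continuous_intros\<close>)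

lemma measurable_bridge_functionals [measurable]:
  "bridge_K U \<in> borel_measurable M" "bridge_L U \<in> borel_measurable M" "bridge_Q U \<in> borel_measurable M"
  unfolding bridge_K_def[abs_def] bridge_L_def[abs_def] bridge_Q_def[abs_def] by measurable

lemma law_K:
  assumes x: "0 < x"
  shows "cdf (distr M borel (bridge_K U)) x = prob {\<omega>\<in>space M. Mplus U \<omega> + Mminus U \<omega> \<le> x}"
    and "((\<lambda>k::int. (1 - 4 * (of_int k)\<^sup>2 * x\<^sup>2) * exp (- 2 * (of_int k)\<^sup>2 * x\<^sup>2))
      has_sum prob {\<omega>\<in>space M. Mplus U \<omega> + Mminus U \<omega> \<le> x}) UNIV"
  using antideriv_K_sum[OF x] by (simp_all only: prob_K[OF x] cdf_distr_eq measurable_bridge_functionals) (simp_all add: bridge_K_def prob_K[OF x])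

lemma law_L:
  assumes x: "0 < x"
  shows "1 - cdf (distr M borel (bridge_L U)) x = prob {\<omega>\<in>space M. Mplus U \<omega> - Mminus U \<omega> \<ge> x}"
    and "((\<lambda>k::nat. 1 / (4 * (real k)\<^sup>2 - 1) * exp (- 2 * (real k)\<^sup>2 * x\<^sup>2))
      has_sum prob {\<omega>\<in>space M. Mplus U \<omega> - Mminus U \<omega> \<ge> x}) {1..}"
proof -
  let ?p = "\<Sum>n. (if n = 0 then 1 / 2 else 0) - antideriv_L0 x n 0"
  have le: "prob {\<omega>\<in>space M. Mplus U \<omega> - Mminus U \<omega> \<le> x} = ?p" by (rule prob_L[OF x]) auto
  \<comment> \<open>The same value as for \<open>\<le>\<close>: the law has no atom at
    \<open>x\<close>, which reconciles \<open>1 - F\<close> with the probability of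
    \<open>\<ge>\<close>.\<close>
  have less: "prob {\<omega>\<in>space M. Mplus U \<omega> - Mminus U \<omega> < x} = ?p" by (rule prob_L[OF x]) auto
  have "prob {\<omega>\<in>space M. \<not> Mplus U \<omega> - Mminus U \<omega> < x} = 1 - ?p"
    using less by (subst prob_neg) auto
  then have ge: "prob {\<omega>\<in>space M. Mplus U \<omega> - Mminus U \<omega> \<ge> x} = 1 - ?p" by (simp add: not_less)
  have "cdf (distr M borel (bridge_L U)) x = ?p"
    unfolding cdf_distr_eq[OF measurable_bridge_functionals(2)] using le by (simp add: bridge_L_def)
  then show "1 - cdf (distr M borel (bridge_L U)) x = prob {\<omega>\<in>space M. Mplus U \<omega> - Mminus U \<omega> \<ge> x}" using ge by simp
  show "((\<lambda>k::nat. 1 / (4 * (real k)\<^sup>2 - 1) * exp (- 2 * (real k)\<^sup>2 * x\<^sup>2))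
      has_sum prob {\<omega>\<in>space M. Mplus U \<omega> - Mminus U \<omega> \<ge> x}) {1..}"
    unfolding ge by (rule antideriv_L_sum[OF x])
qed

end

subsection \<open>Mixing with a Gamma variable\<close>

lemma std_normal_cdf_DERIV:
  "(cdf std_normal_distribution has_real_derivative std_normal_density u) (at u)"
proof -
  interpret N: real_distribution std_normal_distribution by (rule real_dist_normal_dist)
  let ?a = "u - 1" and ?b = "u + 1"
  have cont: "continuous_on {?a..?b} std_normal_density"
    unfolding std_normal_density_def[abs_def] by (intro continuous_intros) auto
  have eq: "cdf std_normal_distribution y = cdf std_normal_distribution ?a + integral {?a..y} std_normal_density"
    if "?a < y" for y
  proof -
    have "cdf std_normal_distribution y - cdf std_normal_distribution ?a = measure std_normal_distribution {?a<..y}"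
      using N.cdf_diff_eq[OF that] by simp
    also have "\<dots> = (\<integral>x. indicator {?a<..y} x \<partial>std_normal_distribution)" by simp
    also have "\<dots> = (\<integral>x. std_normal_density x * indicator {?a<..y} x \<partial>lborel)"
      by (subst integral_density) auto
    also have "\<dots> = (\<integral>x. indicator {?a..y} x *\<^sub>R std_normal_density x \<partial>lborel)"
      by (intro integral_cong_AE) (use AE_lborel_singleton[of ?a] in \<open>auto simp: indicator_def elim!: eventually_mono\<close>)
    also have "\<dots> = integral {?a..y} std_normal_density"
    proof -
      have "set_integrable lborel {?a..y} std_normal_density"
        unfolding set_integrable_def by (intro integrable_mult_indicator) auto
      from set_borel_integral_eq_integral(2)[OF this] show ?thesis by (simp add: set_lebesgue_integral_def)
    qed
    finally show ?thesis by simp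
  qed
  have "((\<lambda>y. integral {?a..y} std_normal_density) has_real_derivative std_normal_density u) (at u within {?a..?b})"
    by (rule integral_has_real_derivative[OF cont]) simp
  moreover have "u \<in> interior {?a..?b}" by simp
  ultimately have "((\<lambda>y. integral {?a..y} std_normal_density) has_real_derivative std_normal_density u) (at u)"
    by (simp only: at_within_interior)
  from DERIV_add[OF DERIV_const[of "cdf std_normal_distribution ?a"] this]
  have "((\<lambda>y. cdf std_normal_distribution ?a + integral {?a..y} std_normal_density) has_real_derivative std_normal_density u) (at u)" by simp
  then show ?thesis
    by (rule has_field_derivative_transform_within_open[of _ _ _ "{?a<..}"]) (simp_all add: eq)
qed

text \<open>With \<open>u = \<surd>(\<theta> x)\<close> and \<open>\<kappa> = \<surd>(c \<theta>)\<close>, a primitive of the integrand is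
  \<open>exp (2 \<kappa>) \<Phi>(\<surd>2 (u + \<kappa> / u)) + exp (- 2 \<kappa>) \<Phi>(\<surd>2 (u - \<kappa> / u))\<close>.\<close>

lemma gamma_half_laplace_inverse:
  assumes \<theta>: "0 < \<theta>" and c: "0 < c"
  shows "integrable lborel (\<lambda>x. gamma_density (1/2) \<theta> x * exp (- c / x))"
    and "(\<integral>x. gamma_density (1/2) \<theta> x * exp (- c / x) \<partial>lborel) = exp (- 2 * sqrt (c * \<theta>))"
proof -
  define \<kappa> where "\<kappa> = sqrt (c * \<theta>)"
  have \<kappa>: "0 < \<kappa>" using \<theta> c by (simp add: \<kappa>_def)
  define \<Phi> where "\<Phi> = cdf std_normal_distribution"
  interpret N: real_distribution std_normal_distribution by (rule real_dist_normal_dist)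
  have \<Phi>D: "(\<Phi> has_real_derivative std_normal_density u) (at u)" for u
    unfolding \<Phi>_def by (rule std_normal_cdf_DERIV)
  have \<Phi>top: "(\<Phi> \<longlongrightarrow> 1) at_top" and \<Phi>bot: "(\<Phi> \<longlongrightarrow> 0) at_bot"
    unfolding \<Phi>_def using N.cdf_lim_at_top_prob N.cdf_lim_at_bot by auto
  let ?u = "\<lambda>x. sqrt (\<theta> * x)"
  let ?p = "\<lambda>x. sqrt 2 * (sqrt (\<theta> * x) + \<kappa> / sqrt (\<theta> * x))" and ?m = "\<lambda>x. sqrt 2 * (sqrt (\<theta> * x) - \<kappa> / sqrt (\<theta> * x))"
  define F where "F x = exp (2 * \<kappa>) * \<Phi> (?p x) + exp (- 2 * \<kappa>) * \<Phi> (?m x)" for x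
  define f where "f x = \<theta> / (sqrt pi * sqrt (\<theta> * x)) * exp (- \<theta> * x) * exp (- c / x)" for x
  have gd: "gamma_density (1/2) \<theta> x * exp (- c / x) = indicator {0<..} x *\<^sub>R f x" for x
  proof (cases "0 < x")
    case True
    then have "(\<theta> * x) powr (1 / 2 - 1) = 1 / sqrt (\<theta> * x)"
      using \<theta> powr_minus[of "\<theta> * x" "1 / 2"] by (simp add: powr_half_sqrt inverse_eq_divide)
    then show ?thesis using True by (simp add: gamma_density_def f_def Gamma_one_half_real)
  qed (simp add: gamma_density_def)
  have FD: "(F has_real_derivative f x) (at x)" if x: "0 < x" for x
  proof -
    let ?U = "sqrt (\<theta> * x)"
    have U: "0 < ?U" "?U\<^sup>2 = \<theta> * x" using x \<theta> by simp_all
    have Up: "((\<lambda>x. sqrt (\<theta> * x)) has_real_derivative \<theta> / (2 * ?U)) (at x)"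
    proof -
      have "0 < \<theta> * x" using x \<theta> by simp
      show ?thesis
        by (rule DERIV_cong[OF DERIV_chain2[OF DERIV_real_sqrt[OF \<open>0 < \<theta> * x\<close>] DERIV_cmult_Id]]) (simp add: inverse_eq_divide)
    qed
    have "?U \<noteq> 0" using x \<theta> by simp
    note kU = DERIV_divide[OF DERIV_const[of \<kappa>] Up \<open>?U \<noteq> 0\<close>]
    have alg: "A + (0 * V - k * A) / (V * V) = A * (1 - k / V\<^sup>2)" "A - (0 * V - k * A) / (V * V) = A * (1 + k / V\<^sup>2)" for A V k :: real
      by (simp_all add: power2_eq_square right_diff_distrib distrib_left mult.commute)
    have pD: "(?p has_real_derivative sqrt 2 * (\<theta> / (2 * ?U) * (1 - \<kappa> / ?U\<^sup>2))) (at x)"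
      by (rule DERIV_cong[OF DERIV_cmult[OF DERIV_add[OF Up kU]]]) (simp only: alg)
    have mD: "(?m has_real_derivative sqrt 2 * (\<theta> / (2 * ?U) * (1 + \<kappa> / ?U\<^sup>2))) (at x)"
      by (rule DERIV_cong[OF DERIV_cmult[OF DERIV_diff[OF Up kU]]]) (simp only: alg)
    have d: "std_normal_density (sqrt 2 * w) = exp (- w\<^sup>2) / (sqrt 2 * sqrt pi)" for w
      by (simp add: std_normal_density_def power_mult_distrib real_sqrt_mult)
    have k2: "\<kappa>\<^sup>2 = c * \<theta>" using c \<theta> by (simp add: \<kappa>_def)
    have sq: "(?U + \<kappa> / ?U)\<^sup>2 = \<theta> * x + c / x + 2 * \<kappa>" "(?U - \<kappa> / ?U)\<^sup>2 = \<theta> * x + c / x - 2 * \<kappa>"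
    proof -
      have "(\<kappa> / ?U)\<^sup>2 = c / x" using U k2 \<theta> x by (simp add: power_divide)
      moreover have "?U * (\<kappa> / ?U) = \<kappa>" by (simp only: times_divide_eq_right nonzero_mult_div_cancel_left[OF \<open>?U \<noteq> 0\<close>])
      ultimately show "(?U + \<kappa> / ?U)\<^sup>2 = \<theta> * x + c / x + 2 * \<kappa>" "(?U - \<kappa> / ?U)\<^sup>2 = \<theta> * x + c / x - 2 * \<kappa>"
        using x \<theta> unfolding power2_sum power2_diff U(2) by (simp_all add: mult.assoc)
    qed
    let ?E = "exp (- (\<theta> * x + c / x)) / (sqrt 2 * sqrt pi)"
    \<comment> \<open>The squares contain \<open>2 \<kappa>\<close> and \<open>- 2 \<kappa>\<close>,
      which the prefactors of \<open>F\<close> compensate; both densities reduce to the same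
      \<open>?E\<close>.\<close>
    have e1: "exp (2 * \<kappa>) * std_normal_density (?p x) = ?E" and e2: "exp (- 2 * \<kappa>) * std_normal_density (?m x) = ?E"
      unfolding d sq times_divide_eq_right exp_add[symmetric] by simp_all
    have "(F has_real_derivative exp (2 * \<kappa>) * (std_normal_density (?p x) * (sqrt 2 * (\<theta> / (2 * ?U) * (1 - \<kappa> / ?U\<^sup>2))))
       + exp (- 2 * \<kappa>) * (std_normal_density (?m x) * (sqrt 2 * (\<theta> / (2 * ?U) * (1 + \<kappa> / ?U\<^sup>2))))) (at x)"
      unfolding F_def[abs_def]
      by (intro DERIV_add DERIV_cmult DERIV_chain2[OF \<Phi>D] pD mD)
    also have "exp (2 * \<kappa>) * (std_normal_density (?p x) * (sqrt 2 * (\<theta> / (2 * ?U) * (1 - \<kappa> / ?U\<^sup>2))))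
       + exp (- 2 * \<kappa>) * (std_normal_density (?m x) * (sqrt 2 * (\<theta> / (2 * ?U) * (1 + \<kappa> / ?U\<^sup>2)))) =
       ?E * (sqrt 2 * (\<theta> / (2 * ?U) * (1 - \<kappa> / ?U\<^sup>2))) + ?E * (sqrt 2 * (\<theta> / (2 * ?U) * (1 + \<kappa> / ?U\<^sup>2)))"
      by (simp only: mult.assoc[symmetric] e1 e2)
    \<comment> \<open>The contributions of \<open>\<kappa> / ?U\<^sup>2\<close> have opposite signs
      and cancel.\<close>
    also have "\<dots> = ?E * (sqrt 2 * (\<theta> / ?U))"
      by (simp only: distrib_left[symmetric]) (simp add: right_diff_distrib distrib_left)
    also have "\<dots> = f x"
      using U by (simp add: f_def exp_add[symmetric] algebra_simps)
    finally show ?thesis .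
  qed
  have fcont: "isCont f x" if "0 < x" for x
    unfolding f_def using that \<theta> by (intro continuous_intros) auto
  have fnn: "0 \<le> f x" if "0 < x" for x using that \<theta> by (simp add: f_def)
  \<comment> \<open>Near 0 the argument \<open>u + \<kappa> / u\<close> tends to infinity and
    \<open>u - \<kappa> / u\<close> to minus infinity. The value at infinity therefore exceeds that
    at 0 by \<open>exp (- 2 * \<kappa>)\<close> alone.\<close>
  have lim0: "(F \<longlongrightarrow> exp (2 * \<kappa>) * 1 + exp (- 2 * \<kappa>) * 0) (at_right 0)"
    unfolding F_def using \<kappa> \<theta>
    by (intro tendsto_intros filterlim_compose[OF \<Phi>top] filterlim_compose[OF \<Phi>bot]) real_asymp+
  have limtop: "(F \<longlongrightarrow> exp (2 * \<kappa>) * 1 + exp (- 2 * \<kappa>) * 1) at_top"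
    unfolding F_def using \<kappa> \<theta>
    by (intro tendsto_intros filterlim_compose[OF \<Phi>top]) real_asymp+
  have "set_integrable lborel (einterval 0 \<infinity>) f" "(LBINT x=0..\<infinity>. f x) = (exp (2 * \<kappa>) * 1 + exp (- 2 * \<kappa>) * 1) - (exp (2 * \<kappa>) * 1 + exp (- 2 * \<kappa>) * 0)"
  proof -
    have A: "((F \<circ> real_of_ereal) \<longlongrightarrow> exp (2 * \<kappa>) * 1 + exp (- 2 * \<kappa>) * 0) (at_right 0)"
      using lim0 by (simp add: zero_ereal_def ereal_tendsto_simps)
    have B: "((F \<circ> real_of_ereal) \<longlongrightarrow> exp (2 * \<kappa>) * 1 + exp (- 2 * \<kappa>) * 1) (at_left \<infinity>)"
      using limtop by (simp add: ereal_tendsto_simps)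
    show "set_integrable lborel (einterval 0 \<infinity>) f" "(LBINT x=0..\<infinity>. f x) = (exp (2 * \<kappa>) * 1 + exp (- 2 * \<kappa>) * 1) - (exp (2 * \<kappa>) * 1 + exp (- 2 * \<kappa>) * 0)"
      by (rule interval_integral_FTC_nonneg[OF _ _ _ _ A B]; use FD fcont fnn in \<open>auto simp: zero_ereal_def\<close>)+
  qed
  moreover have "einterval 0 \<infinity> = {0<..}" by (auto simp: einterval_def zero_ereal_def)
  ultimately show "integrable lborel (\<lambda>x. gamma_density (1/2) \<theta> x * exp (- c / x))"
    "(\<integral>x. gamma_density (1/2) \<theta> x * exp (- c / x) \<partial>lborel) = exp (- 2 * sqrt (c * \<theta>))"
    unfolding gd by (simp_all add: set_integrable_def interval_lebesgue_integral_def set_lebesgue_integral_def \<kappa>_def)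
qed

lemma joint_formula_algebra:
  assumes \<theta>: "0 < \<theta>" and xy: "0 < x" "0 < y"
  defines "s \<equiv> sqrt (2 * \<theta>)"
  shows "s / (s + m_fun \<theta> x + m_fun \<theta> y) = (1 - exp (- 2 * x * s)) * (1 - exp (- 2 * y * s)) / (1 - exp (- 2 * x * s) * exp (- 2 * y * s))"
    and "s / (s + m_fun \<theta> x + m_fun \<theta> y) = coth ((x + y) * s) - cosh ((x - y) * s) / sinh ((x + y) * s)"
proof -
  have s: "0 < s" using \<theta> by (simp add: s_def)
  define X Y where "X = exp (- 2 * x * s)" and "Y = exp (- 2 * y * s)"
  have X: "0 < X" "X < 1" and Y: "0 < Y" "Y < 1" using s xy by (auto simp: X_def Y_def)
  have XY: "X * Y < 1 * 1" using X Y by (intro mult_strict_mono) auto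
  have m: "m_fun \<theta> x = s * (X / (1 - X))" "m_fun \<theta> y = s * (Y / (1 - Y))"
    by (simp_all add: m_fun_def X_def Y_def s_def)
  have "1 + X / (1 - X) + Y / (1 - Y) = (1 - X * Y) / ((1 - X) * (1 - Y))"
    using X Y by (simp add: divide_simps) (simp add: algebra_simps)
  then have "s + m_fun \<theta> x + m_fun \<theta> y = s * ((1 - X * Y) / ((1 - X) * (1 - Y)))"
    unfolding m by (metis distrib_left mult.right_neutral)
  then show 1: "s / (s + m_fun \<theta> x + m_fun \<theta> y) = (1 - exp (- 2 * x * s)) * (1 - exp (- 2 * y * s)) / (1 - exp (- 2 * x * s) * exp (- 2 * y * s))"
    using s unfolding X_def Y_def by simp
  define p q where "p = exp (x * s)" and "q = exp (y * s)"
  have pq: "1 < p" "1 < q" using s xy by (auto simp: p_def q_def)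
  have e: "X = 1 / p\<^sup>2" "Y = 1 / q\<^sup>2"
    by (simp_all add: X_def Y_def p_def q_def exp_minus inverse_eq_divide flip: exp_double)
  have pq1: "1 < p * q" using pq by (metis less_1_mult)
  have pq2: "1 < p\<^sup>2 * q\<^sup>2" using pq1 by (simp flip: power_mult_distrib add: one_less_power)
  have sinh: "sinh ((x + y) * s) = (p * q - 1 / (p * q)) / 2" and cosh: "cosh ((x + y) * s) = (p * q + 1 / (p * q)) / 2"
    and cosh': "cosh ((x - y) * s) = (p / q + q / p) / 2"
    by (simp_all add: sinh_def cosh_def p_def q_def exp_add exp_diff exp_minus distrib_right left_diff_distrib inverse_eq_divide)
  have "coth ((x + y) * s) - cosh ((x - y) * s) / sinh ((x + y) * s) = ((p * q + 1 / (p * q)) - (p / q + q / p)) / (p * q - 1 / (p * q))"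
    unfolding coth_def sinh cosh cosh' by (simp add: diff_divide_distrib)
  also have "\<dots> = ((p * q + 1 / (p * q)) - (p / q + q / p)) * (p * q) / ((p * q - 1 / (p * q)) * (p * q))"
    using pq by simp
  also have "((p * q + 1 / (p * q)) - (p / q + q / p)) * (p * q) = (p\<^sup>2 - 1) * (q\<^sup>2 - 1)"
    using pq by (simp add: field_simps power2_eq_square)
  also have "(p * q - 1 / (p * q)) * (p * q) = p\<^sup>2 * q\<^sup>2 - 1"
    using pq by (simp add: field_simps power2_eq_square)
  also have "(p\<^sup>2 - 1) * (q\<^sup>2 - 1) / (p\<^sup>2 * q\<^sup>2 - 1) = (1 - X) * (1 - Y) / (1 - X * Y)"
  proof -
    have "(1 - X) * (1 - Y) / (1 - X * Y) = (p\<^sup>2 * q\<^sup>2 * ((1 - X) * (1 - Y))) / (p\<^sup>2 * q\<^sup>2 * (1 - X * Y))" using pq by simp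
    also have "p\<^sup>2 * q\<^sup>2 * (1 - X * Y) = p\<^sup>2 * q\<^sup>2 - 1" unfolding e using pq by (simp add: field_simps)
    also have "p\<^sup>2 * q\<^sup>2 * ((1 - X) * (1 - Y)) = (p\<^sup>2 - 1) * (q\<^sup>2 - 1)" unfolding e using pq by (simp add: field_simps)
    finally show ?thesis by simp
  qed
  finally show "s / (s + m_fun \<theta> x + m_fun \<theta> y) = coth ((x + y) * s) - cosh ((x - y) * s) / sinh ((x + y) * s)"
    unfolding 1 X_def Y_def by simp
qed

text \<open>Since \<open>kol (c / sqrt g) = exp (- 2 c^2 / g)\<close>, this is
  \<open>gamma_half_laplace_inverse\<close> with constant \<open>2 c^2\<close>. The result is
  exponential in \<open>c\<close>, hence multiplicative, so series in \<open>n\<close> become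
  geometric.\<close>

lemma (in prob_space) distributed_gamma_laplace_kol:
  assumes \<theta>: "0 < \<theta>" and D: "distributed M lborel \<gamma> (\<lambda>x. ennreal (gamma_density (1/2) \<theta> x))" and c: "0 \<le> c"
  shows "integrable M (\<lambda>\<omega>. kol (c / sqrt (\<gamma> \<omega>)))"
    and "expectation (\<lambda>\<omega>. kol (c / sqrt (\<gamma> \<omega>))) = exp (- 2 * c * sqrt (2 * \<theta>))"
proof -
  have [measurable]: "\<gamma> \<in> borel_measurable M" using distributed_measurable[OF D] by simp
  show "integrable M (\<lambda>\<omega>. kol (c / sqrt (\<gamma> \<omega>)))"
    using kol_le_1 kol_pos by (intro integrable_bounded[where B=1]) (auto simp: kol_def)
  have gnn: "0 \<le> gamma_density (1/2) \<theta> x" for x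
    using \<theta> by (auto simp: gamma_density_def Gamma_one_half_real)
  show "expectation (\<lambda>\<omega>. kol (c / sqrt (\<gamma> \<omega>))) = exp (- 2 * c * sqrt (2 * \<theta>))"
  proof (cases "c = 0")
    case True
    then show ?thesis by (simp add: prob_space)
  next
    case False
    then have c0: "0 < c" using c by simp
    have "expectation (\<lambda>\<omega>. kol (c / sqrt (\<gamma> \<omega>))) = (\<integral>g. gamma_density (1/2) \<theta> g * kol (c / sqrt g) \<partial>lborel)"
      by (rule distributed_integral[OF D, symmetric]) (auto simp: gnn kol_def)
    also have "\<dots> = (\<integral>g. gamma_density (1/2) \<theta> g * exp (- (2 * c\<^sup>2) / g) \<partial>lborel)"
    proof (intro Bochner_Integration.integral_cong refl)
      fix g :: real
      show "gamma_density (1/2) \<theta> g * kol (c / sqrt g) = gamma_density (1/2) \<theta> g * exp (- (2 * c\<^sup>2) / g)"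
        by (cases "0 < g") (simp_all add: kol_def power_divide gamma_density_def)
    qed
    also have "\<dots> = exp (- 2 * sqrt (2 * c\<^sup>2 * \<theta>))"
      using c0 by (intro gamma_half_laplace_inverse(2) \<theta>) simp
    also have "sqrt (2 * c\<^sup>2 * \<theta>) = c * sqrt (2 * \<theta>)" using c0 by (simp add: real_sqrt_mult)
    finally show ?thesis by (simp add: mult.assoc)
  qed
qed

text \<open>An argument \<open>n a + m b\<close> of \<open>kol\<close> turns into
  \<open>A^n B^m\<close>, and the second difference \<open>kterm n\<close> into
  \<open>(A B)^n (1 - A) (1 - B)\<close>. The exchange with the series is justified by
  \<open>4 * kol (n (a + b) / sqrt \<gamma>)\<close>, whose mean is
  \<open>4 (A B)^n\<close>.\<close>

lemma (in prob_space) expectation_range_cdf: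
  assumes \<theta>: "0 < \<theta>" and D: "distributed M lborel \<gamma> (\<lambda>x. ennreal (gamma_density (1/2) \<theta> x))" and ab: "0 < a" "0 < b"
  shows "expectation (\<lambda>\<omega>. range_cdf (a / sqrt (\<gamma> \<omega>)) (b / sqrt (\<gamma> \<omega>))) =
    (1 - exp (- 2 * a * sqrt (2 * \<theta>))) * (1 - exp (- 2 * b * sqrt (2 * \<theta>))) / (1 - exp (- 2 * a * sqrt (2 * \<theta>)) * exp (- 2 * b * sqrt (2 * \<theta>)))"
proof -
  define s where "s = sqrt (2 * \<theta>)"
  have s: "0 < s" using \<theta> by (simp add: s_def)
  define A B where "A = exp (- 2 * a * s)" and "B = exp (- 2 * b * s)"
  have A: "0 < A" "A < 1" and B: "0 < B" "B < 1" using s ab by (auto simp: A_def B_def)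
  have AB: "0 < A * B" "A * B < 1" using A B mult_strict_mono[of A 1 B 1] by auto
  let ?k = "\<lambda>c \<omega>. kol (c / sqrt (\<gamma> \<omega>))"
  note lap = distributed_gamma_laplace_kol[OF \<theta> D, folded s_def]
  let ?T = "\<lambda>n \<omega>. kterm n (a / sqrt (\<gamma> \<omega>)) (b / sqrt (\<gamma> \<omega>))"
  let ?c = "\<lambda>n::nat. real n * (a + b)"
  have ex: "exp (- 2 * (real n * a + real m * b) * s) = A ^ n * B ^ m" for n m
    by (simp add: A_def B_def exp_of_nat_mult[symmetric] exp_add[symmetric] algebra_simps)
  have args: "0 \<le> real n * a + real m * b" for n m using ab by simp
  have k: "?T n \<omega> = ?k (real n * a + real n * b) \<omega> + ?k (real (Suc n) * a + real (Suc n) * b) \<omega>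
     - ?k (real (Suc n) * a + real n * b) \<omega> - ?k (real n * a + real (Suc n) * b) \<omega>" for n \<omega>
    by (simp add: kterm_def add_divide_distrib distrib_left add.commute[of 1])
  have int: "integrable M (\<lambda>\<omega>. ?T n \<omega>)" for n
    unfolding k by (intro Bochner_Integration.integrable_diff Bochner_Integration.integrable_add lap(1) args)
  have val: "expectation (\<lambda>\<omega>. ?T n \<omega>) = (A * B) ^ n * ((1 - A) * (1 - B))" for n
  proof -
    have "expectation (\<lambda>\<omega>. ?T n \<omega>) = A ^ n * B ^ n + A ^ Suc n * B ^ Suc n - A ^ Suc n * B ^ n - A ^ n * B ^ Suc n"
      unfolding k using lap(1)[OF args] lap(2)[OF args] by (simp only: Bochner_Integration.integral_diff Bochner_Integration.integral_add
        Bochner_Integration.integrable_diff Bochner_Integration.integrable_add ex)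
    also have "\<dots> = (A * B) ^ n * ((1 - A) * (1 - B))" by (simp add: power_mult_distrib algebra_simps)
    finally show ?thesis .
  qed
  have bound: "\<bar>?T n \<omega>\<bar> \<le> 4 * ?k (?c n) \<omega>" if "0 < \<gamma> \<omega>" for n \<omega>
  proof -
    have le: "?k c \<omega> \<le> ?k (?c n) \<omega>" if "?c n \<le> c" for c
      using that \<open>0 < \<gamma> \<omega>\<close> ab by (intro kol_antimono divide_right_mono) auto
    have "?k (real n * a + real n * b) \<omega> \<le> ?k (?c n) \<omega>" by (rule le) (use ab in \<open>simp add: algebra_simps\<close>)
    moreover have "?k (real (Suc n) * a + real (Suc n) * b) \<omega> \<le> ?k (?c n) \<omega>" by (rule le) (use ab in \<open>simp add: algebra_simps\<close>)
    moreover have "?k (real (Suc n) * a + real n * b) \<omega> \<le> ?k (?c n) \<omega>" by (rule le) (use ab in \<open>simp add: algebra_simps\<close>)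
    moreover have "?k (real n * a + real (Suc n) * b) \<omega> \<le> ?k (?c n) \<omega>" by (rule le) (use ab in \<open>simp add: algebra_simps\<close>)
    ultimately show ?thesis unfolding k abs_le_iff
      using kol_pos[of "(real n * a + real n * b) / sqrt (\<gamma> \<omega>)"] kol_pos[of "(real (Suc n) * a + real (Suc n) * b) / sqrt (\<gamma> \<omega>)"]
        kol_pos[of "(real (Suc n) * a + real n * b) / sqrt (\<gamma> \<omega>)"] kol_pos[of "(real n * a + real (Suc n) * b) / sqrt (\<gamma> \<omega>)"] by linarith
  qed
  have pos: "AE \<omega> in M. 0 < \<gamma> \<omega>"
  proof (subst distributed_AE2[OF D, of "\<lambda>g. 0 < g"])
    show "AE g in lborel. 0 < ennreal (gamma_density (1/2) \<theta> g) \<longrightarrow> 0 < g" by (auto simp: gamma_density_def)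
  qed simp
  have mk: "?k c \<in> borel_measurable M" if "0 \<le> c" for c using lap(1)[OF that] by simp
  have "expectation (\<lambda>\<omega>. range_cdf (a / sqrt (\<gamma> \<omega>)) (b / sqrt (\<gamma> \<omega>))) = (\<Sum>n. expectation (\<lambda>\<omega>. ?T n \<omega>))"
    unfolding range_cdf_def
  proof (rule integral_suminf[OF int])
    show "AE \<omega> in M. summable (\<lambda>n. norm (?T n \<omega>))"
      using pos
    proof eventually_elim
      case (elim \<omega>)
      have "summable (\<lambda>n. 4 * kol (real n * ((a + b) / sqrt (\<gamma> \<omega>))))" using elim ab by (intro summable_mult summable_kol) simp
      then show ?case
        by (rule summable_comparison_test'[of _ 0]) (use bound[OF elim] in simp)
    qed
    show "summable (\<lambda>n. \<integral>\<omega>. norm (?T n \<omega>) \<partial>M)"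
    proof (rule summable_comparison_test'[of "\<lambda>n. 4 * (A * B) ^ n" 0])
      show "summable (\<lambda>n. 4 * (A * B) ^ n)" using AB by (intro summable_mult summable_geometric) simp
      fix n
      have cn: "0 \<le> ?c n" using ab by simp
      have "(\<integral>\<omega>. norm (?T n \<omega>) \<partial>M) \<le> (\<integral>\<omega>. 4 * ?k (?c n) \<omega> \<partial>M)"
      proof (rule integral_mono_AE)
        show "AE \<omega> in M. norm (?T n \<omega>) \<le> 4 * ?k (?c n) \<omega>"
          using pos by eventually_elim (use bound in simp)
      qed (use int lap(1)[OF cn] in simp_all)
      also have "\<dots> = 4 * exp (- 2 * ?c n * s)" by (subst integral_mult_right_zero) (simp only: lap(2)[OF cn])
      also have "\<dots> = 4 * (A * B) ^ n" using ex[of n n] by (simp add: power_mult_distrib distrib_left)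
      finally show "norm (\<integral>\<omega>. norm (?T n \<omega>) \<partial>M) \<le> 4 * (A * B) ^ n" by simp
    qed
  qed
  also have "\<dots> = (\<Sum>n. (A * B) ^ n * ((1 - A) * (1 - B)))" by (simp only: val)
  also have "\<dots> = 1 / (1 - A * B) * ((1 - A) * (1 - B))"
    using geometric_sums[of "A * B"] AB by (intro sums_unique[symmetric] sums_mult2) simp
  finally show ?thesis unfolding A_def B_def s_def by simp
qed

context brownian_bridge
begin

text \<open>Independence is given for the sigma-algebra of the restricted path in the product space,
  which sees only countably many times at once. The hypothesis \<open>path\<close> lets dyadic times
  determine the sublevel sets of \<open>V\<close>, so \<open>V\<close> is measurable for it.\<close>

lemma indep_functional:
  assumes ind: "indep_of_process M \<gamma> {0..1} U" and \<gamma>: "\<gamma> \<in> borel_measurable M" and V: "V \<in> borel_measurable M"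
    and path: "\<And>c. \<exists>S. closed S \<and> {\<omega>\<in>space M. V \<omega> \<le> c} = {\<omega>\<in>space M. \<forall>t\<in>{0..1}. U t \<omega> \<in> S}"
  shows "indep_var borel \<gamma> borel V"
proof -
  let ?F = "\<lambda>\<omega>. \<lambda>t\<in>{0..1}. U t \<omega>" and ?P = "PiM {0..1} (\<lambda>_. borel) :: (real \<Rightarrow> real) measure"
  let ?N = "vimage_algebra (space M) ?F ?P"
  have F: "?F \<in> space M \<rightarrow> space ?P" by (auto simp: space_PiM)
  have FN: "?F \<in> measurable ?N ?P" by (rule measurable_vimage_algebra1[OF F])
  have UN: "{\<omega>\<in>space M. U t \<omega> \<in> S} \<in> sets ?N" if t: "t \<in> {0..1}" and S: "closed S" for t and S :: "real set"
  proof -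
    have "(\<lambda>\<omega>. ?F \<omega> t) \<in> borel_measurable ?N" by (rule measurable_compose[OF FN measurable_component_singleton[OF t]])
    then have "(\<lambda>\<omega>. ?F \<omega> t) -` S \<inter> space ?N \<in> sets ?N" using S by (intro measurable_sets[of _ _ borel]) auto
    moreover have "(\<lambda>\<omega>. ?F \<omega> t) -` S \<inter> space ?N = {\<omega>\<in>space M. U t \<omega> \<in> S}" using t by auto
    ultimately show ?thesis by simp
  qed
  have VN: "V \<in> borel_measurable ?N"
    unfolding borel_measurable_iff_le
  proof
    fix c
    obtain S where S: "closed S" "{\<omega>\<in>space M. V \<omega> \<le> c} = {\<omega>\<in>space M. \<forall>t\<in>{0..1}. U t \<omega> \<in> S}" using path by blast
    have "{\<omega>\<in>space ?N. \<forall>s\<in>dyadic_grid i. U (s / (1 + s)) \<omega> \<in> S} \<in> sets ?N" for i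
    proof (rule sets.sets_Collect_finite_All[OF _ finite_dyadic_grid])
      fix s assume "s \<in> dyadic_grid i"
      then show "{\<omega>\<in>space ?N. U (s / (1 + s)) \<omega> \<in> S} \<in> sets ?N"
        using UN[OF dyadic_time S(1)] by simp
    qed
    then have "(\<Inter>i. {\<omega>\<in>space ?N. \<forall>s\<in>dyadic_grid i. U (s / (1 + s)) \<omega> \<in> S}) \<in> sets ?N"
      by (intro sets.countable_INT') auto
    then show "{\<omega>\<in>space ?N. V \<omega> \<le> c} \<in> sets ?N" using S path_event_eq[OF S(1)] by simp
  qed
  have sub: "sigma_sets (space M) {V -` A \<inter> space M |A. A \<in> sets borel} \<subseteq> sets ?N"
    using sets.sigma_sets_subset[of "{V -` A \<inter> space M |A. A \<in> sets borel}" ?N] measurable_sets[OF VN] by auto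
  have "indep_set (sets (vimage_algebra (space M) \<gamma> borel)) (sets ?N)" using ind by (simp add: indep_of_process_def)
  then have "indep_set (sigma_sets (space M) {\<gamma> -` A \<inter> space M |A. A \<in> sets borel}) (sigma_sets (space M) {V -` A \<inter> space M |A. A \<in> sets borel})"
    unfolding indep_set_def by (rule indep_sets_mono_sets) (use sub in \<open>auto simp: sets_vimage_algebra split: bool.splits\<close>)
  then show ?thesis unfolding indep_var_eq using \<gamma> V by blast
qed

text \<open>The joint law of the mixing variable and \<open>V\<close> is a product measure.
  Integrating over \<open>V\<close> first, with the value \<open>g\<close> of the mixing variable
  fixed, gives the range law at levels divided by \<open>sqrt g\<close>; its expectation is already
  known.\<close>

lemma scaled_joint_law:
  assumes \<theta>: "0 < \<theta>" and D: "distributed M lborel \<gamma> (\<lambda>x. ennreal (gamma_density (1/2) \<theta> x))"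
    and ind: "indep_of_process M \<gamma> {0..1} U" and xy: "0 < x" "0 < y"
  shows "prob {\<omega>\<in>space M. sqrt (\<gamma> \<omega>) * Mplus U \<omega> \<le> x \<and> sqrt (\<gamma> \<omega>) * Mminus U \<omega> \<le> y} =
    sqrt (2 * \<theta>) / (sqrt (2 * \<theta>) + m_fun \<theta> x + m_fun \<theta> y)"
proof -
  have m\<gamma>[measurable]: "\<gamma> \<in> borel_measurable M" using distributed_measurable[OF D] by simp
  \<comment> \<open>The joint event is the single inequality \<open>\<surd>\<gamma> V \<le> 1\<close>.\<close>
  define V where "V \<omega> = max (Mplus U \<omega> / x) (Mminus U \<omega> / y)" for \<omega>
  have V_le: "V \<omega> \<le> c \<longleftrightarrow> Mplus U \<omega> \<le> c * x \<and> Mminus U \<omega> \<le> c * y" for \<omega> c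
    using xy by (simp add: V_def pos_divide_le_eq)
  have mV[measurable]: "V \<in> borel_measurable M" unfolding V_def by measurable
  have iv: "indep_var borel \<gamma> borel V"
  proof (rule indep_functional[OF ind m\<gamma> mV])
    fix c
    have "{\<omega>\<in>space M. V \<omega> \<le> c} = {\<omega>\<in>space M. \<forall>t\<in>{0..1}. U t \<omega> \<in> {- (c * y)..c * x}}"
      using range_event_eq[of "c * y" "c * x"] by (simp add: V_le conj_commute)
    then show "\<exists>S. closed S \<and> {\<omega>\<in>space M. V \<omega> \<le> c} = {\<omega>\<in>space M. \<forall>t\<in>{0..1}. U t \<omega> \<in> S}" by (intro exI[of _ "{- (c * y)..c * x}"]) simp
  qed
  have pos: "AE \<omega> in M. 0 < \<gamma> \<omega>"
  proof (subst distributed_AE2[OF D, of "\<lambda>g. 0 < g"])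
    show "AE g in lborel. 0 < ennreal (gamma_density (1/2) \<theta> g) \<longrightarrow> 0 < g" by (auto simp: gamma_density_def)
  qed simp
  \<comment> \<open>The first argument of \<open>range_cdf\<close> belongs to \<open>Mminus\<close>,
    hence \<open>y\<close> before \<open>x\<close>.\<close>
  let ?G = "\<lambda>\<omega>. range_cdf (y / sqrt (\<gamma> \<omega>)) (x / sqrt (\<gamma> \<omega>))"
  have r01: "AE \<omega> in M. 0 \<le> ?G \<omega> \<and> ?G \<omega> \<le> 1"
    using pos by eventually_elim (use xy in \<open>simp flip: prob_range\<close>)
  let ?E = "{p \<in> space (borel \<Otimes>\<^sub>M borel). sqrt (fst p) * snd p \<le> (1::real)}"
  have E: "?E \<in> sets (borel \<Otimes>\<^sub>M borel)" by measurable
  interpret PV: prob_space "distr M borel V" by (rule prob_space_distr) simp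
  interpret PG: prob_space "distr M borel \<gamma>" by (rule prob_space_distr) simp
  have "prob {\<omega>\<in>space M. sqrt (\<gamma> \<omega>) * Mplus U \<omega> \<le> x \<and> sqrt (\<gamma> \<omega>) * Mminus U \<omega> \<le> y} = prob {\<omega>\<in>space M. sqrt (\<gamma> \<omega>) * V \<omega> \<le> 1}"
  proof (rule finite_measure_eq_AE)
    show "AE \<omega> in M. (\<omega> \<in> {\<omega>\<in>space M. sqrt (\<gamma> \<omega>) * Mplus U \<omega> \<le> x \<and> sqrt (\<gamma> \<omega>) * Mminus U \<omega> \<le> y}) = (\<omega> \<in> {\<omega>\<in>space M. sqrt (\<gamma> \<omega>) * V \<omega> \<le> 1})"
      using pos
    proof eventually_elim
      case (elim \<omega>)
      then have g: "0 < sqrt (\<gamma> \<omega>)" by simp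
      have "sqrt (\<gamma> \<omega>) * V \<omega> \<le> 1 \<longleftrightarrow> V \<omega> \<le> 1 / sqrt (\<gamma> \<omega>)" using g by (simp only: pos_le_divide_eq mult.commute)
      also have "\<dots> \<longleftrightarrow> sqrt (\<gamma> \<omega>) * Mplus U \<omega> \<le> x \<and> sqrt (\<gamma> \<omega>) * Mminus U \<omega> \<le> y"
        unfolding V_le using g by (simp add: pos_le_divide_eq mult.commute)
      finally show ?case by auto
    qed
  qed measurable
  also have "\<dots> = measure (distr M (borel \<Otimes>\<^sub>M borel) (\<lambda>\<omega>. (\<gamma> \<omega>, V \<omega>))) ?E"
    using E by (subst measure_distr) (auto intro!: arg_cong[where f=prob] simp: space_pair_measure)
  also have "distr M (borel \<Otimes>\<^sub>M borel) (\<lambda>\<omega>. (\<gamma> \<omega>, V \<omega>)) = distr M borel \<gamma> \<Otimes>\<^sub>M distr M borel V"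
    using indep_var_distribution_eq[of borel \<gamma> borel V] iv by simp
  also have "ennreal (measure (distr M borel \<gamma> \<Otimes>\<^sub>M distr M borel V) ?E) =
      (\<integral>\<^sup>+g. emeasure (distr M borel V) (Pair g -` ?E) \<partial>distr M borel \<gamma>)"
  proof -
    interpret PP: pair_prob_space "distr M borel \<gamma>" "distr M borel V" ..
    show ?thesis
      unfolding PP.emeasure_eq_measure[symmetric] using E by (intro PV.emeasure_pair_measure_alt) (simp add: sets_pair_measure_cong[OF sets_distr sets_distr])
  qed
  also have "\<dots> = (\<integral>\<^sup>+\<omega>. emeasure (distr M borel V) (Pair (\<gamma> \<omega>) -` ?E) \<partial>M)"
  proof (rule nn_integral_distr)
    have "?E \<in> sets (borel \<Otimes>\<^sub>M distr M borel V)" using E by (simp add: sets_pair_measure_cong[OF refl sets_distr])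
    from PV.measurable_emeasure_Pair[OF this] show "(\<lambda>g. emeasure (distr M borel V) (Pair g -` ?E)) \<in> borel_measurable (distr M borel \<gamma>)" by simp
  qed simp
  also have "\<dots> = (\<integral>\<^sup>+\<omega>. ennreal (?G \<omega>) \<partial>M)"
  proof (rule nn_integral_cong_AE, use pos in eventually_elim)
    fix \<omega> assume "0 < \<gamma> \<omega>"
    then have g: "0 < sqrt (\<gamma> \<omega>)" by simp
    have "Pair (\<gamma> \<omega>) -` ?E = {..1 / sqrt (\<gamma> \<omega>)}"
      using g by (auto simp: space_pair_measure pos_le_divide_eq mult.commute)
    then have "emeasure (distr M borel V) (Pair (\<gamma> \<omega>) -` ?E) = ennreal (prob {\<omega>'\<in>space M. V \<omega>' \<le> 1 / sqrt (\<gamma> \<omega>)})"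
      by (simp add: emeasure_distr emeasure_eq_measure vimage_def Int_def conj_commute)
    also have "prob {\<omega>'\<in>space M. V \<omega>' \<le> 1 / sqrt (\<gamma> \<omega>)} = ?G \<omega>"
      using prob_range[of "y / sqrt (\<gamma> \<omega>)" "x / sqrt (\<gamma> \<omega>)"] g xy by (simp add: V_le conj_commute)
    finally show "emeasure (distr M borel V) (Pair (\<gamma> \<omega>) -` ?E) = ennreal (?G \<omega>)" .
  qed
  also have "\<dots> = ennreal (expectation (\<lambda>\<omega>. ?G \<omega>))"
  proof (rule nn_integral_eq_integral)
    from r01 show "AE \<omega> in M. 0 \<le> ?G \<omega>" by eventually_elim simp
    show "integrable M (\<lambda>\<omega>. ?G \<omega>)"
    proof (rule integrable_const_bound)
      show "AE \<omega> in M. norm (?G \<omega>) \<le> 1" using r01 by eventually_elim simp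
      show "(\<lambda>\<omega>. ?G \<omega>) \<in> borel_measurable M"
        unfolding range_cdf_def kterm_def kol_def by measurable
    qed
  qed
  finally have "ennreal (prob {\<omega>\<in>space M. sqrt (\<gamma> \<omega>) * Mplus U \<omega> \<le> x \<and> sqrt (\<gamma> \<omega>) * Mminus U \<omega> \<le> y}) =
      ennreal (expectation (\<lambda>\<omega>. ?G \<omega>))" .
  moreover have "0 \<le> expectation (\<lambda>\<omega>. ?G \<omega>)"
  proof (rule integral_nonneg_AE)
    from r01 show "AE \<omega> in M. 0 \<le> ?G \<omega>" by eventually_elim simp
  qed
  ultimately have "prob {\<omega>\<in>space M. sqrt (\<gamma> \<omega>) * Mplus U \<omega> \<le> x \<and> sqrt (\<gamma> \<omega>) * Mminus U \<omega> \<le> y} =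
      expectation (\<lambda>\<omega>. ?G \<omega>)"
    by (simp add: ennreal_inj)
  then show ?thesis
    unfolding expectation_range_cdf[OF \<theta> D xy(2,1)] joint_formula_algebra(1)[OF \<theta> xy] by (simp add: mult.commute)
qed

end

theorem theorem6:
  fixes M :: "'a measure" and U :: "real \<Rightarrow> 'a \<Rightarrow> real"
  assumes "prob_space M"
    and "standard_brownian_bridge M U"
  shows
    "(\<forall>\<theta>>0. \<forall>\<gamma>.
        distributed M lborel \<gamma> (\<lambda>x. ennreal (gamma_density (1/2) \<theta> x)) \<and>
        indep_of_process M \<gamma> {0..1} U \<longrightarrow>
        (\<forall>x>0. \<forall>y>0.
           \<P>(\<omega> in M. sqrt (\<gamma> \<omega>) * Mplus U \<omega> \<le> x \<and> sqrt (\<gamma> \<omega>) * Mminus U \<omega> \<le> y)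
             = sqrt (2 * \<theta>) / (sqrt (2 * \<theta>) + m_fun \<theta> x + m_fun \<theta> y) \<and>
           sqrt (2 * \<theta>) / (sqrt (2 * \<theta>) + m_fun \<theta> x + m_fun \<theta> y)
             = coth ((x + y) * sqrt (2 * \<theta>))
               - cosh ((x - y) * sqrt (2 * \<theta>)) / sinh ((x + y) * sqrt (2 * \<theta>))))
     \<and>
     (\<forall>x>0.
        cdf (distr M borel (bridge_K U)) x = \<P>(\<omega> in M. Mplus U \<omega> + Mminus U \<omega> \<le> x) \<and>
        ((\<lambda>k::int. (1 - 4 * (of_int k)\<^sup>2 * x\<^sup>2) * exp (- 2 * (of_int k)\<^sup>2 * x\<^sup>2))
           has_sum \<P>(\<omega> in M. Mplus U \<omega> + Mminus U \<omega> \<le> x)) UNIV)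
     \<and>
     (\<forall>x>0.
        1 - cdf (distr M borel (bridge_L U)) x = \<P>(\<omega> in M. Mplus U \<omega> - Mminus U \<omega> \<ge> x) \<and>
        ((\<lambda>k::nat. 1 / (4 * (real k)\<^sup>2 - 1) * exp (- 2 * (real k)\<^sup>2 * x\<^sup>2))
           has_sum \<P>(\<omega> in M. Mplus U \<omega> - Mminus U \<omega> \<ge> x)) {1..})
     \<and>
     (\<forall>x>0.
        cdf (distr M borel (bridge_Q U)) x = \<P>(\<omega> in M. bridge_Q U \<omega> \<le> x) \<and>
        \<P>(\<omega> in M. bridge_Q U \<omega> \<le> x)
          = 1 / (x + 1) * (1 - pi * x * cot (pi * x / (x + 1)) / (x + 1)))"
proof -
  interpret brownian_bridge M U
    using assms by (simp add: brownian_bridge_def brownian_bridge_axioms_def)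
  show ?thesis
  proof (intro conjI allI impI)
    fix \<theta> :: real and \<gamma> and x y :: real
    assume \<theta>: "\<theta> > 0" and xy: "x > 0" "y > 0"
      and \<gamma>: "distributed M lborel \<gamma> (\<lambda>x. ennreal (gamma_density (1/2) \<theta> x)) \<and> indep_of_process M \<gamma> {0..1} U"
    show "prob {\<omega> \<in> space M. sqrt (\<gamma> \<omega>) * Mplus U \<omega> \<le> x \<and> sqrt (\<gamma> \<omega>) * Mminus U \<omega> \<le> y}
        = sqrt (2 * \<theta>) / (sqrt (2 * \<theta>) + m_fun \<theta> x + m_fun \<theta> y)"
      using \<gamma> by (intro scaled_joint_law \<theta> xy) auto
    show "sqrt (2 * \<theta>) / (sqrt (2 * \<theta>) + m_fun \<theta> x + m_fun \<theta> y)
        = coth ((x + y) * sqrt (2 * \<theta>)) - cosh ((x - y) * sqrt (2 * \<theta>)) / sinh ((x + y) * sqrt (2 * \<theta>))"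
      by (rule joint_formula_algebra(2)[OF \<theta> xy])
  next
    fix x :: real assume x: "x > 0"
    show "cdf (distr M borel (bridge_Q U)) x = prob {\<omega> \<in> space M. bridge_Q U \<omega> \<le> x}"
      by (rule cdf_distr_eq) simp
    show "prob {\<omega> \<in> space M. bridge_Q U \<omega> \<le> x} = 1 / (x + 1) * (1 - pi * x * cot (pi * x / (x + 1)) / (x + 1))"
      unfolding prob_Q[OF x] by (rule antideriv_Q_sum[OF x])
  qed (use law_K law_L in \<open>auto simp only:\<close>)
qed

end
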